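(* Let $\mu$ be a random probability measure supported on $n$ (distinct) points of the unit circle $\partial\mathbb U$. Assume that its modified Verblunsky coefficients $\gamma_i$, $0\le i\le n-1$, are independent and have rotationally invariant laws. Then the Palm measure of $\mu$ agrees (in law) with the $\varepsilon\to0$ limit in distribution of $\mu$ biased by the weight of the arc $\{e^{i\theta}:\theta\in(-\varepsilon,\varepsilon)\}$. The modified Verblunsky coefficients of the Palm measure are given (in law) by $$\gamma_i'=-\gamma_i\,\frac{1-\bar\gamma_i}{1-\gamma_i},\quad i=0,\dots,n-2,\qquad \gamma'_{n-1}=1.$$
   Context: $\mathbb U=\{|z|<1\}$. Modified Verblunsky coefficients. For a probability measure $\nu$ on $\partial\mathbb U$ whose support is exactly $n$ points, let $\Phi_k$, $0\le k\le n$, be its monic orthogonal polynomials ($\Phi_n$ being the monic polynomial of degree $n$ vanishing on the support), $\Phi_k^*(z)=z^k\overline{\Phi_k(1/\bar z)}$. The Verblunsky coefficients are defined by $\Phi_{k+1}(z)=z\Phi_k(z)-\bar\alpha_k\Phi_k^*(z)$, $0\le k\le n-1$; $|\alpha_k|<1$ for $k\le n-2$, $|\alpha_{n-1}|=1$. The modified Verblunsky coefficients are $\gamma_0=\bar\alpha_0$, $\gamma_k=\bar\alpha_k\prod_{j=0}^{k-1}\frac{1-\bar\gamma_j}{1-\gamma_j}$ for $1\le k\le n-1$. Thus $\gamma_0,\dots,\gamma_{n-2}\in\mathbb U$, $\gamma_{n-1}\in\partial\mathbb U$, and $\nu\leftrightarrow(\gamma_k)$ is a bijection. Biased measure: $\mu$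 biased by the weight of an arc $A$ is the random measure whose law has Radon–Nikodym derivative $\mu(A)/E\mu(A)$ with respect to the law of $\mu$. Palm measure (circle version): for a rotationally invariant random probability measure $\mu$ on $\partial\mathbb U$, given $\mu$ let $X$ be a random point picked from $\mu$; the Palm measure is the random measure $\mu(X\,\cdot)$, i.e. $B\mapsto\mu(XB)$ ($\mu$ rotated so that $X$ is moved to $1$). *)

theory Defs
  imports "HOL-Probability.Probability" "HOL-Computational_Algebra.Polynomial"
begin

definition circle :: "complex measure" where
  "circle = restrict_space borel (sphere 0 1)"

definition arc_around_one :: "real \<Rightarrow> complex set" where
  "arc_around_one \<epsilon> = {cis \<theta> |\<theta>. -\<epsilon> < \<theta> \<and> \<theta> < \<epsilon>}"

definition supp :: "complex measure \<Rightarrow> complex set" where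
  "supp \<nu> = {z \<in> sphere 0 1. \<forall>U. open U \<and> z \<in> U \<longrightarrow> emeasure \<nu> (U \<inter> sphere 0 1) > 0}"


section \<open>Modified Verblunsky coefficients\<close>

definition monic_orthogonal :: "complex measure \<Rightarrow> nat \<Rightarrow> complex poly \<Rightarrow> bool" where
  "monic_orthogonal \<nu> k p \<longleftrightarrow> degree p = k \<and> lead_coeff p = 1 \<and>
     (\<forall>q. degree q < k \<longrightarrow> (\<integral>z. poly p z * cnj (poly q z) \<partial>\<nu>) = 0)"

text \<open>Meaningful for finitely supported measures and degrees up to the size of the support,
  where the description in the second branch is unique.\<close>

definition monic_OP :: "complex measure \<Rightarrow> nat \<Rightarrow> complex poly" where
  "monic_OP \<nu> k =
     (if k = card (supp \<nu>) then \<Prod>a\<in>supp \<nu>. [:- a, 1:] else (THE p. monic_orthogonal \<nu> k p))"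

text \<open>The polynomial whose value at a nonzero \<open>z\<close> is
  \<open>z ^ degree p * cnj (poly p (1 / cnj z))\<close>.\<close>

definition reversed :: "complex poly \<Rightarrow> complex poly" where
  "reversed p = reflect_poly (map_poly cnj p)"

text \<open>The coefficients are only meaningful for measures supported on exactly \<open>n\<close> points and
  indices below \<open>n\<close>; the value 0 elsewhere is a convention which makes them total functions.\<close>

definition verblunsky :: "complex measure \<Rightarrow> nat \<Rightarrow> complex" where
  "verblunsky \<nu> k =
     (if finite (supp \<nu>) \<and> k < card (supp \<nu>)
      then (THE a. monic_OP \<nu> (Suc k) =
              pCons 0 (monic_OP \<nu> k) - smult (cnj a) (reversed (monic_OP \<nu> k)))
      else 0)"

text \<open>For \<open>k = 0\<close> the product is empty.\<close>

fun modified_verblunsky :: "complex measure \<Rightarrow> nat \<Rightarrow> complex" where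
  "modified_verblunsky \<nu> k = cnj (verblunsky \<nu> k) *
     (\<Prod>j\<in>{..<k}. (1 - cnj (modified_verblunsky \<nu> j)) / (1 - modified_verblunsky \<nu> j))"

declare modified_verblunsky.simps [simp del]


section \<open>Random measures on the circle and their laws\<close>

text \<open>A random probability measure is a random element of \<^term>\<open>prob_algebra circle\<close>, and its
  law is a measure on that space.\<close>

definition biased_law :: "complex measure measure \<Rightarrow> complex set \<Rightarrow> complex measure measure" where
  "biased_law L A = density L (\<lambda>\<nu>. emeasure \<nu> A / (\<integral>\<^sup>+ \<nu>'. emeasure \<nu>' A \<partial>L))"

text \<open>The measure \<open>B \<mapsto> \<nu> (x B)\<close> is the image of \<open>\<nu>\<close> under division by \<open>x\<close>.\<close>

definition rotate_to_one :: "complex measure \<Rightarrow> complex \<Rightarrow> complex measure" where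
  "rotate_to_one \<nu> x = distr \<nu> circle (\<lambda>z. z / x)"

definition palm_law :: "complex measure measure \<Rightarrow> complex measure measure" where
  "palm_law L = do {\<nu> \<leftarrow> L; x \<leftarrow> \<nu>; return (prob_algebra circle) (rotate_to_one \<nu> x)}"

text \<open>The coarsest topology for which integration against every continuous function on the circle
  is continuous.\<close>

definition weak_topology :: "complex measure topology" where
  "weak_topology =
     (let C = {g :: complex \<Rightarrow> real. continuous_on (sphere 0 1) g}
      in pullback_topology (space (prob_algebra circle))
           (\<lambda>\<nu>. \<lambda>g\<in>C. \<integral>z. g z \<partial>\<nu>)
           (product_topology (\<lambda>_. euclideanreal) C))"

definition converges_in_distribution ::
    "('i \<Rightarrow> complex measure measure) \<Rightarrow> complex measure measure \<Rightarrow> 'i filter \<Rightarrow> bool" where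
  "converges_in_distribution L P F \<longleftrightarrow>
     (\<forall>f :: complex measure \<Rightarrow> real.
        continuous_map weak_topology euclideanreal f \<and> bounded (f ` space (prob_algebra circle)) \<longrightarrow>
        ((\<lambda>i. \<integral>\<nu>. f \<nu> \<partial>L i) \<longlongrightarrow> (\<integral>\<nu>. f \<nu> \<partial>P)) F)"

definition rotationally_invariant :: "complex measure \<Rightarrow> bool" where
  "rotationally_invariant D \<longleftrightarrow> (\<forall>u\<in>sphere 0 1. distr D borel (\<lambda>z. u * z) = D)"

end

(*
  Write v_k for the conjugate Verblunsky coefficients, Phi_k for the orthogonal polynomials, and
  B_k = z Phi_k / Phi_k^*. Then v_k / B_k(x) is the k-th modified Verblunsky coefficient of the measure
  rotated by x, and it is 1 for k = n - 1 exactly when x is an atom. Given v_0, ..., v_(n-2), the last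
  coefficient v_(n-1) is uniform on the circle, and the moments of |Phi_(n-1)|^2 mu are polynomials in it;
  those of positive order have no constant term. Averaging therefore turns mu into the Bernstein-Szego
  measure (prod_(k<n-1) (1 - |v_k|^2)) / |Phi_(n-1)|^2 dx, whose density at x is the product of the Poisson
  kernels (1 - |g_k|^2) / |1 - g_k|^2 at g_k = v_k / B_k(x). As multiplying each v_k by a unimodular function
  of the previous ones preserves a product of rotation invariant laws, the Palm measure has the law of
  the g_k reweighted by Poisson kernels, and on each circle |g| = r this reweighting is the image of the
  uniform law under g -> -g (1 - conj g) / (1 - g). The convergence statement follows from rotation
  invariance of the law of mu: biasing by an arc A is the same as rotating the Palm measure by an
  independent uniform point of A.
*)
theory Submission
  imports Defs
begin

text \<open>Write m = n - 1. Moments of positive order must contain v_m without conjugates, since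
  only then do they average to zero. The conjugated factors of |Phi_m|^2 threaten this. On the
  support x Phi_m = v_m Phi_m^*, so one power of x is traded for a factor v_m, and the moments that
  remain conjugated have order at most m and do not see v_m. The average is taken of the joint law
  of a drawn point x and (v_0, ..., v_(m-1)), because the coefficients of the rotated measure depend
  on both. Multiplying by |Phi_m(x)|^2 first makes the moments computable; dividing by it afterwards
  is legitimate because Phi_m has no zero on the circle. Rotation invariance of the law of
  \<open>\<mu>\<close> is not assumed. For the coefficients it is immediate, but events in the space
  of measures are generated by masses of sets, so a measure has to be recovered measurably from its
  coefficients. The explicit formula for the moments serves this purpose too.\<close>

section \<open>Finite measures on the circle and integration of continuous functions\<close>

lemma space_circle [simp]: "space circle = sphere 0 1"
  by (simp add: circle_def space_restrict_space)

lemma borel_measurable_circle_continuous: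
  fixes f :: "complex \<Rightarrow> 'b::topological_space"
  assumes "continuous_on (sphere 0 1) f"
  shows "f \<in> borel_measurable circle"
  unfolding circle_def by (rule borel_measurable_continuous_on_restrict[OF assms])

lemma in_sets_circle: "A \<in> sets circle \<longleftrightarrow> A \<in> sets borel \<and> A \<subseteq> sphere 0 1"
proof -
  have "sphere 0 1 \<inter> space borel \<in> sets (borel :: complex measure)"
    by (simp add: borel_closed)
  then show ?thesis
    unfolding circle_def by (subst sets_restrict_space_iff) auto
qed

lemma prob_algebra_circleD:
  assumes "\<nu> \<in> space (prob_algebra circle)"
  shows "prob_space \<nu>" "sets \<nu> = sets circle" "space \<nu> = sphere 0 1" "finite_measure \<nu>"
proof -
  show "prob_space \<nu>" "sets \<nu> = sets circle"
    using assms by (auto simp: space_prob_algebra)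
  then show "space \<nu> = sphere 0 1" "finite_measure \<nu>"
    using sets_eq_imp_space_eq[of \<nu> circle] by (auto simp: prob_space_def)
qed

lemma integrable_circle_continuous:
  fixes f :: "complex \<Rightarrow> 'b::{banach, second_countable_topology}"
  assumes "finite_measure \<nu>" "sets \<nu> = sets circle" "continuous_on (sphere 0 1) f"
  shows "integrable \<nu> f"
proof -
  interpret finite_measure \<nu> by fact
  have "compact (f ` sphere 0 1)"
    by (intro compact_continuous_image assms) auto
  then obtain B where B: "\<And>z. z \<in> sphere 0 1 \<Longrightarrow> norm (f z) \<le> B"
    using compact_imp_bounded bounded_iff by (metis imageI)
  have "f \<in> borel_measurable \<nu>"
    using borel_measurable_circle_continuous[OF assms(3)] measurable_cong_sets[OF assms(2) refl] by blast
  then show ?thesis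
    using B assms(2)
    by (intro integrable_const_bound[where B=B] AE_I2) (auto dest: sets_eq_imp_space_eq)
qed

lemma AE_circleI:
  assumes "sets \<nu> = sets circle" "\<And>z. cmod z = 1 \<Longrightarrow> P z"
  shows "AE z in \<nu>. P z"
  using assms by (intro AE_I2) (auto dest: sets_eq_imp_space_eq)

lemma integral_cong_circle:
  assumes "sets \<nu> = sets circle" "\<And>z. cmod z = 1 \<Longrightarrow> f z = g z"
  shows "(\<integral>z. f z \<partial>\<nu>) = (\<integral>z. g z \<partial>\<nu>)"
  using assms by (intro Bochner_Integration.integral_cong) (auto dest: sets_eq_imp_space_eq)

lemma cnj_unit: "cmod z = 1 \<Longrightarrow> cnj z * z = 1" "cmod z = 1 \<Longrightarrow> z * cnj z = 1"
  using complex_norm_square[of z] by (auto simp: mult.commute)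

lemma cnj_unit_eq: "cmod z = 1 \<Longrightarrow> cnj z = 1 / z"
  by (metis cnj_unit(1) eq_divide_eq norm_zero zero_neq_one)

section \<open>Supports\<close>

text \<open>Second countability: every point outside the support has a null neighbourhood from a
  countable basis, so the complement is a countable union of null sets.\<close>

lemma compl_supp:
  assumes "sets \<nu> = sets circle"
  shows "AE z in \<nu>. z \<in> supp \<nu>"
proof -
  obtain B :: "complex set set" where B: "countable B" "topological_basis B"
    using ex_countable_basis by blast
  let ?N = "{U \<in> B. emeasure \<nu> (U \<inter> sphere 0 1) = 0}"
  have open_sets: "U \<inter> sphere 0 1 \<in> sets \<nu>" if "open U" for U
    using that assms by (auto simp: in_sets_circle intro!: sets.Int borel_open borel_closed)
  have "(\<Union>U\<in>?N. U \<inter> sphere 0 1) \<in> null_sets \<nu>"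
  proof (rule null_sets_UN')
    show "countable ?N" using B(1) by simp
    fix U assume "U \<in> ?N"
    then show "U \<inter> sphere 0 1 \<in> null_sets \<nu>"
      using open_sets topological_basis_open[OF B(2)] by (auto simp: null_sets_def)
  qed
  then have "AE z in \<nu>. z \<notin> (\<Union>U\<in>?N. U \<inter> sphere 0 1)"
    by (rule AE_not_in)
  moreover have "z \<in> supp \<nu>"
    if z: "z \<in> space \<nu>" "z \<notin> (\<Union>U\<in>?N. U \<inter> sphere 0 1)" for z
  proof -
    have zs: "z \<in> sphere 0 1" using z(1) sets_eq_imp_space_eq[OF assms] by simp
    have "emeasure \<nu> (U \<inter> sphere 0 1) > 0" if U: "open U" "z \<in> U" for U
    proof (rule ccontr)
      assume "\<not> ?thesis"
      then have 0: "emeasure \<nu> (U \<inter> sphere 0 1) = 0" by (simp add: not_gr_zero)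
      obtain V where V: "V \<in> B" "z \<in> V" "V \<subseteq> U"
        using topological_basisE[OF B(2) U] by blast
      have "emeasure \<nu> (V \<inter> sphere 0 1) \<le> emeasure \<nu> (U \<inter> sphere 0 1)"
        using V U open_sets by (intro emeasure_mono) auto
      then have "V \<in> ?N" using V 0 by auto
      then show False using z V zs by blast
    qed
    then show ?thesis using zs by (simp add: supp_def)
  qed
  ultimately show ?thesis
    using AE_space[of \<nu>] by (smt (verit, best) eventually_mono eventually_conj)
qed

text \<open>The complement of \<open>A\<close> is open and null, so it cannot be a neighbourhood of
  a point of the support.\<close>

lemma AE_closed_imp_supp:
  assumes "sets \<nu> = sets circle" "closed A" "AE z in \<nu>. z \<in> A"
  shows "supp \<nu> \<subseteq> A"
proof
  fix z assume z: "z \<in> supp \<nu>"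
  show "z \<in> A"
  proof (rule ccontr)
    assume "z \<notin> A"
    then have pos: "emeasure \<nu> (- A \<inter> sphere 0 1) > 0"
      using z assms(2) by (auto simp: supp_def)
    have m: "- A \<inter> sphere 0 1 \<in> sets \<nu>"
      using assms by (auto simp: in_sets_circle intro!: sets.Int borel_open borel_closed)
    have "AE z in \<nu>. z \<notin> - A \<inter> sphere 0 1"
      using assms(3) by eventually_elim auto
    then have "- A \<inter> sphere 0 1 \<in> null_sets \<nu>"
      using AE_iff_null_sets[OF m] by simp
    then show False using pos by auto
  qed
qed

lemma supp_subset_sphere: "supp \<nu> \<subseteq> sphere 0 1"
  by (auto simp: supp_def)

section \<open>Szego recursion\<close>

lemma coeff_reversed:
  "coeff (reversed p) i = (if i > degree p then 0 else cnj (coeff p (degree p - i)))"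
proof -
  have "degree (map_poly cnj p) = degree p" by (simp add: degree_map_poly)
  then show ?thesis by (simp add: reversed_def coeff_reflect_poly coeff_map_poly)
qed

lemma degree_reversed_le: "degree (reversed p) \<le> degree p"
  by (rule degree_le) (simp add: coeff_reversed)

lemma poly_reversed:
  assumes "cmod z = 1"
  shows "poly (reversed p) z = z ^ degree p * cnj (poly p z)"
proof -
  have d: "degree (map_poly cnj p) = degree p" by (simp add: degree_map_poly)
  have *: "poly (map_poly cnj p) (cnj z) = cnj (poly p z)"
    by (simp add: poly_altdef d coeff_map_poly)
  have "inverse z = cnj z" using cnj_unit_eq[OF assms] by (simp add: divide_simps)
  moreover have "z \<noteq> 0" using assms by auto
  ultimately show ?thesis
    using * d by (simp add: reversed_def poly_reflect_poly_nz)
qed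

text \<open>\<open>v k\<close> is the conjugate Verblunsky coefficient. Its modulus is not
  restricted, so that the dependence on a single \<open>v k\<close> can be studied as that of a
  polynomial.\<close>

primrec szego_poly :: "(nat \<Rightarrow> complex) \<Rightarrow> nat \<Rightarrow> complex poly" where
  "szego_poly v 0 = 1"
| "szego_poly v (Suc k) = pCons 0 (szego_poly v k) - smult (v k) (reversed (szego_poly v k))"

lemma degree_lead_coeff_szego_poly:
  "degree (szego_poly v k) = k \<and> coeff (szego_poly v k) k = 1"
proof (induction k)
  case (Suc k)
  let ?p = "szego_poly v k"
  have "coeff (reversed ?p) (Suc k) = 0" using Suc by (simp add: coeff_reversed)
  then have c: "coeff (szego_poly v (Suc k)) (Suc k) = 1"
    using Suc by simp
  have "degree (szego_poly v (Suc k)) \<le> Suc k"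
    using Suc degree_reversed_le[of ?p]
    by (auto intro!: degree_diff_le degree_pCons_le[THEN order_trans] degree_smult_le[THEN order_trans])
  moreover have "Suc k \<le> degree (szego_poly v (Suc k))"
    by (rule le_degree) (simp only: c, simp)
  ultimately show ?case using c by (metis order_antisym)
qed simp

lemmas degree_szego_poly [simp] = degree_lead_coeff_szego_poly[THEN conjunct1]
  and coeff_szego_poly_top [simp] = degree_lead_coeff_szego_poly[THEN conjunct2]

lemma szego_poly_nonzero [simp]: "szego_poly v k \<noteq> 0"
  by (metis coeff_0 coeff_szego_poly_top zero_neq_one)

text \<open>The same recursion for values on the unit circle, where the reversed polynomial takes
  the value \<open>z ^ k * cnj (szego v z k)\<close>. Off the circle the two recursions
  differ.\<close>

primrec szego :: "(nat \<Rightarrow> complex) \<Rightarrow> complex \<Rightarrow> nat \<Rightarrow> complex" where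
  "szego v z 0 = 1"
| "szego v z (Suc k) = z * szego v z k - v k * z ^ k * cnj (szego v z k)"

lemma poly_szego_poly: "cmod z = 1 \<Longrightarrow> poly (szego_poly v k) z = szego v z k"
  by (induction k) (simp_all add: poly_reversed)

lemma szego_poly_cong: "(\<And>j. j < k \<Longrightarrow> v j = w j) \<Longrightarrow> szego_poly v k = szego_poly w k"
  by (induction k) auto

lemma szego_cong: "(\<And>j. j < k \<Longrightarrow> v j = w j) \<Longrightarrow> szego v z k = szego w z k"
  by (induction k) auto

section \<open>Orthogonal polynomials produced by the recursion\<close>

lemma orthogonal_monomials_imp_orthogonal:
  assumes "finite_measure \<nu>" "sets \<nu> = sets circle"
    and orth: "\<And>j. j < k \<Longrightarrow> (\<integral>z. poly p z * cnj (z ^ j) \<partial>\<nu>) = 0" and "degree q < k"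
  shows "(\<integral>z. poly p z * cnj (poly q z) \<partial>\<nu>) = 0"
proof -
  have "(\<integral>z. poly p z * cnj (poly q z) \<partial>\<nu>) =
      (\<integral>z. (\<Sum>j\<le>degree q. cnj (coeff q j) * (poly p z * cnj (z ^ j))) \<partial>\<nu>)"
    by (simp add: poly_altdef sum_distrib_left mult_ac)
  also have "\<dots> = (\<Sum>j\<le>degree q. \<integral>z. cnj (coeff q j) * (poly p z * cnj (z ^ j)) \<partial>\<nu>)"
    by (intro Bochner_Integration.integral_sum integrable_circle_continuous[OF assms(1,2)] continuous_intros)
  also have "\<dots> = 0" using orth \<open>degree q < k\<close> by simp
  finally show ?thesis .
qed

text \<open>The denominator is nonzero as long as \<open>k\<close> is smaller than the size of the support.\<close>

primrec ortho_poly :: "complex measure \<Rightarrow> nat \<Rightarrow> complex poly" where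
  "ortho_poly \<nu> 0 = 1"
| "ortho_poly \<nu> (Suc k) = pCons 0 (ortho_poly \<nu> k) -
     smult ((\<integral>z. z * poly (ortho_poly \<nu> k) z \<partial>\<nu>) / of_real (\<integral>z. (cmod (poly (ortho_poly \<nu> k) z))\<^sup>2 \<partial>\<nu>))
       (reversed (ortho_poly \<nu> k))"

definition ortho_norm :: "complex measure \<Rightarrow> nat \<Rightarrow> real" where
  "ortho_norm \<nu> k = (\<integral>z. (cmod (poly (ortho_poly \<nu> k) z))\<^sup>2 \<partial>\<nu>)"

text \<open>The only value that makes Phi_(k+1) orthogonal to the constants, as long as the norm is
  nonzero: the integral of Phi_k^* is the squared norm of Phi_k.\<close>

definition szego_coeff :: "complex measure \<Rightarrow> nat \<Rightarrow> complex" where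
  "szego_coeff \<nu> k = (\<integral>z. z * poly (ortho_poly \<nu> k) z \<partial>\<nu>) / of_real (ortho_norm \<nu> k)"

lemma ortho_poly_eq: "ortho_poly \<nu> k = szego_poly (szego_coeff \<nu>) k"
  by (induction k) (simp_all add: szego_coeff_def ortho_norm_def)

text \<open>Multiplication by z is unitary on the circle, so pairing the recursion with z^j reduces
  both of its terms to pairings of Phi_k with monomials. For 1 <= j <= k these vanish by induction,
  for j = 0 the choice of the coefficient cancels them, and j = k + 1 yields the new factor 1 -
  |v_k|^2 of the squared norm.\<close>

lemma szego_orthogonality:
  assumes "\<nu> \<in> space (prob_algebra circle)" "\<And>i. i < k \<Longrightarrow> ortho_norm \<nu> i \<noteq> 0"
  shows "\<forall>j<k. (\<integral>z. poly (ortho_poly \<nu> k) z * cnj (z ^ j) \<partial>\<nu>) = 0"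
    and "(\<integral>z. poly (ortho_poly \<nu> k) z * cnj (z ^ k) \<partial>\<nu>) = of_real (ortho_norm \<nu> k)"
    and "ortho_norm \<nu> k = (\<Prod>j<k. 1 - (cmod (szego_coeff \<nu> j))\<^sup>2)"
proof -
  note nu = prob_algebra_circleD[OF assms(1)]
  interpret prob_space \<nu> by fact
  note int = integrable_circle_continuous[OF nu(4,2)]
  \<comment> \<open>Phi_k - z^k has degree below k and is therefore orthogonal to Phi_k, so pairing
    Phi_k with z^k is the same as pairing it with itself.\<close>
  have norm_top: "(\<integral>z. poly (ortho_poly \<nu> k) z * cnj (z ^ k) \<partial>\<nu>) = of_real (ortho_norm \<nu> k)"
    if orth: "\<And>j. j < k \<Longrightarrow> (\<integral>z. poly (ortho_poly \<nu> k) z * cnj (z ^ j) \<partial>\<nu>) = 0" for k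
  proof (cases k)
    case 0
    then show ?thesis by (simp add: ortho_norm_def prob_space)
  next
    case (Suc k')
    let ?p = "ortho_poly \<nu> k"
    let ?q = "?p - monom 1 k"
    have "degree ?q \<le> k"
      by (intro degree_diff_le) (auto simp: ortho_poly_eq degree_monom_le)
    moreover have "coeff ?q k = 0" by (simp add: ortho_poly_eq)
    ultimately have "degree ?q < k"
      using Suc by (metis degree_0 eq_zero_or_degree_less zero_less_Suc)
    from orthogonal_monomials_imp_orthogonal[OF nu(4,2) orth this, simplified]
    have "0 = (\<integral>z. poly ?p z * cnj (poly ?p z) - poly ?p z * cnj (z ^ k) \<partial>\<nu>)"
      by (simp add: poly_monom algebra_simps)
    also have "\<dots> = (\<integral>z. poly ?p z * cnj (poly ?p z) \<partial>\<nu>) - (\<integral>z. poly ?p z * cnj (z ^ k) \<partial>\<nu>)"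
      by (intro Bochner_Integration.integral_diff int continuous_intros)
    also have "(\<integral>z. poly ?p z * cnj (poly ?p z) \<partial>\<nu>) = of_real (ortho_norm \<nu> k)"
      unfolding ortho_norm_def
      by (subst integral_complex_of_real[symmetric]) (simp only: complex_norm_square)
    finally show ?thesis by simp
  qed
  have "(\<forall>j<k. (\<integral>z. poly (ortho_poly \<nu> k) z * cnj (z ^ j) \<partial>\<nu>) = 0) \<and>
      ortho_norm \<nu> k = (\<Prod>j<k. 1 - (cmod (szego_coeff \<nu> j))\<^sup>2)"
    using assms(2)
  proof (induction k)
    case 0
    then show ?case by (simp add: ortho_norm_def prob_space)
  next
    case (Suc k)
    define p where "p = ortho_poly \<nu> k"
    define a where "a = szego_coeff \<nu> k"
    define N where "N = ortho_norm \<nu> k"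
    have IH: "\<And>j. j < k \<Longrightarrow> (\<integral>z. poly p z * cnj (z ^ j) \<partial>\<nu>) = 0"
      and N: "N = (\<Prod>j<k. 1 - (cmod (szego_coeff \<nu> j))\<^sup>2)"
      using Suc by (auto simp: p_def N_def)
    have top: "(\<integral>z. poly p z * cnj (z ^ k) \<partial>\<nu>) = of_real N"
      using norm_top IH unfolding p_def N_def by blast
    have aN: "(\<integral>z. z * poly p z \<partial>\<nu>) = a * of_real N"
      using Suc.prems[of k] by (simp add: a_def szego_coeff_def p_def N_def)
    have dp: "degree p = k" by (simp add: p_def ortho_poly_eq)
    have rec: "ortho_poly \<nu> (Suc k) = pCons 0 p - smult a (reversed p)"
      by (simp add: p_def a_def szego_coeff_def ortho_norm_def)
    \<comment> \<open>On the circle the reversed polynomial is z^k times the conjugate of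
      \<open>p\<close>; its pairing with z^j is thus the conjugate of an integral that contains
      \<open>p\<close> unconjugated.\<close>
    have step: "(\<integral>z. poly (ortho_poly \<nu> (Suc k)) z * cnj (z ^ j) \<partial>\<nu>) =
       (\<integral>z. z * poly p z * cnj (z ^ j) \<partial>\<nu>) - a * cnj (\<integral>z. poly p z * z ^ j * cnj (z ^ k) \<partial>\<nu>)" for j
    proof -
      have "(\<integral>z. poly (ortho_poly \<nu> (Suc k)) z * cnj (z ^ j) \<partial>\<nu>) =
        (\<integral>z. z * poly p z * cnj (z ^ j) - a * cnj (poly p z * z ^ j * cnj (z ^ k)) \<partial>\<nu>)"
        by (intro integral_cong_circle[OF nu(2)])
           (simp add: rec poly_reversed dp algebra_simps del: ortho_poly.simps)
      also have "\<dots> = (\<integral>z. z * poly p z * cnj (z ^ j) \<partial>\<nu>) - (\<integral>z. a * cnj (poly p z * z ^ j * cnj (z ^ k)) \<partial>\<nu>)"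
        by (intro Bochner_Integration.integral_diff int continuous_intros)
      also have "(\<integral>z. a * cnj (poly p z * z ^ j * cnj (z ^ k)) \<partial>\<nu>) =
          a * cnj (\<integral>z. poly p z * z ^ j * cnj (z ^ k) \<partial>\<nu>)"
        by (simp only: integral_mult_right_zero Bochner_Integration.integral_cnj)
      finally show ?thesis .
    qed
    have shift: "(\<integral>z. z * poly p z * cnj (z ^ Suc j) \<partial>\<nu>) = (\<integral>z. poly p z * cnj (z ^ j) \<partial>\<nu>)" for j
      by (intro integral_cong_circle[OF nu(2)]) (simp add: cnj_unit)
    have shift': "(\<integral>z. poly p z * z ^ j * cnj (z ^ k) \<partial>\<nu>) = (\<integral>z. poly p z * cnj (z ^ (k - j)) \<partial>\<nu>)"
      if "j \<le> k" for j
    proof (intro integral_cong_circle[OF nu(2)])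
      fix z :: complex assume z: "cmod z = 1"
      have "cnj z ^ k = cnj z ^ j * cnj z ^ (k - j)"
        using that by (simp flip: power_add)
      moreover have "z ^ j * cnj z ^ j = 1"
        using cnj_unit(2)[OF z] by (simp flip: power_mult_distrib)
      ultimately show "poly p z * z ^ j * cnj (z ^ k) = poly p z * cnj (z ^ (k - j))"
        by (simp add: mult.assoc[symmetric])
    qed
    have orth: "(\<integral>z. poly (ortho_poly \<nu> (Suc k)) z * cnj (z ^ j) \<partial>\<nu>) = 0" if "j < Suc k" for j
    proof (cases j)
      case 0
      then show ?thesis using step[of 0] aN top shift'[of 0] by simp
    next
      case (Suc j')
      then have "(\<integral>z. z * poly p z * cnj (z ^ j) \<partial>\<nu>) = 0"
        using shift[of j'] IH[of j'] that by simp
      moreover have "(\<integral>z. poly p z * z ^ j * cnj (z ^ k) \<partial>\<nu>) = 0"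
        using shift'[of j] IH[of "k - j"] that Suc by simp
      ultimately show ?thesis using step by simp
    qed
    have "(\<integral>z. poly p z * z ^ Suc k * cnj (z ^ k) \<partial>\<nu>) = (\<integral>z. z * poly p z \<partial>\<nu>)"
      using cnj_unit
      by (intro integral_cong_circle[OF nu(2)]) (simp add: mult_ac flip: power_mult_distrib)
    then have "(\<integral>z. poly (ortho_poly \<nu> (Suc k)) z * cnj (z ^ Suc k) \<partial>\<nu>) = of_real N - a * cnj (a * of_real N)"
      using step[of "Suc k"] shift[of k] top aN by simp
    also have "\<dots> = of_real (N * (1 - (cmod a)\<^sup>2))"
      by (simp add: algebra_simps complex_norm_square[unfolded of_real_power])
    finally have "of_real (ortho_norm \<nu> (Suc k)) = complex_of_real (N * (1 - (cmod a)\<^sup>2))"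
      using norm_top[OF orth] by simp
    then have "ortho_norm \<nu> (Suc k) = N * (1 - (cmod a)\<^sup>2)"
      using of_real_eq_iff by blast
    then show ?case using orth N by (auto simp: a_def)
  qed
  then show "\<forall>j<k. (\<integral>z. poly (ortho_poly \<nu> k) z * cnj (z ^ j) \<partial>\<nu>) = 0"
    and "ortho_norm \<nu> k = (\<Prod>j<k. 1 - (cmod (szego_coeff \<nu> j))\<^sup>2)"
    by auto
  then show "(\<integral>z. poly (ortho_poly \<nu> k) z * cnj (z ^ k) \<partial>\<nu>) = of_real (ortho_norm \<nu> k)"
    using norm_top by blast
qed

lemma monic_orthogonal_ortho_poly:
  assumes "\<nu> \<in> space (prob_algebra circle)" "\<And>i. i < k \<Longrightarrow> ortho_norm \<nu> i \<noteq> 0"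
  shows "monic_orthogonal \<nu> k (ortho_poly \<nu> k)"
  unfolding monic_orthogonal_def
proof (intro conjI allI impI)
  fix q :: "complex poly" assume "degree q < k"
  then show "(\<integral>z. poly (ortho_poly \<nu> k) z * cnj (poly q z) \<partial>\<nu>) = 0"
    using szego_orthogonality(1)[OF assms]
    by (intro orthogonal_monomials_imp_orthogonal[OF prob_algebra_circleD(4,2)[OF assms(1)]]) auto
qed (simp_all add: ortho_poly_eq)

section \<open>Uniqueness of the orthogonal polynomials and identification of the Verblunsky
  coefficients\<close>

text \<open>The zero set of a polynomial is closed, so it has full measure exactly when it contains
  the support.\<close>

lemma norm_square_integral_eq_0_iff:
  assumes "\<nu> \<in> space (prob_algebra circle)"
  shows "(\<integral>z. (cmod (poly p z))\<^sup>2 \<partial>\<nu>) = 0 \<longleftrightarrow> (\<forall>a\<in>supp \<nu>. poly p a = 0)"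
proof -
  note nu = prob_algebra_circleD[OF assms]
  have "integrable \<nu> (\<lambda>z. (cmod (poly p z))\<^sup>2)"
    by (intro integrable_circle_continuous nu continuous_intros)
  then have "(\<integral>z. (cmod (poly p z))\<^sup>2 \<partial>\<nu>) = 0 \<longleftrightarrow> (AE z in \<nu>. z \<in> {z. poly p z = 0})"
    by (subst integral_nonneg_eq_0_iff_AE) auto
  also have "\<dots> \<longleftrightarrow> supp \<nu> \<subseteq> {z. poly p z = 0}"
  proof
    assume "AE z in \<nu>. z \<in> {z. poly p z = 0}"
    moreover have "closed {z. poly p z = 0}"
      by (intro closed_Collect_eq continuous_intros)
    ultimately show "supp \<nu> \<subseteq> {z. poly p z = 0}"
      using AE_closed_imp_supp nu(2) by blast
  next
    assume "supp \<nu> \<subseteq> {z. poly p z = 0}"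
    then show "AE z in \<nu>. z \<in> {z. poly p z = 0}"
      by (intro eventually_mono[OF compl_supp[OF nu(2)]]) auto
  qed
  finally show ?thesis by auto
qed

lemma poly_vanishing_eq_0:
  fixes p :: "'a::idom poly"
  assumes "finite S" "degree p < card S" "\<And>a. a \<in> S \<Longrightarrow> poly p a = 0"
  shows "p = 0"
proof (rule ccontr)
  assume "p \<noteq> 0"
  then have "card S \<le> card {x. poly p x = 0}"
    using assms poly_roots_finite by (intro card_mono) auto
  also have "\<dots> \<le> degree p" using card_poly_roots_bound[OF \<open>p \<noteq> 0\<close>] .
  finally show False using assms(2) by simp
qed

text \<open>The difference of two candidates has degree below k, hence is orthogonal to both and to
  itself. It vanishes on the support, which has more points than its degree allows.\<close>

lemma monic_orthogonal_unique:
  assumes "\<nu> \<in> space (prob_algebra circle)" "finite (supp \<nu>)" "k \<le> card (supp \<nu>)"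
    and p: "monic_orthogonal \<nu> k p" and q: "monic_orthogonal \<nu> k q"
  shows "p = q"
proof (cases "k = 0")
  case True
  then show ?thesis
    using p q by (metis degree_eq_zeroE lead_coeff_pCons(2) monic_orthogonal_def degree_pCons_0 coeff_pCons_0)
next
  case False
  note nu = prob_algebra_circleD[OF assms(1)]
  note int = integrable_circle_continuous[OF nu(4,2)]
  define r where "r = p - q"
  have "degree r \<le> k" "coeff r k = 0"
    using p q by (auto simp: r_def monic_orthogonal_def intro!: degree_diff_le)
  then have deg: "degree r < k"
    using False by (metis degree_0 eq_zero_or_degree_less gr0I)
  then have "(\<integral>z. poly p z * cnj (poly r z) \<partial>\<nu>) = 0" "(\<integral>z. poly q z * cnj (poly r z) \<partial>\<nu>) = 0"
    using p q by (auto simp: monic_orthogonal_def)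
  moreover have "(\<integral>z. poly r z * cnj (poly r z) \<partial>\<nu>) =
      (\<integral>z. poly p z * cnj (poly r z) \<partial>\<nu>) - (\<integral>z. poly q z * cnj (poly r z) \<partial>\<nu>)"
    by (subst Bochner_Integration.integral_diff[symmetric])
       (auto simp: r_def algebra_simps intro!: int continuous_intros)
  ultimately have "complex_of_real (\<integral>z. (cmod (poly r z))\<^sup>2 \<partial>\<nu>) = 0"
    by (subst integral_complex_of_real[symmetric]) (simp only: complex_norm_square diff_self)
  then have "\<forall>a\<in>supp \<nu>. poly r a = 0"
    using norm_square_integral_eq_0_iff[OF assms(1)] by simp
  then have "r = 0"
    using poly_vanishing_eq_0[OF assms(2), of r] deg assms(3) by auto
  then show ?thesis by (simp add: r_def)
qed

lemma ortho_norm_nonzero: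
  assumes "\<nu> \<in> space (prob_algebra circle)" "finite (supp \<nu>)" "k < card (supp \<nu>)"
  shows "ortho_norm \<nu> k \<noteq> 0"
proof
  assume "ortho_norm \<nu> k = 0"
  then have "\<forall>a\<in>supp \<nu>. poly (ortho_poly \<nu> k) a = 0"
    using norm_square_integral_eq_0_iff[OF assms(1)] by (simp add: ortho_norm_def)
  then have "ortho_poly \<nu> k = 0"
    using poly_vanishing_eq_0[OF assms(2), of "ortho_poly \<nu> k"] assms(3) by (simp add: ortho_poly_eq)
  then show False by (simp add: ortho_poly_eq)
qed

text \<open>A polynomial vanishing on the support is zero almost everywhere, hence orthogonal to
  everything. By uniqueness the special top degree in \<open>monic_OP\<close> therefore continues
  the same recursion.\<close>

lemma monic_orthogonal_prod_supp:
  assumes "\<nu> \<in> space (prob_algebra circle)" "finite (supp \<nu>)"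
  shows "monic_orthogonal \<nu> (card (supp \<nu>)) (\<Prod>a\<in>supp \<nu>. [:- a, 1:])"
  unfolding monic_orthogonal_def
proof (intro conjI allI impI)
  note nu = prob_algebra_circleD[OF assms(1)]
  let ?Z = "\<Prod>a\<in>supp \<nu>. [:- a, 1:]"
  show "degree ?Z = card (supp \<nu>)"
    by (subst degree_prod_sum_eq) auto
  show "lead_coeff ?Z = 1"
    by (simp add: lead_coeff_prod)
  fix q
  have "AE z in \<nu>. poly ?Z z * cnj (poly q z) = 0"
    using compl_supp[OF nu(2)]
    by (rule AE_mp) (use assms in \<open>auto simp: poly_prod intro!: AE_I2\<close>)
  then show "(\<integral>z. poly ?Z z * cnj (poly q z) \<partial>\<nu>) = 0"
    by (rule integral_eq_zero_AE)
qed

lemma ortho_poly_card_supp: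
  assumes "\<nu> \<in> space (prob_algebra circle)" "finite (supp \<nu>)"
  shows "ortho_poly \<nu> (card (supp \<nu>)) = (\<Prod>a\<in>supp \<nu>. [:- a, 1:])"
  using assms by (intro monic_orthogonal_unique[OF assms order_refl] monic_orthogonal_ortho_poly
      monic_orthogonal_prod_supp ortho_norm_nonzero) auto

lemma poly_ortho_poly_supp:
  assumes "\<nu> \<in> space (prob_algebra circle)" "finite (supp \<nu>)" "a \<in> supp \<nu>"
  shows "poly (ortho_poly \<nu> (card (supp \<nu>))) a = 0"
  using assms by (auto simp: ortho_poly_card_supp poly_prod)

lemma ortho_norm_card_supp:
  assumes "\<nu> \<in> space (prob_algebra circle)" "finite (supp \<nu>)"
  shows "ortho_norm \<nu> (card (supp \<nu>)) = 0"
  using poly_ortho_poly_supp[OF assms] norm_square_integral_eq_0_iff[OF assms(1)]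
  by (simp add: ortho_norm_def)

text \<open>Rephrases the size of the support by squared norms, which depend measurably on the
  measure. A zero norm at m confines the support to the at most m zeros of Phi_m, and a smaller
  support would have produced an earlier zero norm.\<close>

lemma finite_supp_iff_ortho_norm:
  assumes "\<nu> \<in> space (prob_algebra circle)"
  shows "finite (supp \<nu>) \<and> card (supp \<nu>) = m \<longleftrightarrow>
    ortho_norm \<nu> m = 0 \<and> (\<forall>i<m. ortho_norm \<nu> i \<noteq> 0)"
proof
  assume "finite (supp \<nu>) \<and> card (supp \<nu>) = m"
  then show "ortho_norm \<nu> m = 0 \<and> (\<forall>i<m. ortho_norm \<nu> i \<noteq> 0)"
    using ortho_norm_card_supp ortho_norm_nonzero assms by blast
next
  assume m: "ortho_norm \<nu> m = 0 \<and> (\<forall>i<m. ortho_norm \<nu> i \<noteq> 0)"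
  then have "\<forall>a\<in>supp \<nu>. poly (ortho_poly \<nu> m) a = 0"
    using norm_square_integral_eq_0_iff[OF assms] by (simp add: ortho_norm_def)
  then have sub: "supp \<nu> \<subseteq> {a. poly (ortho_poly \<nu> m) a = 0}" by auto
  have nz: "ortho_poly \<nu> m \<noteq> 0" by (simp add: ortho_poly_eq)
  have fin: "finite (supp \<nu>)"
    using sub finite_subset poly_roots_finite[OF nz] by blast
  have "card (supp \<nu>) \<le> card {a. poly (ortho_poly \<nu> m) a = 0}"
    using sub poly_roots_finite[OF nz] by (intro card_mono)
  also have "\<dots> \<le> m"
    using card_poly_roots_bound[OF nz] by (simp add: ortho_poly_eq)
  finally have "card (supp \<nu>) \<le> m" .
  moreover have "\<not> card (supp \<nu>) < m"
    using m ortho_norm_card_supp[OF assms fin] by auto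
  ultimately show "finite (supp \<nu>) \<and> card (supp \<nu>) = m" using fin by auto
qed

lemma monic_OP_eq:
  assumes "\<nu> \<in> space (prob_algebra circle)" "finite (supp \<nu>)" "k \<le> card (supp \<nu>)"
  shows "monic_OP \<nu> k = ortho_poly \<nu> k"
proof (cases "k = card (supp \<nu>)")
  case True
  then show ?thesis using assms by (simp add: monic_OP_def ortho_poly_card_supp)
next
  case False
  have "monic_orthogonal \<nu> k (ortho_poly \<nu> k)"
    using assms by (intro monic_orthogonal_ortho_poly ortho_norm_nonzero) auto
  then show ?thesis
    using False monic_orthogonal_unique[OF assms]
    by (auto simp: monic_OP_def intro!: the_equality)
qed

lemma verblunsky_eq:
  assumes "\<nu> \<in> space (prob_algebra circle)"
  shows "verblunsky \<nu> k = (if finite (supp \<nu>) \<and> k < card (supp \<nu>) then cnj (szego_coeff \<nu> k) else 0)"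
proof (cases "finite (supp \<nu>) \<and> k < card (supp \<nu>)")
  case True
  let ?p = "ortho_poly \<nu> k"
  \<comment> \<open>The constant coefficient of Phi_k^* is the conjugate of the leading coefficient
    of Phi_k. Comparing constant terms in the recursion therefore determines the
    coefficient.\<close>
  have nz: "coeff (reversed ?p) 0 = 1"
    by (simp add: coeff_reversed ortho_poly_eq)
  have rec: "ortho_poly \<nu> (Suc k) = pCons 0 ?p - smult (szego_coeff \<nu> k) (reversed ?p)"
    by (simp add: szego_coeff_def ortho_norm_def)
  have "(THE a. ortho_poly \<nu> (Suc k) = pCons 0 ?p - smult (cnj a) (reversed ?p)) = cnj (szego_coeff \<nu> k)"
  proof (rule the_equality)
    show "ortho_poly \<nu> (Suc k) = pCons 0 ?p - smult (cnj (cnj (szego_coeff \<nu> k))) (reversed ?p)"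
      using rec by simp
    fix a assume "ortho_poly \<nu> (Suc k) = pCons 0 ?p - smult (cnj a) (reversed ?p)"
    then have "coeff (smult (cnj a) (reversed ?p)) 0 = coeff (smult (szego_coeff \<nu> k) (reversed ?p)) 0"
      using rec by simp
    then show "a = cnj (szego_coeff \<nu> k)" using nz by (auto simp: complex_eq_iff)
  qed
  then show ?thesis
    using True assms by (simp add: verblunsky_def monic_OP_eq)
qed (auto simp: verblunsky_def)

text \<open>Only the recursion up to the size of the support is compared, since the later coefficients are
  junk.\<close>

lemma szego_coeff_eqI:
  assumes "\<nu> \<in> space (prob_algebra circle)" "finite (supp \<nu>)"
    and orth: "\<And>k. k \<le> card (supp \<nu>) \<Longrightarrow> monic_orthogonal \<nu> k (szego_poly v k)"
    and "k < card (supp \<nu>)"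
  shows "szego_coeff \<nu> k = v k"
proof -
  have eq: "ortho_poly \<nu> j = szego_poly v j" if "j \<le> card (supp \<nu>)" for j
    using that assms by (intro monic_orthogonal_unique[OF assms(1,2) that]
        monic_orthogonal_ortho_poly orth ortho_norm_nonzero) auto
  have "smult (szego_coeff \<nu> k) (reversed (szego_poly v k)) = smult (v k) (reversed (szego_poly v k))"
    using eq[of k] eq[of "Suc k"] assms(4) by (simp add: szego_coeff_def ortho_norm_def)
  then have "coeff (smult (szego_coeff \<nu> k) (reversed (szego_poly v k))) 0 =
      coeff (smult (v k) (reversed (szego_poly v k))) 0" by simp
  then show ?thesis by (simp add: coeff_reversed)
qed

text \<open>Each step multiplies the squared norm by 1 - |v_i|^2. The norm stays positive below the
  size of the support and vanishes on reaching it.\<close>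

lemma szego_coeff_bounds:
  assumes "\<nu> \<in> space (prob_algebra circle)" "finite (supp \<nu>)" "card (supp \<nu>) = Suc m"
  shows "i < m \<Longrightarrow> cmod (szego_coeff \<nu> i) < 1" and "cmod (szego_coeff \<nu> m) = 1"
proof -
  have N: "ortho_norm \<nu> i = (\<Prod>j<i. 1 - (cmod (szego_coeff \<nu> j))\<^sup>2)" if "i \<le> Suc m" for i
    using that assms by (intro szego_orthogonality ortho_norm_nonzero) auto
  have pos: "ortho_norm \<nu> i > 0" if "i < Suc m" for i
    using ortho_norm_nonzero[OF assms(1,2), of i] that assms(3)
    by (auto simp: ortho_norm_def less_le intro!: Bochner_Integration.integral_nonneg)
  have step: "ortho_norm \<nu> (Suc i) = ortho_norm \<nu> i * (1 - (cmod (szego_coeff \<nu> i))\<^sup>2)" if "i \<le> m" for i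
    using N[of i] N[of "Suc i"] that by simp
  show "cmod (szego_coeff \<nu> i) < 1" if "i < m"
  proof -
    have "1 - (cmod (szego_coeff \<nu> i))\<^sup>2 > 0"
      using step[of i] pos[of i] pos[of "Suc i"] that by (simp add: zero_less_mult_iff)
    then show ?thesis by (simp add: abs_square_less_1)
  qed
  have "ortho_norm \<nu> (Suc m) = 0" using ortho_norm_card_supp[OF assms(1,2)] assms(3) by simp
  then have "(cmod (szego_coeff \<nu> m))\<^sup>2 = 1" using step[of m] pos[of m] by simp
  then show "cmod (szego_coeff \<nu> m) = 1" by (simp add: power2_eq_1_iff) (smt (verit) norm_ge_zero)
qed

section \<open>Rotations\<close>

lemma measurable_divide_circle:
  assumes "cmod x = 1"
  shows "(\<lambda>z. z / x) \<in> circle \<rightarrow>\<^sub>M circle"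
  unfolding circle_def
  by (rule measurable_restrict_space3) (use assms in \<open>auto simp: norm_divide\<close>)

lemma rotate_to_one_in_prob_algebra:
  assumes "\<nu> \<in> space (prob_algebra circle)" "cmod x = 1"
  shows "rotate_to_one \<nu> x \<in> space (prob_algebra circle)"
proof -
  note nu = prob_algebra_circleD[OF assms(1)]
  have "(\<lambda>z. z / x) \<in> \<nu> \<rightarrow>\<^sub>M circle"
    using measurable_divide_circle[OF assms(2)] measurable_cong_sets[OF nu(2) refl] by blast
  then show ?thesis
    unfolding rotate_to_one_def space_prob_algebra
    by (auto intro!: prob_space.prob_space_distr nu)
qed

text \<open>Measurability is required jointly in both arguments, because the point of rotation is
  itself drawn from the measure.\<close>

lemma rotate_measurable:
  "(\<lambda>(\<nu>, x). rotate_to_one \<nu> x) \<in> prob_algebra circle \<Otimes>\<^sub>M circle \<rightarrow>\<^sub>M prob_algebra circle"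
proof -
  have "(\<lambda>p. snd p / snd (fst p)) \<in> (prob_algebra circle \<Otimes>\<^sub>M circle) \<Otimes>\<^sub>M circle \<rightarrow>\<^sub>M circle"
  proof -
    have id: "(\<lambda>x. x) \<in> circle \<rightarrow>\<^sub>M borel"
      by (rule borel_measurable_circle_continuous) auto
    have m: "snd \<in> (prob_algebra circle \<Otimes>\<^sub>M circle) \<Otimes>\<^sub>M circle \<rightarrow>\<^sub>M borel"
      "(\<lambda>p. snd (fst p)) \<in> (prob_algebra circle \<Otimes>\<^sub>M circle) \<Otimes>\<^sub>M circle \<rightarrow>\<^sub>M borel"
      by (rule measurable_compose[OF measurable_snd id],
          rule measurable_compose[OF measurable_compose[OF measurable_fst measurable_snd] id])
    show ?thesis
      by (subst (3) circle_def, rule measurable_restrict_space2)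
         (auto simp: space_pair_measure norm_divide intro!: borel_measurable_divide m)
  qed
  then show ?thesis
    unfolding rotate_to_one_def split_beta
    by (intro measurable_distr_prob_space2[where M=circle]) (auto simp: split_beta)
qed

lemma supp_rotate_to_one:
  assumes "\<nu> \<in> space (prob_algebra circle)" "cmod x = 1"
  shows "supp (rotate_to_one \<nu> x) = (\<lambda>z. z / x) ` supp \<nu>"
proof -
  note nu = prob_algebra_circleD[OF assms(1)]
  have x0: "x \<noteq> 0" using assms(2) by auto
  have meas: "(\<lambda>z. z / x) \<in> \<nu> \<rightarrow>\<^sub>M circle"
    using measurable_divide_circle[OF assms(2)] measurable_cong_sets[OF nu(2) refl] by blast
  have em: "emeasure (rotate_to_one \<nu> x) (U \<inter> sphere 0 1) = emeasure \<nu> ((\<lambda>z. z / x) -` U \<inter> sphere 0 1)"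
    if "open U" for U
  proof -
    have "U \<inter> sphere 0 1 \<in> sets circle"
      using that by (auto simp: in_sets_circle intro!: sets.Int borel_open borel_closed)
    then show ?thesis
      unfolding rotate_to_one_def
      by (subst emeasure_distr[OF meas]) (auto simp: nu(3) norm_divide assms(2) intro!: arg_cong[of _ _ "emeasure \<nu>"])
  qed
  have op: "open ((\<lambda>z. z / x) -` U)" if "open U" for U
    using that by (intro open_vimage continuous_intros) (use x0 in auto)
  have op': "open ((\<lambda>z. z * x) -` U)" if "open U" for U
    using that by (intro open_vimage continuous_intros)
  show ?thesis
  proof (intro equalityI subsetI)
    fix w assume w: "w \<in> supp (rotate_to_one \<nu> x)"
    have "w * x \<in> supp \<nu>"
      unfolding supp_def
    proof (intro CollectI conjI allI impI)
      show "w * x \<in> sphere 0 1" using w assms(2) by (auto simp: supp_def norm_mult)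
      fix U assume U: "open U \<and> w * x \<in> U"
      have "emeasure (rotate_to_one \<nu> x) ((\<lambda>z. z * x) -` U \<inter> sphere 0 1) > 0"
        using w op'[of U] U by (auto simp: supp_def)
      then show "emeasure \<nu> (U \<inter> sphere 0 1) > 0"
        using U em[OF op'] x0 by (simp add: vimage_def)
    qed
    then show "w \<in> (\<lambda>z. z / x) ` supp \<nu>"
      using x0 by (intro image_eqI[of _ _ "w * x"]) auto
  next
    fix w assume "w \<in> (\<lambda>z. z / x) ` supp \<nu>"
    then obtain z where z: "z \<in> supp \<nu>" "w = z / x" by auto
    show "w \<in> supp (rotate_to_one \<nu> x)"
      unfolding supp_def
    proof (intro CollectI conjI allI impI)
      show "w \<in> sphere 0 1" using z assms(2) by (auto simp: supp_def norm_divide)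
      fix U assume U: "open U \<and> w \<in> U"
      have "emeasure \<nu> ((\<lambda>z. z / x) -` U \<inter> sphere 0 1) > 0"
        using z op[of U] U by (auto simp: supp_def)
      then show "emeasure (rotate_to_one \<nu> x) (U \<inter> sphere 0 1) > 0"
        using em U by simp
    qed
  qed
qed

lemma card_supp_rotate_to_one:
  assumes "\<nu> \<in> space (prob_algebra circle)" "cmod x = 1"
  shows "finite (supp (rotate_to_one \<nu> x)) = finite (supp \<nu>)"
    "card (supp (rotate_to_one \<nu> x)) = card (supp \<nu>)"
proof -
  have "inj_on (\<lambda>z. z / x) (supp \<nu>)" using assms(2) by (auto simp: inj_on_def)
  then show "finite (supp (rotate_to_one \<nu> x)) = finite (supp \<nu>)"
    "card (supp (rotate_to_one \<nu> x)) = card (supp \<nu>)"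
    using supp_rotate_to_one[OF assms] by (simp_all add: finite_image_iff card_image)
qed

lemma integral_rotate_to_one:
  fixes f :: "complex \<Rightarrow> 'b::{banach, second_countable_topology}"
  assumes "\<nu> \<in> space (prob_algebra circle)" "cmod x = 1" "f \<in> borel_measurable circle"
  shows "(\<integral>z. f z \<partial>rotate_to_one \<nu> x) = (\<integral>z. f (z / x) \<partial>\<nu>)"
proof -
  note nu = prob_algebra_circleD[OF assms(1)]
  have "(\<lambda>z. z / x) \<in> \<nu> \<rightarrow>\<^sub>M circle"
    using measurable_divide_circle[OF assms(2)] measurable_cong_sets[OF nu(2) refl] by blast
  then show ?thesis unfolding rotate_to_one_def by (rule integral_distr[OF _ assms(3)])
qed

lemma szego_rotate:
  assumes "cmod x = 1" "cmod z = 1"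
  shows "szego (\<lambda>k. v k / x ^ Suc k) (z / x) k = szego v z k / x ^ k"
proof (induction k)
  case (Suc k)
  have x0: "x \<noteq> 0" using assms by auto
  have c: "cnj (szego v z k / x ^ k) = cnj (szego v z k) * x ^ k"
    using cnj_unit[OF assms(1)] x0 by (simp add: divide_simps flip: power_mult_distrib)
  show ?case
    using x0 unfolding szego.simps Suc c by (simp add: divide_simps power_divide algebra_simps)
qed simp

text \<open>The polynomials Phi_k(x z) / x^k are monic and orthogonal for the rotated measure, and
  they satisfy the recursion with the rescaled coefficients. Uniqueness does the rest.\<close>

lemma szego_coeff_rotate:
  assumes "\<nu> \<in> space (prob_algebra circle)" "finite (supp \<nu>)" "cmod x = 1" "k < card (supp \<nu>)"
  shows "szego_coeff (rotate_to_one \<nu> x) k = szego_coeff \<nu> k / x ^ Suc k"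
proof (rule szego_coeff_eqI)
  note nu = prob_algebra_circleD[OF assms(1)]
  let ?v = "szego_coeff \<nu>" and ?w = "\<lambda>k. szego_coeff \<nu> k / x ^ Suc k"
  show "rotate_to_one \<nu> x \<in> space (prob_algebra circle)"
    using rotate_to_one_in_prob_algebra assms by blast
  show "finite (supp (rotate_to_one \<nu> x))" "k < card (supp (rotate_to_one \<nu> x))"
    using assms card_supp_rotate_to_one by auto
  fix k assume "k \<le> card (supp (rotate_to_one \<nu> x))"
  then have k: "k \<le> card (supp \<nu>)" using assms card_supp_rotate_to_one by auto
  have orth: "monic_orthogonal \<nu> k (szego_poly ?v k)"
    unfolding ortho_poly_eq[symmetric]
    using k assms by (intro monic_orthogonal_ortho_poly ortho_norm_nonzero) auto
  show "monic_orthogonal (rotate_to_one \<nu> x) k (szego_poly ?w k)"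
    unfolding monic_orthogonal_def
  proof (intro conjI allI impI)
    fix q :: "complex poly" assume q: "degree q < k"
    \<comment> \<open>The test polynomial is pulled back along the rotation, which keeps its
      degree.\<close>
    let ?q = "pcompose q [:0, 1 / x:]"
    have "(\<integral>z. poly (szego_poly ?w k) z * cnj (poly q z) \<partial>rotate_to_one \<nu> x) =
        (\<integral>z. poly (szego_poly ?w k) (z / x) * cnj (poly q (z / x)) \<partial>\<nu>)"
      by (intro integral_rotate_to_one assms borel_measurable_circle_continuous continuous_intros)
    also have "\<dots> = (\<integral>z. (1 / x ^ k) * (poly (szego_poly ?v k) z * cnj (poly ?q z)) \<partial>\<nu>)"
    proof (intro integral_cong_circle[OF nu(2)])
      fix z :: complex assume z: "cmod z = 1"
      then have "cmod (z / x) = 1" using assms by (simp add: norm_divide)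
      then show "poly (szego_poly ?w k) (z / x) * cnj (poly q (z / x)) =
          1 / x ^ k * (poly (szego_poly ?v k) z * cnj (poly ?q z))"
        using z szego_rotate[OF assms(3) z]
        by (simp add: poly_szego_poly poly_pcompose)
    qed
    also have "\<dots> = 0"
    proof -
      have "degree ?q < k" using q by (simp add: degree_pcompose)
      then have "(\<integral>z. poly (szego_poly ?v k) z * cnj (poly ?q z) \<partial>\<nu>) = 0"
        using orth unfolding monic_orthogonal_def by blast
      then show ?thesis by (simp only: integral_mult_right_zero mult_zero_right)
    qed
    finally show "(\<integral>z. poly (szego_poly ?w k) z * cnj (poly q z) \<partial>rotate_to_one \<nu> x) = 0" .
  qed auto
qed

section \<open>Measurability of the coefficients\<close>

text \<open>Pushing \<open>K x\<close> forward along \<open>Pair x\<close> moves the dependence of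
  the integrand on the parameter into the measure, and integrating one fixed function is measurable
  in the measure.\<close>

lemma integral_measurable_kernel:
  fixes f :: "'a \<times> 'b \<Rightarrow> 'c::{banach, second_countable_topology}"
  assumes f[measurable]: "f \<in> borel_measurable (M \<Otimes>\<^sub>M N)" and K[measurable]: "K \<in> M \<rightarrow>\<^sub>M prob_algebra N"
  shows "(\<lambda>x. \<integral>y. f (x, y) \<partial>K x) \<in> borel_measurable M"
proof -
  have [measurable]: "(\<lambda>x. distr (K x) (M \<Otimes>\<^sub>M N) (Pair x)) \<in> M \<rightarrow>\<^sub>M subprob_algebra (M \<Otimes>\<^sub>M N)"
    by (intro measurable_distr2[where M=N] measurable_prob_algebraD K) simp
  have "(\<lambda>x. \<integral>p. f p \<partial>distr (K x) (M \<Otimes>\<^sub>M N) (Pair x)) \<in> borel_measurable M"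
    by measurable
  then show ?thesis
  proof (rule measurable_cong[THEN iffD1, rotated])
    fix x assume x: "x \<in> space M"
    then have "sets (K x) = sets N"
      using measurable_space[OF K] by (auto simp: space_prob_algebra)
    then have "Pair x \<in> K x \<rightarrow>\<^sub>M M \<Otimes>\<^sub>M N"
      using x by (simp cong: measurable_cong_sets)
    then show "(\<integral>p. f p \<partial>distr (K x) (M \<Otimes>\<^sub>M N) (Pair x)) = (\<integral>y. f (x, y) \<partial>K x)"
      by (rule integral_distr[OF _ f])
  qed
qed

lemma measurable_cnj [measurable]: "cnj \<in> borel_measurable borel"
  by (intro borel_measurable_continuous_onI continuous_intros)

lemma measurable_id_circle: "(\<lambda>x. x) \<in> circle \<rightarrow>\<^sub>M borel"
  by (rule borel_measurable_circle_continuous) auto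

text \<open>The induction alternates: joint measurability of the values of Phi_k in measure and
  point gives measurability of the norm and the coefficient, and these give the values of
  Phi_(k+1).\<close>

lemma
  shows measurable_szego_coeff [measurable]:
    "(\<lambda>\<nu>. szego_coeff \<nu> k) \<in> borel_measurable (prob_algebra circle)"
  and measurable_ortho_norm [measurable]:
    "(\<lambda>\<nu>. ortho_norm \<nu> k) \<in> borel_measurable (prob_algebra circle)"
proof -
  let ?P = "prob_algebra circle \<Otimes>\<^sub>M circle"
  have id[measurable]: "(\<lambda>\<nu>. \<nu>) \<in> prob_algebra circle \<rightarrow>\<^sub>M prob_algebra circle" by simp
  have *: "(\<lambda>\<nu>. szego_coeff \<nu> k) \<in> borel_measurable (prob_algebra circle) \<and>
      (\<lambda>\<nu>. ortho_norm \<nu> k) \<in> borel_measurable (prob_algebra circle)"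
    if p[measurable]: "(\<lambda>q. poly (ortho_poly (fst q) k) (snd q)) \<in> borel_measurable ?P" for k
  proof
    have [measurable]: "snd \<in> borel_measurable ?P"
      by (rule measurable_compose[OF measurable_snd measurable_id_circle])
    show N[measurable]: "(\<lambda>\<nu>. ortho_norm \<nu> k) \<in> borel_measurable (prob_algebra circle)"
      using integral_measurable_kernel[OF _ id, of "\<lambda>q. (cmod (poly (ortho_poly (fst q) k) (snd q)))\<^sup>2"]
      by (simp add: ortho_norm_def)
    have [measurable]: "(\<lambda>\<nu>. \<integral>z. z * poly (ortho_poly \<nu> k) z \<partial>\<nu>) \<in> borel_measurable (prob_algebra circle)"
      using integral_measurable_kernel[OF _ id, of "\<lambda>q. snd q * poly (ortho_poly (fst q) k) (snd q)"]
      by simp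
    show "(\<lambda>\<nu>. szego_coeff \<nu> k) \<in> borel_measurable (prob_algebra circle)"
      unfolding szego_coeff_def by measurable
  qed
  have "(\<lambda>q. poly (ortho_poly (fst q) k) (snd q)) \<in> borel_measurable ?P" for k
  proof (induction k)
    case 0
    then show ?case by simp
  next
    case (Suc k)
    note [measurable] = Suc *[OF Suc, THEN conjunct1]
    have [measurable]: "snd \<in> borel_measurable ?P"
      by (rule measurable_compose[OF measurable_snd measurable_id_circle])
    have "(\<lambda>q. snd q * poly (ortho_poly (fst q) k) (snd q) -
        szego_coeff (fst q) k * (snd q ^ k * cnj (poly (ortho_poly (fst q) k) (snd q)))) \<in> borel_measurable ?P"
      by measurable
    then show ?case
      by (rule measurable_cong[THEN iffD1, rotated])
         (auto simp: space_pair_measure poly_reversed ortho_poly_eq)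
  qed
  then show "(\<lambda>\<nu>. szego_coeff \<nu> k) \<in> borel_measurable (prob_algebra circle)"
    "(\<lambda>\<nu>. ortho_norm \<nu> k) \<in> borel_measurable (prob_algebra circle)"
    using * by blast+
qed

lemma measurable_finite_supp [measurable]:
  "Measurable.pred (prob_algebra circle) (\<lambda>\<nu>. finite (supp \<nu>) \<and> card (supp \<nu>) = m)"
proof -
  have "Measurable.pred (prob_algebra circle) (\<lambda>\<nu>. ortho_norm \<nu> m = 0 \<and> (\<forall>i<m. ortho_norm \<nu> i \<noteq> 0))"
    by measurable
  then show ?thesis
    by (rule measurable_cong[THEN iffD2, rotated]) (rule finite_supp_iff_ortho_norm)
qed

text \<open>The condition on the size of the support is spread over countably many measurable
  events, one for each size \<open>m\<close> above \<open>k\<close>.\<close>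

lemma measurable_verblunsky [measurable]:
  "(\<lambda>\<nu>. verblunsky \<nu> k) \<in> borel_measurable (prob_algebra circle)"
proof -
  have "(\<lambda>\<nu>. if \<exists>m. k < m \<and> finite (supp \<nu>) \<and> card (supp \<nu>) = m then cnj (szego_coeff \<nu> k) else 0)
      \<in> borel_measurable (prob_algebra circle)"
    by measurable
  then show ?thesis
    by (rule measurable_cong[THEN iffD2, rotated]) (auto simp: verblunsky_eq)
qed

lemma measurable_modified_verblunsky [measurable]:
  "(\<lambda>\<nu>. modified_verblunsky \<nu> k) \<in> borel_measurable (prob_algebra circle)"
proof (induction k rule: less_induct)
  case (less k)
  have [measurable]: "(\<lambda>\<nu>. \<Prod>j\<in>{..<k}. (1 - cnj (modified_verblunsky \<nu> j)) / (1 - modified_verblunsky \<nu> j))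
      \<in> borel_measurable (prob_algebra circle)"
    by (intro borel_measurable_prod borel_measurable_divide borel_measurable_diff borel_measurable_const
        measurable_compose[OF less measurable_cnj] less) auto
  show ?case
    unfolding modified_verblunsky.simps[of _ k] by measurable
qed

section \<open>Relative coefficients\<close>

text \<open>With the Blaschke product \<open>B_k z = z * szego v z k / (z ^ k * cnj (szego v z k))\<close> on the unit
  circle, \<open>relative_coeff v x k\<close> is \<open>v k / B_k x\<close>. At \<open>x = 1\<close> these are the modified Verblunsky
  coefficients, and moving \<open>x\<close> to \<open>1\<close> replaces them by their values at \<open>x\<close>. The value of
  \<open>unimodular\<close> at \<open>0\<close> keeps all these multipliers on the unit circle.\<close>

definition unimodular :: "complex \<Rightarrow> complex" where
  "unimodular c = (if c = 0 then 1 else cnj c / c)"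

definition relative_coeff :: "(nat \<Rightarrow> complex) \<Rightarrow> complex \<Rightarrow> nat \<Rightarrow> complex" where
  "relative_coeff v x k = v k * (x ^ k * unimodular (szego v x k) / x)"

lemma norm_unimodular [simp]: "cmod (unimodular c) = 1"
  by (simp add: unimodular_def norm_divide)

lemma norm_relative_coeff: "cmod x = 1 \<Longrightarrow> cmod (relative_coeff v x k) = cmod (v k)"
  by (simp add: relative_coeff_def norm_mult norm_divide norm_power)

lemma measurable_unimodular [measurable]: "unimodular \<in> borel_measurable borel"
  unfolding unimodular_def[abs_def] by measurable

text \<open>In this multiplicative form one factor per step carries nonvanishing, modulus and phase
  of the polynomial values.\<close>

lemma szego_Suc_relative:
  assumes "cmod x = 1" "szego v x k \<noteq> 0"
  shows "szego v x (Suc k) = x * szego v x k * (1 - relative_coeff v x k)"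
proof -
  have "x \<noteq> 0" using assms by auto
  then show ?thesis
    using assms(2) by (simp add: relative_coeff_def unimodular_def field_simps)
qed

lemma szego_nonzero:
  assumes "cmod x = 1" "\<And>j. j < k \<Longrightarrow> cmod (v j) < 1"
  shows "szego v x k \<noteq> 0"
  using assms(2)
proof (induction k)
  case (Suc k)
  then have IH: "szego v x k \<noteq> 0" by simp
  have "cmod (relative_coeff v x k) < 1"
    using Suc.prems[of k] norm_relative_coeff[OF assms(1)] by simp
  then have "relative_coeff v x k \<noteq> 1" by auto
  moreover have "x \<noteq> 0" using assms(1) by auto
  ultimately show ?case
    using IH szego_Suc_relative[OF assms(1) IH] by simp
qed simp

lemma norm_szego:
  assumes "cmod x = 1" "\<And>j. j < k \<Longrightarrow> cmod (v j) < 1"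
  shows "cmod (szego v x k) = (\<Prod>j<k. cmod (1 - relative_coeff v x j))"
  using assms(2)
proof (induction k)
  case (Suc k)
  then show ?case
    using szego_Suc_relative[OF assms(1) szego_nonzero[OF assms(1)], of k v] assms(1)
    by (simp add: norm_mult)
qed simp

text \<open>Identifies the product in the definition of the modified coefficients: it accumulates
  the squared inverse phase of Phi_k(1).\<close>

lemma unimodular_szego_1:
  assumes "\<And>j. j < k \<Longrightarrow> cmod (v j) < 1"
  shows "unimodular (szego v 1 k) = (\<Prod>j<k. (1 - cnj (relative_coeff v 1 j)) / (1 - relative_coeff v 1 j))"
  using assms
proof (induction k)
  case (Suc k)
  have nz: "szego v 1 k \<noteq> 0" "szego v 1 (Suc k) \<noteq> 0"
    using Suc.prems szego_nonzero[of 1] by (metis less_Suc_eq norm_one)+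
  have "unimodular (szego v 1 (Suc k)) =
      unimodular (szego v 1 k) * ((1 - cnj (relative_coeff v 1 k)) / (1 - relative_coeff v 1 k))"
    using nz szego_Suc_relative[of 1 v k] by (simp add: unimodular_def del: szego.simps)
  then show ?case using Suc by simp
qed (simp add: unimodular_def)

lemma modified_verblunsky_eq:
  assumes "\<nu> \<in> space (prob_algebra circle)" "finite (supp \<nu>)" "card (supp \<nu>) = Suc m" "k < Suc m"
  shows "modified_verblunsky \<nu> k = relative_coeff (szego_coeff \<nu>) 1 k"
  using assms(4)
proof (induction k rule: less_induct)
  case (less k)
  let ?v = "szego_coeff \<nu>"
  have "modified_verblunsky \<nu> k =
      ?v k * (\<Prod>j<k. (1 - cnj (relative_coeff ?v 1 j)) / (1 - relative_coeff ?v 1 j))"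
    using less assms by (subst modified_verblunsky.simps) (simp add: verblunsky_eq)
  also have "\<dots> = relative_coeff ?v 1 k"
    using less.prems szego_coeff_bounds(1)[OF assms(1-3)]
    by (subst unimodular_szego_1[symmetric]) (auto simp: relative_coeff_def)
  finally show ?case .
qed

text \<open>Inverts the defining product and so exhibits v_k as the k-th modified coefficient times
  a unimodular function of the earlier ones, the triangular form that \<open>distr_skew\<close>
  handles. Writing the factors with \<open>unimodular\<close> keeps them on the circle for every
  argument.\<close>

lemma szego_coeff_eq_modified:
  assumes "\<nu> \<in> space (prob_algebra circle)" "finite (supp \<nu>)" "card (supp \<nu>) = Suc m" "k < Suc m"
  shows "szego_coeff \<nu> k = modified_verblunsky \<nu> k *
    (\<Prod>j<k. unimodular (1 - cnj (modified_verblunsky \<nu> j)))"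
proof -
  let ?v = "szego_coeff \<nu>"
  have lt: "cmod (?v j) < 1" if "j < k" for j
    using szego_coeff_bounds(1)[OF assms(1-3)] that assms(4) by simp
  have nz: "1 - relative_coeff ?v 1 j \<noteq> 0" "1 - cnj (relative_coeff ?v 1 j) \<noteq> 0" if "j < k" for j
  proof -
    have "cmod (relative_coeff ?v 1 j) < 1" using lt[OF that] by (simp add: norm_relative_coeff)
    then show "1 - relative_coeff ?v 1 j \<noteq> 0" "1 - cnj (relative_coeff ?v 1 j) \<noteq> 0"
      by (auto simp: complex_eq_iff) (smt (verit) cmod_eq_Re one_complex.simps norm_one complex_eq_iff)+
  qed
  have "(\<Prod>j<k. unimodular (1 - cnj (modified_verblunsky \<nu> j))) =
     (\<Prod>j<k. (1 - relative_coeff ?v 1 j) / (1 - cnj (relative_coeff ?v 1 j)))"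
    using assms nz by (intro prod.cong) (auto simp: modified_verblunsky_eq unimodular_def)
  moreover have "relative_coeff ?v 1 k = ?v k * unimodular (szego ?v 1 k)"
    by (simp add: relative_coeff_def)
  moreover have "unimodular (szego ?v 1 k) *
     (\<Prod>j<k. (1 - relative_coeff ?v 1 j) / (1 - cnj (relative_coeff ?v 1 j))) = 1"
    using nz lt by (simp add: unimodular_szego_1 flip: prod.distrib)
  ultimately show ?thesis
    using modified_verblunsky_eq[OF assms] by (simp add: mult.assoc)
qed

lemma relative_coeff_rotate:
  assumes "cmod x = 1" "szego v x k \<noteq> 0"
  shows "relative_coeff (\<lambda>k. v k / x ^ Suc k) 1 k = relative_coeff v x k"
proof -
  have x0: "x \<noteq> 0" using assms by auto
  \<comment> \<open>Against this factor the division of \<open>v k\<close> by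
    \<open>x ^ Suc k\<close> leaves the power x^(k-1) that \<open>relative_coeff\<close>
    contains.\<close>
  have "unimodular (c / x ^ k) = unimodular c * x ^ (2 * k)" if "c \<noteq> 0" for c
  proof -
    have "cnj (c / x ^ k) = cnj c * x ^ k"
      using assms by (simp add: cnj_unit_eq power_divide)
    then show ?thesis using x0 that by (simp add: unimodular_def power_add mult_2 del: complex_cnj_divide)
  qed
  then have u: "unimodular (szego v x k / x ^ k) = unimodular (szego v x k) * x ^ (2 * k)"
    using assms(2) by blast
  have "szego (\<lambda>k. v k / x ^ Suc k) 1 k = szego v x k / x ^ k"
    using szego_rotate[OF assms(1,1), of v k] x0 by (simp del: power_Suc)
  then show ?thesis
    unfolding relative_coeff_def using u x0 by (simp add: mult_2 power_add del: power_Suc) simp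
qed

lemma relative_coeff_cong:
  "(\<And>j. j \<le> k \<Longrightarrow> v j = w j) \<Longrightarrow> relative_coeff v x k = relative_coeff w x k"
  using szego_cong[of k v w x] by (simp add: relative_coeff_def)

lemma modified_verblunsky_rotate:
  assumes "\<nu> \<in> space (prob_algebra circle)" "finite (supp \<nu>)" "card (supp \<nu>) = Suc m" "k < Suc m"
    and "cmod x = 1"
  shows "modified_verblunsky (rotate_to_one \<nu> x) k = relative_coeff (szego_coeff \<nu>) x k"
proof -
  have "modified_verblunsky (rotate_to_one \<nu> x) k =
      relative_coeff (szego_coeff (rotate_to_one \<nu> x)) 1 k"
    using assms rotate_to_one_in_prob_algebra card_supp_rotate_to_one[OF assms(1,5)]
    by (intro modified_verblunsky_eq[where m=m]) auto
  also have "\<dots> = relative_coeff (\<lambda>k. szego_coeff \<nu> k / x ^ Suc k) 1 k"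
    using assms by (intro relative_coeff_cong szego_coeff_rotate) auto
  also have "\<dots> = relative_coeff (szego_coeff \<nu>) x k"
    using szego_coeff_bounds(1)[OF assms(1-3)] assms(4,5)
    by (intro relative_coeff_rotate szego_nonzero) auto
  finally show ?thesis .
qed

text \<open>Phi_(m+1) vanishes at the atoms, while in its factorisation x and Phi_m(x) are nonzero,
  so the last factor must vanish.\<close>

lemma relative_coeff_supp:
  assumes "\<nu> \<in> space (prob_algebra circle)" "finite (supp \<nu>)" "card (supp \<nu>) = Suc m" "x \<in> supp \<nu>"
  shows "relative_coeff (szego_coeff \<nu>) x m = 1"
proof -
  let ?v = "szego_coeff \<nu>"
  have x: "cmod x = 1" using assms(4) supp_subset_sphere[of \<nu>] by auto
  have nz: "szego ?v x m \<noteq> 0"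
    using szego_coeff_bounds(1)[OF assms(1-3)] by (intro szego_nonzero x)
  have "szego ?v x (Suc m) = 0"
    using poly_ortho_poly_supp[OF assms(1,2,4)] poly_szego_poly[OF x] assms(3)
    by (simp add: ortho_poly_eq del: szego_poly.simps szego.simps)
  moreover have "x \<noteq> 0" using x by auto
  ultimately show ?thesis
    using szego_Suc_relative[OF x nz] nz by (simp del: szego.simps)
qed

section \<open>Trigonometric moments\<close>

text \<open>Under the real part a term with a negative power can be replaced by its conjugate, which
  has a positive power. Real parts of polynomials are thus closed under multiplication on the
  circle.\<close>

lemma Re_poly_times_cnj_poly:
  "\<exists>r. \<forall>z. cmod z = 1 \<longrightarrow> Re (poly p z * cnj (poly q z)) = Re (poly r z)"
proof (induction q arbitrary: p rule: pCons_induct)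
  case 0
  then show ?case by (intro exI[of _ 0]) simp
next
  case (pCons a q)
  obtain p0 p' where p: "p = pCons p0 p'" by (cases p rule: pCons_cases)
  obtain r where r: "\<forall>z. cmod z = 1 \<longrightarrow> Re (poly p' z * cnj (poly q z)) = Re (poly r z)"
    using pCons.IH by blast
  let ?r = "smult (cnj a) p + pCons 0 (smult (cnj p0) q) + r"
  have "Re (poly p z * cnj (poly (pCons a q) z)) = Re (poly ?r z)" if z: "cmod z = 1" for z
  proof -
    have "poly p z * cnj (poly (pCons a q) z) =
        cnj a * poly p z + p0 * cnj (z * poly q z) + (z * cnj z) * (poly p' z * cnj (poly q z))"
      by (simp add: p algebra_simps)
    moreover have "Re (p0 * cnj (z * poly q z)) = Re (cnj p0 * (z * poly q z))"
      by (simp add: algebra_simps)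
    ultimately show ?thesis
      using r z by (simp add: cnj_unit algebra_simps)
  qed
  then show ?case by blast
qed

text \<open>Stone-Weierstrass provides real polynomials in the two coordinates; on the circle these
  become real parts of complex polynomials, the functions whose integrals are governed by the
  moments of nonnegative order.\<close>

lemma trigonometric_approximation:
  fixes g :: "complex \<Rightarrow> real"
  assumes "continuous_on (sphere 0 1) g" "e > 0"
  shows "\<exists>p. \<forall>z. cmod z = 1 \<longrightarrow> \<bar>g z - Re (poly p z)\<bar> < e"
proof -
  obtain f where f: "real_polynomial_function f" "\<And>z. z \<in> sphere 0 1 \<Longrightarrow> \<bar>g z - f z\<bar> < e"
    using Stone_Weierstrass_real_polynomial_function[OF _ assms] by (metis compact_sphere)
  have "\<exists>p. \<forall>z. cmod z = 1 \<longrightarrow> f z = Re (poly p z)"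
    using f(1)
  proof induction
    case (linear f)
    \<comment> \<open>A real linear functional on the plane is the real part of multiplication by a
      complex number, here read off from its values at 1 and at the imaginary unit.\<close>
    have "f z = Re (poly [:0, Complex (f 1) (- f \<i>):] z)" for z
    proof -
      have "f z = f (Re z *\<^sub>R 1 + Im z *\<^sub>R \<i>)"
        by (rule arg_cong[of _ _ f]) (simp add: complex_eq_iff)
      also have "\<dots> = Re z * f 1 + Im z * f \<i>"
        using linear by (simp only: bounded_linear.linear linear_add linear_scale) simp
      finally show ?thesis by simp
    qed
    then show ?case by blast
  next
    case (const c)
    show ?case by (intro exI[of _ "[:of_real c:]"]) simp
  next
    case (add f g)
    then obtain p q where "\<forall>z. cmod z = 1 \<longrightarrow> f z = Re (poly p z)" "\<forall>z. cmod z = 1 \<longrightarrow> g z = Re (poly q z)"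
      by blast
    then show ?case by (intro exI[of _ "p + q"]) simp
  next
    case (mult f g)
    then obtain p q where pq: "\<forall>z. cmod z = 1 \<longrightarrow> f z = Re (poly p z)" "\<forall>z. cmod z = 1 \<longrightarrow> g z = Re (poly q z)"
      by blast
    obtain r where "\<forall>z. cmod z = 1 \<longrightarrow> Re (poly p z * cnj (poly q z)) = Re (poly r z)"
      using Re_poly_times_cnj_poly by blast
    \<comment> \<open>This is 2 Re a Re b = Re (a b) + Re (a conj b).\<close>
    then have "f z * g z = Re (poly (smult (1/2) (p * q + r)) z)" if "cmod z = 1" for z
      using pq that by (simp add: field_simps)
    then show ?case by blast
  qed
  then obtain p where p: "\<And>z. cmod z = 1 \<Longrightarrow> f z = Re (poly p z)" by blast
  have "\<bar>g z - Re (poly p z)\<bar> < e" if "cmod z = 1" for z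
    using f(2)[of z] p[OF that] that by simp
  then show ?thesis by blast
qed

text \<open>For \<open>F = {}\<close> this is constantly 1, since \<open>infdist\<close> is then constantly 0.\<close>

definition bump :: "complex set \<Rightarrow> nat \<Rightarrow> complex \<Rightarrow> real" where
  "bump F k z = max 0 (1 - real k * infdist z F)"

lemma continuous_on_bump: "continuous_on A (bump F k)"
  unfolding bump_def[abs_def] by (intro continuous_intros)

lemma bump_tendsto_measure:
  assumes "finite_measure \<nu>" "sets \<nu> = sets circle" "closed F" "F \<subseteq> sphere 0 1" "F \<noteq> {}"
  shows "(\<lambda>k. \<integral>z. bump F k z \<partial>\<nu>) \<longlonglongrightarrow> measure \<nu> F"
proof -
  interpret finite_measure \<nu> by fact
  have F: "F \<in> sets \<nu>" using assms by (auto simp: in_sets_circle borel_closed)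
  have "(\<lambda>k. \<integral>z. bump F k z \<partial>\<nu>) \<longlonglongrightarrow> (\<integral>z. indicator F z \<partial>\<nu>)"
  proof (rule integral_dominated_convergence[where w="\<lambda>_. 1"])
    show "(\<lambda>z. indicator F z) \<in> borel_measurable \<nu>" using F by simp
    show "bump F k \<in> borel_measurable \<nu>" for k
      using borel_measurable_circle_continuous[OF continuous_on_bump] measurable_cong_sets[OF assms(2) refl]
      by blast
    show "AE z in \<nu>. (\<lambda>k. bump F k z) \<longlonglongrightarrow> indicator F z"
    proof (rule AE_I2)
      fix z
      show "(\<lambda>k. bump F k z) \<longlonglongrightarrow> indicator F z"
      proof (cases "z \<in> F")
        case True
        then show ?thesis by (simp add: bump_def)
      next
        case False
        then have "infdist z F > 0"
          using assms(3,5) in_closed_iff_infdist_zero[of F z] infdist_nonneg[of z F] by fastforce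
        then obtain K :: nat where "1 / infdist z F < real K" using reals_Archimedean2 by blast
        then have "1 < real K * infdist z F"
          using \<open>infdist z F > 0\<close> by (simp add: divide_simps)
        then have "bump F k z = 0" if "k \<ge> K" for k
          using that mult_right_mono[of "real K" "real k" "infdist z F"] infdist_nonneg[of z F]
          by (simp add: bump_def)
        then show ?thesis
          using False by (intro tendsto_eventually) (auto simp: eventually_sequentially)
      qed
    qed
    show "AE z in \<nu>. norm (bump F k z) \<le> 1" for k
      by (simp add: bump_def infdist_nonneg)
  qed auto
  then show ?thesis using F by simp
qed

section \<open>Measures on the circle are determined by their moments\<close>

lemma sets_circle_closed: "sets circle = sigma_sets (sphere 0 1) {F. closed F \<and> F \<subseteq> sphere 0 1}"
proof -
  let ?S = "sphere 0 (1::real) :: complex set"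
  have "sets (restrict_space borel ?S) = (\<inter>) ?S ` sigma_sets UNIV (Collect closed)"
    unfolding sets_restrict_space by (simp add: borel_eq_closed)
  also have "\<dots> = sigma_sets ?S ((\<inter>) ?S ` Collect closed)"
    by (rule sigma_sets_Int) (auto intro: sigma_sets.Basic)
  also have "(\<inter>) ?S ` Collect closed = {F. closed F \<and> F \<subseteq> ?S}"
    by (auto intro: closed_Int)
  finally show ?thesis by (simp add: circle_def)
qed

lemma Int_stable_closed_subsets: "Int_stable {F. closed F \<and> F \<subseteq> (S :: complex set)}"
  by (auto simp: Int_stable_def)

text \<open>Moments of nonnegative order suffice, since those of negative order are their
  conjugates. Equality passes from real parts of polynomials to continuous functions by uniform
  approximation, from these to closed sets through \<open>bump\<close>, and closed sets form a
  generator stable under intersection.\<close>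

lemma measure_circle_eqI:
  assumes "finite_measure A" "sets A = sets circle" "finite_measure B" "sets B = sets circle"
    and mom: "\<And>j::nat. (\<integral>z. z ^ j \<partial>A) = (\<integral>z. z ^ j \<partial>B)"
  shows "A = B"
proof -
  have poly: "(\<integral>z. Re (poly p z) \<partial>A) = (\<integral>z. Re (poly p z) \<partial>B)" for p
  proof -
    have "(\<integral>z. poly p z \<partial>C) = (\<Sum>i\<le>degree p. coeff p i * (\<integral>z. z ^ i \<partial>C))"
      if "finite_measure C" "sets C = sets circle" for C
      unfolding poly_altdef
      by (subst Bochner_Integration.integral_sum)
         (auto intro!: integrable_circle_continuous[OF that] continuous_intros)
    then have "(\<integral>z. poly p z \<partial>A) = (\<integral>z. poly p z \<partial>B)"
      using assms by simp
    moreover have "(\<integral>z. Re (poly p z) \<partial>C) = Re (\<integral>z. poly p z \<partial>C)"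
      if "finite_measure C" "sets C = sets circle" for C
      by (intro integral_Re integrable_circle_continuous[OF that] continuous_intros)
    ultimately show ?thesis using assms by simp
  qed
  have cont: "(\<integral>z. g z \<partial>A) = (\<integral>z. g z \<partial>B)" if g: "continuous_on (sphere 0 1) g" for g :: "complex \<Rightarrow> real"
  proof -
    \<comment> \<open>The total masses bound the error of the approximation; adding 1 keeps the
      bound positive even if both measures are zero.\<close>
    define K where "K = measure A (space A) + measure B (space B) + 1"
    have K: "K > 0" by (simp add: K_def add_nonneg_pos)
    have "\<bar>(\<integral>z. g z \<partial>A) - (\<integral>z. g z \<partial>B)\<bar> \<le> e * K" if e: "e > 0" for e
    proof -
      obtain p where p: "\<And>z. cmod z = 1 \<Longrightarrow> \<bar>g z - Re (poly p z)\<bar> < e"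
        using trigonometric_approximation[OF g e] by blast
      have "\<bar>(\<integral>z. g z \<partial>C) - (\<integral>z. Re (poly p z) \<partial>C)\<bar> \<le> e * measure C (space C)"
        if C: "finite_measure C" "sets C = sets circle" for C
      proof -
        interpret finite_measure C by fact
        note int = integrable_circle_continuous[OF C]
        have "(\<integral>z. g z \<partial>C) - (\<integral>z. Re (poly p z) \<partial>C) = (\<integral>z. g z - Re (poly p z) \<partial>C)"
          by (rule Bochner_Integration.integral_diff[symmetric]) (intro int g continuous_intros)+
        also have "\<bar>\<dots>\<bar> \<le> (\<integral>z. \<bar>g z - Re (poly p z)\<bar> \<partial>C)"
          by (rule integral_abs_bound)
        also have "\<dots> \<le> (\<integral>z. e \<partial>C)"
          using p less_imp_le
          by (intro integral_mono_AE int continuous_intros g AE_circleI[OF C(2)]) auto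
        finally show ?thesis by (simp add: mult.commute)
      qed
      from this[OF assms(1,2)] this[OF assms(3,4)] poly[of p] show ?thesis
        using e by (simp add: K_def algebra_simps abs_le_iff)
    qed
    then have "\<bar>(\<integral>z. g z \<partial>A) - (\<integral>z. g z \<partial>B)\<bar> \<le> 0 + e" if "e > 0" for e
      using that K by (metis add_0 divide_pos_pos nonzero_mult_div_cancel_right times_divide_eq_left less_irrefl)
    then show ?thesis using field_le_epsilon by (metis abs_le_zero_iff right_minus_eq)
  qed
  interpret A: finite_measure A by fact
  interpret B: finite_measure B by fact
  have closed: "emeasure A F = emeasure B F" if "closed F" "F \<subseteq> sphere 0 1" for F
  proof (cases "F = {}")
    case False
    have "measure A F = measure B F"
      by (rule LIMSEQ_unique[OF bump_tendsto_measure[OF assms(1,2) that False]])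
         (use bump_tendsto_measure[OF assms(3,4) that False] cont[OF continuous_on_bump] in simp)
    then show ?thesis by (simp add: A.emeasure_eq_measure B.emeasure_eq_measure)
  qed simp
  show ?thesis
  proof (rule measure_eqI_generator_eq[OF Int_stable_closed_subsets[of "sphere 0 1"], where \<Omega>="sphere 0 1" and A="\<lambda>_. sphere 0 1"])
    show "sets A = sigma_sets (sphere 0 1) {F. closed F \<and> F \<subseteq> sphere 0 1}"
      "sets B = sigma_sets (sphere 0 1) {F. closed F \<and> F \<subseteq> sphere 0 1}"
      using assms sets_circle_closed by auto
  qed (auto simp: closed)
qed

text \<open>Orthogonality of \<open>szego_poly v i\<close> to the constants expresses the \<open>i\<close>-th moment by the lower ones;
  beyond the size of the support one uses that \<open>szego_poly v (Suc m)\<close> vanishes on it.\<close>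

function moment :: "(nat \<Rightarrow> complex) \<Rightarrow> nat \<Rightarrow> nat \<Rightarrow> complex" where
  "moment v m i = (if i = 0 then 1 else
     - (\<Sum>l<min i (Suc m). coeff (szego_poly v (min i (Suc m))) l * moment v m (i - min i (Suc m) + l)))"
  by auto
termination by (relation "Wellfounded.measure (\<lambda>(v, m, i). i)") auto

declare moment.simps [simp del]

lemma integral_power_eq_moment:
  assumes "\<nu> \<in> space (prob_algebra circle)" "finite (supp \<nu>)" "card (supp \<nu>) = Suc m"
  shows "(\<integral>z. z ^ i \<partial>\<nu>) = moment (szego_coeff \<nu>) m i"
proof (induction i rule: less_induct)
  case (less i)
  note nu = prob_algebra_circleD[OF assms(1)]
  interpret prob_space \<nu> by fact
  let ?v = "szego_coeff \<nu>"
  show ?case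
  proof (cases "i = 0")
    case True
    then show ?thesis by (simp add: moment.simps prob_space)
  next
    case False
    define K where "K = min i (Suc m)"
    have K: "0 < K" "K \<le> i" "K \<le> Suc m" using False by (auto simp: K_def)
    have "(\<integral>z. z ^ (i - K) * poly (szego_poly ?v K) z \<partial>\<nu>) = 0"
    proof (cases "i \<le> Suc m")
      case True
      then show ?thesis
        using szego_orthogonality(1)[OF assms(1), of K] ortho_norm_nonzero[OF assms(1,2)] K assms(3)
        by (auto simp: K_def ortho_poly_eq dest!: spec[of _ 0])
    next
      case False
      then have "K = card (supp \<nu>)" using assms by (simp add: K_def)
      then have "AE z in \<nu>. z ^ (i - K) * poly (szego_poly ?v K) z = 0"
        using poly_ortho_poly_supp[OF assms(1,2)] unfolding ortho_poly_eq[symmetric]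
        by (intro eventually_mono[OF compl_supp[OF nu(2)]]) simp
      then show ?thesis by (rule integral_eq_zero_AE)
    qed
    moreover have "(\<integral>z. z ^ (i - K) * poly (szego_poly ?v K) z \<partial>\<nu>) =
        (\<Sum>l\<le>K. coeff (szego_poly ?v K) l * (\<integral>z. z ^ (i - K + l) \<partial>\<nu>))"
    proof -
      have "(\<integral>z. z ^ (i - K) * poly (szego_poly ?v K) z \<partial>\<nu>) =
          (\<integral>z. (\<Sum>l\<le>K. coeff (szego_poly ?v K) l * z ^ (i - K + l)) \<partial>\<nu>)"
        by (simp add: poly_altdef sum_distrib_left power_add mult_ac)
      also have "\<dots> = (\<Sum>l\<le>K. \<integral>z. coeff (szego_poly ?v K) l * z ^ (i - K + l) \<partial>\<nu>)"
        by (intro Bochner_Integration.integral_sum integrable_circle_continuous[OF nu(4,2)] continuous_intros)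
      finally show ?thesis by simp
    qed
    moreover have "(\<Sum>l\<le>K. coeff (szego_poly ?v K) l * (\<integral>z. z ^ (i - K + l) \<partial>\<nu>)) =
        (\<Sum>l<K. coeff (szego_poly ?v K) l * moment ?v m (i - K + l)) + (\<integral>z. z ^ i \<partial>\<nu>)"
      using K less by (simp add: lessThan_Suc_atMost[symmetric])
    ultimately have "(\<integral>z. z ^ i \<partial>\<nu>) = - (\<Sum>l<K. coeff (szego_poly ?v K) l * moment ?v m (i - K + l))"
      by (simp add: eq_neg_iff_add_eq_0 add.commute)
    then show ?thesis using False by (subst moment.simps) (simp add: K_def)
  qed
qed

section \<open>Polynomial dependence on the last coefficient\<close>

text \<open>Only one coordinate is followed, with the others fixed: integrating over the last
  coefficient takes place at fixed values of the earlier ones.\<close>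

definition poly_in_coord :: "nat \<Rightarrow> ((nat \<Rightarrow> complex) \<Rightarrow> complex) \<Rightarrow> bool" where
  "poly_in_coord m f \<longleftrightarrow> (\<forall>v. \<exists>p. \<forall>a. f (v(m := a)) = poly p a)"

lemma poly_in_coord_indep:
  "(\<And>v a. f (v(m := a)) = f v) \<Longrightarrow> poly_in_coord m f"
  unfolding poly_in_coord_def by (intro allI, rule_tac x="[:f v:]" in exI) simp

lemma poly_in_coord_proj: "poly_in_coord m (\<lambda>v. v m)"
  unfolding poly_in_coord_def by (intro allI exI[of _ "[:0, 1:]"]) simp

lemma poly_in_coord_mult:
  "poly_in_coord m f \<Longrightarrow> poly_in_coord m g \<Longrightarrow> poly_in_coord m (\<lambda>v. f v * g v)"
  unfolding poly_in_coord_def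
proof
  fix v
  assume "\<forall>v. \<exists>p. \<forall>a. f (v(m := a)) = poly p a" "\<forall>v. \<exists>p. \<forall>a. g (v(m := a)) = poly p a"
  then obtain p q where "\<forall>a. f (v(m := a)) = poly p a" "\<forall>a. g (v(m := a)) = poly q a"
    by blast
  then show "\<exists>p. \<forall>a. f (v(m := a)) * g (v(m := a)) = poly p a"
    by (intro exI[of _ "p * q"]) simp
qed

lemma poly_in_coord_diff:
  "poly_in_coord m f \<Longrightarrow> poly_in_coord m g \<Longrightarrow> poly_in_coord m (\<lambda>v. f v - g v)"
  unfolding poly_in_coord_def
proof
  fix v
  assume "\<forall>v. \<exists>p. \<forall>a. f (v(m := a)) = poly p a" "\<forall>v. \<exists>p. \<forall>a. g (v(m := a)) = poly p a"
  then obtain p q where "\<forall>a. f (v(m := a)) = poly p a" "\<forall>a. g (v(m := a)) = poly q a"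
    by blast
  then show "\<exists>p. \<forall>a. f (v(m := a)) - g (v(m := a)) = poly p a"
    by (intro exI[of _ "p - q"]) simp
qed

lemma poly_in_coord_sum:
  assumes "\<And>i. i \<in> I \<Longrightarrow> poly_in_coord m (f i)"
  shows "poly_in_coord m (\<lambda>v. \<Sum>i\<in>I. f i v)"
  unfolding poly_in_coord_def
proof
  fix v
  have "\<forall>i\<in>I. \<exists>p. \<forall>a. f i (v(m := a)) = poly p a"
    using assms unfolding poly_in_coord_def by blast
  from bchoice[OF this] obtain p where "\<forall>i\<in>I. \<forall>a. f i (v(m := a)) = poly (p i) a" ..
  then show "\<exists>p. \<forall>a. (\<Sum>i\<in>I. f i (v(m := a))) = poly p a"
    by (intro exI[of _ "\<Sum>i\<in>I. p i"]) (simp add: poly_sum)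
qed

lemma poly_in_coord_uminus:
  "poly_in_coord m f \<Longrightarrow> poly_in_coord m (\<lambda>v. - f v)"
  unfolding poly_in_coord_def
proof
  fix v
  assume "\<forall>v. \<exists>p. \<forall>a. f (v(m := a)) = poly p a"
  then obtain p where "\<forall>a. f (v(m := a)) = poly p a" by blast
  then show "\<exists>p. \<forall>a. - f (v(m := a)) = poly p a"
    by (intro exI[of _ "- p"]) simp
qed

text \<open>Only degree m + 1 sees \<open>v m\<close>, and there it occurs linearly and without
  conjugation, since Phi_m^* involves the earlier coefficients alone.\<close>

lemma poly_in_coord_coeff:
  assumes "k \<le> Suc m"
  shows "poly_in_coord m (\<lambda>v. coeff (szego_poly v k) l)"
proof (cases "k = Suc m")
  case True
  have indep: "szego_poly (v(m := a)) m = szego_poly v m" for v a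
    by (rule szego_poly_cong) simp
  have "poly_in_coord m (\<lambda>v. coeff (pCons 0 (szego_poly v m)) l - v m * coeff (reversed (szego_poly v m)) l)"
    by (intro poly_in_coord_diff poly_in_coord_mult poly_in_coord_proj poly_in_coord_indep[of "\<lambda>v. coeff (reversed (szego_poly v m)) l"]
        poly_in_coord_indep[of "\<lambda>v. coeff (pCons 0 (szego_poly v m)) l"]) (simp_all add: indep)
  then show ?thesis using True by simp
next
  case False
  then have "szego_poly (v(m := a)) k = szego_poly v k" for v a
    using assms by (intro szego_poly_cong) simp
  then show ?thesis by (intro poly_in_coord_indep) simp
qed

lemma moment_indep:
  "i \<le> m \<Longrightarrow> moment (v(m := a)) m i = moment v m i"
proof (induction i rule: less_induct)
  case (less i)
  have "szego_poly (v(m := a)) i = szego_poly v i"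
    using less.prems by (intro szego_poly_cong) simp
  moreover have "moment (v(m := a)) m l = moment v m l" if "l < i" for l
    using less.prems that by (intro less.IH) auto
  ultimately show ?case
    using less.prems by (subst (1 2) moment.simps) (simp add: min_absorb1)
qed

lemma poly_in_coord_moment: "poly_in_coord m (\<lambda>v. moment v m i)"
proof (induction i rule: less_induct)
  case (less i)
  show ?case
  proof (cases "i = 0")
    case True
    then show ?thesis by (intro poly_in_coord_indep) (simp add: moment.simps)
  next
    case False
    have "poly_in_coord m (\<lambda>v. - (\<Sum>l<min i (Suc m).
        coeff (szego_poly v (min i (Suc m))) l * moment v m (i - min i (Suc m) + l)))"
      using False
      by (intro poly_in_coord_uminus poly_in_coord_sum poly_in_coord_mult poly_in_coord_coeff less) auto
    moreover have "moment v m i = - (\<Sum>l<min i (Suc m).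
        coeff (szego_poly v (min i (Suc m))) l * moment v m (i - min i (Suc m) + l))" for v
      using False by (subst moment.simps) simp
    ultimately show ?thesis by simp
  qed
qed

lemma moment_cong:
  "(\<And>j. j < Suc m \<Longrightarrow> v j = w j) \<Longrightarrow> moment v m i = moment w m i"
proof (induction i rule: less_induct)
  case (less i)
  have "szego_poly v (min i (Suc m)) = szego_poly w (min i (Suc m))"
    using less.prems by (intro szego_poly_cong) simp
  moreover have "moment v m l = moment w m l" if "l < i" for l
    using less.prems that by (intro less.IH) auto
  ultimately show ?case
    by (subst (1 2) moment.simps) (auto intro!: sum.cong)
qed

lemma measurable_coeff_szego_poly:
  assumes "k \<le> n"
  shows "(\<lambda>v. coeff (szego_poly v k) l) \<in> borel_measurable (PiM {..<n} (\<lambda>_. borel))"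
  using assms
proof (induction k arbitrary: l)
  case (Suc k)
  note [measurable] = Suc.IH[OF Suc_leD[OF Suc.prems]]
  have [measurable]: "(\<lambda>v. v k) \<in> borel_measurable (PiM {..<n} (\<lambda>_. borel :: complex measure))"
    using Suc.prems by simp
  show ?case
    unfolding szego_poly.simps coeff_diff coeff_smult coeff_reversed degree_szego_poly coeff_pCons
    by (cases l) measurable
qed simp

lemma measurable_moment:
  "(\<lambda>v. moment v m i) \<in> borel_measurable (PiM {..<Suc m} (\<lambda>_. borel))"
proof (induction i rule: less_induct)
  case (less i)
  then show ?case
    by (subst moment.simps)
       (cases "i = 0", auto intro!: borel_measurable_sum borel_measurable_times borel_measurable_uminus
         measurable_coeff_szego_poly)
qed

text \<open>On the support \<open>x * szego v x m = v m * x ^ m * cnj (szego v x m)\<close>, so positive powers of \<open>x\<close>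
  produce a factor \<open>v m\<close>.\<close>

definition shifted_moment :: "(nat \<Rightarrow> complex) \<Rightarrow> nat \<Rightarrow> nat \<Rightarrow> complex" where
  "shifted_moment v m j = (\<Sum>i\<le>m. \<Sum>l\<le>m. cnj (coeff (szego_poly v m) i) * cnj (coeff (szego_poly v m) l) *
     (if l \<le> j + m - i then moment v m (j + m - i - l) else cnj (moment v m (l - (j + m - i)))))"

text \<open>Conjugation would destroy polynomial dependence, but it only hits the coefficients of
  Phi_m and moments of order at most \<open>m\<close>, and neither involves
  \<open>v m\<close>.\<close>

lemma poly_in_coord_shifted_moment: "poly_in_coord m (\<lambda>v. shifted_moment v m j)"
proof -
  have indep: "szego_poly (v(m := a)) m = szego_poly v m" for v a
    by (rule szego_poly_cong) simp
  have "poly_in_coord m (\<lambda>v. if l \<le> k then moment v m (k - l) else cnj (moment v m (l - k)))"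
    if "l \<le> m" for k l
    using that by (cases "l \<le> k") (auto intro!: poly_in_coord_moment poly_in_coord_indep simp: moment_indep)
  moreover have "poly_in_coord m (\<lambda>v. cnj (coeff (szego_poly v m) i))" for i
    by (rule poly_in_coord_indep) (simp add: indep)
  ultimately show ?thesis
    unfolding shifted_moment_def by (intro poly_in_coord_sum poly_in_coord_mult) simp_all
qed

lemma shifted_moment_cong:
  assumes "\<And>j. j < Suc m \<Longrightarrow> v j = w j"
  shows "shifted_moment v m j = shifted_moment w m j"
proof -
  have "moment v m i = moment w m i" for i using assms by (rule moment_cong)
  moreover have "szego_poly v m = szego_poly w m" using assms by (intro szego_poly_cong) simp
  ultimately show ?thesis unfolding shifted_moment_def by (simp only:)
qed

lemma measurable_shifted_moment:
  "(\<lambda>v. shifted_moment v m j) \<in> borel_measurable (PiM {..<Suc m} (\<lambda>_. borel))"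
proof -
  note [measurable] = measurable_coeff_szego_poly[of m "Suc m", OF le_SucI[OF order_refl]] measurable_moment
  show ?thesis unfolding shifted_moment_def by measurable
qed

text \<open>The factor |Phi_m|^2 removes all denominators, so after one power of x has been
  exchanged for v_m the integrand is a finite combination of powers and conjugate powers of
  x.\<close>

lemma integral_power_norm_szego:
  assumes "\<nu> \<in> space (prob_algebra circle)" "finite (supp \<nu>)" "card (supp \<nu>) = Suc m"
  shows "(\<integral>x. x ^ Suc j * of_real ((cmod (szego (szego_coeff \<nu>) x m))\<^sup>2) \<partial>\<nu>) =
    szego_coeff \<nu> m * shifted_moment (szego_coeff \<nu>) m j"
proof -
  note nu = prob_algebra_circleD[OF assms(1)]
  let ?v = "szego_coeff \<nu>"
  let ?c = "coeff (szego_poly ?v m)"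
  have cont: "continuous_on A (\<lambda>x. szego ?v x k)" for A k
    by (induction k) (auto intro!: continuous_intros)
  have "(\<integral>x. x ^ Suc j * of_real ((cmod (szego ?v x m))\<^sup>2) \<partial>\<nu>) =
      (\<integral>x. ?v m * (x ^ j * (x ^ m * cnj (szego ?v x m)) * cnj (szego ?v x m)) \<partial>\<nu>)"
  proof (intro integral_cong_AE)
    show "AE x in \<nu>. x ^ Suc j * of_real ((cmod (szego ?v x m))\<^sup>2) =
        ?v m * (x ^ j * (x ^ m * cnj (szego ?v x m)) * cnj (szego ?v x m))"
    proof (rule eventually_mono[OF compl_supp[OF nu(2)]])
      fix x assume x: "x \<in> supp \<nu>"
      then have "cmod x = 1" using supp_subset_sphere[of \<nu>] by auto
      then have "szego ?v x (Suc m) = 0"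
        using poly_ortho_poly_supp[OF assms(1,2) x] poly_szego_poly assms(3)
        by (simp add: ortho_poly_eq del: szego_poly.simps szego.simps)
      then have eq: "x * szego ?v x m = ?v m * x ^ m * cnj (szego ?v x m)" by simp
      have "x ^ Suc j * of_real ((cmod (szego ?v x m))\<^sup>2) = x ^ j * (x * szego ?v x m) * cnj (szego ?v x m)"
        by (simp only: complex_norm_square) simp
      then show "x ^ Suc j * of_real ((cmod (szego ?v x m))\<^sup>2) =
        ?v m * (x ^ j * (x ^ m * cnj (szego ?v x m)) * cnj (szego ?v x m))"
        by (simp only: eq) (simp add: mult_ac)
    qed
  qed (auto intro!: borel_measurable_integrable integrable_circle_continuous[OF nu(4,2)] continuous_intros cont)
  also have "\<dots> = ?v m * (\<integral>x. x ^ j * (x ^ m * cnj (szego ?v x m)) * cnj (szego ?v x m) \<partial>\<nu>)"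
    by simp
  \<comment> \<open>Both polynomial factors are expanded in powers. The exponents j + m - i are
    genuine differences because i <= m.\<close>
  also have "(\<integral>x. x ^ j * (x ^ m * cnj (szego ?v x m)) * cnj (szego ?v x m) \<partial>\<nu>) =
      (\<integral>x. (\<Sum>i\<le>m. \<Sum>l\<le>m. cnj (?c i) * cnj (?c l) * (x ^ (j + m - i) * cnj (x ^ l))) \<partial>\<nu>)"
  proof (intro integral_cong_circle[OF nu(2)])
    fix x :: complex assume x: "cmod x = 1"
    have sz: "szego ?v x m = (\<Sum>i\<le>m. ?c i * x ^ i)"
      using poly_szego_poly[OF x, of ?v m] by (simp add: poly_altdef)
    have "x ^ m * cnj x ^ i = x ^ (m - i)" if "i \<le> m" for i
    proof -
      have "x ^ m = x ^ (m - i) * x ^ i" using that by (simp flip: power_add)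
      then show ?thesis using cnj_unit(2)[OF x] by (simp add: mult.assoc flip: power_mult_distrib)
    qed
    then have 1: "x ^ m * cnj (szego ?v x m) = (\<Sum>i\<le>m. cnj (?c i) * x ^ (m - i))"
      unfolding sz cnj_sum sum_distrib_left
      by (intro sum.cong refl) (simp add: mult.left_commute[of "x ^ m"])
    have 2: "cnj (szego ?v x m) = (\<Sum>l\<le>m. cnj (?c l) * cnj (x ^ l))"
      by (simp add: sz)
    show "x ^ j * (x ^ m * cnj (szego ?v x m)) * cnj (szego ?v x m) =
      (\<Sum>i\<le>m. \<Sum>l\<le>m. cnj (?c i) * cnj (?c l) * (x ^ (j + m - i) * cnj (x ^ l)))"
    proof -
      have "x ^ (j + m - i) = x ^ j * x ^ (m - i)" if "i \<le> m" for i
        using that by (simp flip: power_add)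
      moreover have "x ^ j * (x ^ m * cnj (szego ?v x m)) * cnj (szego ?v x m) =
          (\<Sum>i\<le>m. \<Sum>l\<le>m. x ^ j * (cnj (?c i) * x ^ (m - i) * (cnj (?c l) * cnj (x ^ l))))"
        by (subst mult.assoc, subst 1, subst 2, subst sum_product) (simp only: sum_distrib_left)
      ultimately show ?thesis by (simp add: mult_ac)
    qed
  qed
  also have "\<dots> = (\<Sum>i\<le>m. \<Sum>l\<le>m. cnj (?c i) * cnj (?c l) * (\<integral>x. x ^ (j + m - i) * cnj (x ^ l) \<partial>\<nu>))"
  proof -
    note int = integrable_circle_continuous[OF nu(4,2)]
    have "(\<integral>x. (\<Sum>l\<le>m. cnj (?c i) * cnj (?c l) * (x ^ (j + m - i) * cnj (x ^ l))) \<partial>\<nu>) =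
        (\<Sum>l\<le>m. cnj (?c i) * cnj (?c l) * (\<integral>x. x ^ (j + m - i) * cnj (x ^ l) \<partial>\<nu>))" for i
      by (subst Bochner_Integration.integral_sum) (auto intro!: int continuous_intros)
    then show ?thesis
      by (subst Bochner_Integration.integral_sum) (auto intro!: int continuous_intros)
  qed
  also have "\<dots> = shifted_moment ?v m j"
  proof -
    \<comment> \<open>On the circle opposite powers cancel, leaving a moment or the conjugate of one
      according to which exponent is larger.\<close>
    have "(\<integral>x. x ^ k * cnj (x ^ l) \<partial>\<nu>) =
       (if l \<le> k then moment ?v m (k - l) else cnj (moment ?v m (l - k)))" for k l
    proof (cases "l \<le> k")
      case True
      have "(\<integral>x. x ^ k * cnj (x ^ l) \<partial>\<nu>) = (\<integral>x. x ^ (k - l) \<partial>\<nu>)"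
      proof (intro integral_cong_circle[OF nu(2)])
        fix x :: complex assume x: "cmod x = 1"
        have "x ^ k = x ^ (k - l) * x ^ l" using True by (simp flip: power_add)
        then show "x ^ k * cnj (x ^ l) = x ^ (k - l)"
          using cnj_unit(2)[OF x] by (simp add: mult.assoc flip: power_mult_distrib)
      qed
      then show ?thesis using True integral_power_eq_moment[OF assms] by simp
    next
      case False
      have "(\<integral>x. x ^ k * cnj (x ^ l) \<partial>\<nu>) = (\<integral>x. cnj (x ^ (l - k)) \<partial>\<nu>)"
      proof (intro integral_cong_circle[OF nu(2)])
        fix x :: complex assume x: "cmod x = 1"
        have "x ^ l = x ^ (l - k) * x ^ k" using False by (simp flip: power_add)
        then show "x ^ k * cnj (x ^ l) = cnj (x ^ (l - k))"
          using cnj_unit(1)[OF x] by (simp add: mult_ac flip: power_mult_distrib)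
      qed
      also have "\<dots> = cnj (\<integral>x. x ^ (l - k) \<partial>\<nu>)" by (rule Bochner_Integration.integral_cnj)
      finally show ?thesis using False integral_power_eq_moment[OF assms] by simp
    qed
    then show ?thesis by (simp add: shifted_moment_def)
  qed
  finally show ?thesis .
qed

lemma integral_norm_szego:
  assumes "\<nu> \<in> space (prob_algebra circle)" "finite (supp \<nu>)" "card (supp \<nu>) = Suc m"
  shows "(\<integral>x. (cmod (szego (szego_coeff \<nu>) x m))\<^sup>2 \<partial>\<nu>) = (\<Prod>k<m. 1 - (cmod (szego_coeff \<nu> k))\<^sup>2)"
proof -
  note nu = prob_algebra_circleD[OF assms(1)]
  have "(\<integral>x. (cmod (szego (szego_coeff \<nu>) x m))\<^sup>2 \<partial>\<nu>) = ortho_norm \<nu> m"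
    unfolding ortho_norm_def ortho_poly_eq by (intro integral_cong_circle[OF nu(2)]) (simp add: poly_szego_poly)
  also have "\<dots> = (\<Prod>k<m. 1 - (cmod (szego_coeff \<nu> k))\<^sup>2)"
    using assms by (intro szego_orthogonality ortho_norm_nonzero) auto
  finally show ?thesis .
qed

section \<open>Rotation invariant laws\<close>

definition poisson_weight :: "complex \<Rightarrow> real" where
  "poisson_weight w = (1 - (cmod w)\<^sup>2) / (cmod (1 - w))\<^sup>2"

definition palm_flip :: "complex \<Rightarrow> complex" where
  "palm_flip w = - w * ((1 - cnj w) / (1 - w))"

lemma measurable_poisson_weight [measurable]: "poisson_weight \<in> borel_measurable borel"
  unfolding poisson_weight_def[abs_def] by measurable

lemma measurable_palm_flip [measurable]: "palm_flip \<in> borel_measurable borel"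
  unfolding palm_flip_def[abs_def] by measurable

lemma borel_measurable_sets_circle:
  fixes f :: "complex \<Rightarrow> 'b::topological_space"
  assumes "sets \<nu> = sets circle" "continuous_on (sphere 0 1) f"
  shows "f \<in> borel_measurable \<nu>"
  using borel_measurable_circle_continuous[OF assms(2)] measurable_cong_sets[OF assms(1) refl] by blast

text \<open>Haar probability on the circle, characterised by invariance. The instance used later is
  the law of the last coefficient.\<close>

locale circle_uniform = prob_space U for U :: "complex measure" +
  assumes sets_U [simp, measurable_cong]: "sets U = sets circle"
    and rot: "cmod u = 1 \<Longrightarrow> distr U circle (\<lambda>z. u * z) = U"
begin

lemma space_U: "space U = sphere 0 1"
  using sets_eq_imp_space_eq[OF sets_U] by simp

lemma measurable_rotation: "cmod u = 1 \<Longrightarrow> (\<lambda>z. u * z) \<in> circle \<rightarrow>\<^sub>M circle"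
  unfolding circle_def by (rule measurable_restrict_space3) (auto simp: norm_mult)

lemma nn_integral_rotation:
  assumes "cmod u = 1" "f \<in> borel_measurable circle"
  shows "(\<integral>\<^sup>+z. f (u * z) \<partial>U) = (\<integral>\<^sup>+z. f z \<partial>U)"
proof -
  have "(\<integral>\<^sup>+z. f z \<partial>U) = (\<integral>\<^sup>+z. f z \<partial>distr U circle (\<lambda>z. u * z))"
    using rot[OF assms(1)] by simp
  also have "\<dots> = (\<integral>\<^sup>+z. f (u * z) \<partial>U)"
    using measurable_rotation[OF assms(1)] assms(2) by (intro nn_integral_distr) simp_all
  finally show ?thesis by simp
qed

lemma integrable_U:
  fixes f :: "complex \<Rightarrow> 'b::{banach, second_countable_topology}"
  shows "continuous_on (sphere 0 1) f \<Longrightarrow> integrable U f"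
  by (intro integrable_circle_continuous finite_measure_axioms sets_U)

lemma integral_power: "(\<integral>z. z ^ Suc j \<partial>U) = 0"
proof -
  \<comment> \<open>A rotation whose power of order j + 1 is -1, so that invariance turns the moment
    into its own negative.\<close>
  define u where "u = cis (pi / real (Suc j))"
  have u: "cmod u = 1" "u ^ Suc j = -1"
    by (simp_all add: u_def Complex.DeMoivre del: of_nat_Suc power_Suc)
  have "(\<integral>z. z ^ Suc j \<partial>U) = (\<integral>z. z ^ Suc j \<partial>distr U circle (\<lambda>z. u * z))"
    using rot[OF u(1)] by simp
  also have "\<dots> = (\<integral>z. (u * z) ^ Suc j \<partial>U)"
    using measurable_rotation[OF u(1)]
    by (intro integral_distr borel_measurable_circle_continuous continuous_intros) simp
  also have "\<dots> = - (\<integral>z. z ^ Suc j \<partial>U)"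
    using u(2) by (simp only: power_mult_distrib integral_mult_right_zero) simp
  finally show ?thesis by (simp add: eq_neg_iff_add_eq_0 del: power_Suc)
qed

lemma integral_power_eq: "(\<integral>z. z ^ j \<partial>U) = (if j = 0 then 1 else 0)"
  using integral_power by (cases j) (simp_all add: prob_space del: power_Suc)

text \<open>For \<open>\<tau> u = (cnj w - u) / (1 - w * u)\<close> the mixed moments \<open>t j k = \<integral> \<tau>^j u^k\<close> satisfy
  \<open>t (j+1) k = w * t (j+1) (k+1) + cnj w * t j k - t j (k+1)\<close>; being bounded, they are determined
  by \<open>t 0\<close>.\<close>

lemma moebius_moments:
  assumes w: "cmod w < 1"
  defines "\<tau> \<equiv> \<lambda>u. (cnj w - u) / (1 - w * u)"
  shows "(\<integral>u. \<tau> u ^ j * u ^ k \<partial>U) = (if k = 0 then cnj w ^ j else 0)"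
proof -
  have nz: "1 - w * u \<noteq> 0" if "cmod u = 1" for u
    using w that by (metis eq_iff_diff_eq_0 mult.right_neutral norm_mult norm_one less_irrefl)
  have cont: "continuous_on (sphere 0 1) \<tau>"
    unfolding \<tau>_def using nz by (intro continuous_intros) auto
  have int: "integrable U (\<lambda>u. \<tau> u ^ j * u ^ k)" for j k
    by (intro integrable_U continuous_intros cont)
  have tau_norm: "cmod (\<tau> u) = 1" if u: "cmod u = 1" for u
  proof -
    have "cnj w - u = - u * cnj (1 - w * u)"
      using cnj_unit[OF u] by (simp add: algebra_simps)
    then have "cmod (cnj w - u) = cmod (1 - w * u)"
      using u by (metis complex_mod_cnj mult.left_neutral norm_minus_cancel norm_mult)
    then show ?thesis using nz[OF u] by (simp add: \<tau>_def norm_divide)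
  qed
  define t where "t j k = (\<integral>u. \<tau> u ^ j * u ^ k \<partial>U)" for j k
  have bound: "cmod (t j k) \<le> 1" for j k
  proof -
    have "cmod (t j k) \<le> (\<integral>u. cmod (\<tau> u ^ j * u ^ k) \<partial>U)"
      unfolding t_def by (rule integral_norm_bound)
    also have "\<dots> = (\<integral>u. 1 \<partial>U)"
      by (intro integral_cong_circle[OF sets_U]) (simp add: norm_mult norm_power tau_norm)
    finally show ?thesis by (simp add: prob_space)
  qed
  have rec: "t (Suc j) k = w * t (Suc j) (Suc k) + (cnj w * t j k - t j (Suc k))" for j k
  proof -
    have "t (Suc j) k = (\<integral>u. w * (\<tau> u ^ Suc j * u ^ Suc k) + (cnj w * (\<tau> u ^ j * u ^ k) - \<tau> u ^ j * u ^ Suc k) \<partial>U)"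
      unfolding t_def
    proof (intro integral_cong_circle[OF sets_U])
      fix u :: complex assume u: "cmod u = 1"
      have "\<tau> u * (1 - w * u) = cnj w - u" using nz[OF u] by (simp add: \<tau>_def)
      then have \<tau>: "\<tau> u = w * (\<tau> u * u) + (cnj w - u)" by (simp add: algebra_simps)
      have "\<tau> u ^ Suc j * u ^ k = \<tau> u * (\<tau> u ^ j * u ^ k)" by simp
      also have "\<dots> = (w * (\<tau> u * u) + (cnj w - u)) * (\<tau> u ^ j * u ^ k)"
        using \<tau> by simp
      finally show "\<tau> u ^ Suc j * u ^ k =
          w * (\<tau> u ^ Suc j * u ^ Suc k) + (cnj w * (\<tau> u ^ j * u ^ k) - \<tau> u ^ j * u ^ Suc k)"
        by (simp add: algebra_simps)
    qed
    also have "\<dots> = w * t (Suc j) (Suc k) + (cnj w * t j k - t j (Suc k))"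
      unfolding t_def using int by (simp del: power_Suc)
    finally show ?thesis .
  qed
  have "\<forall>k. t j k = (if k = 0 then cnj w ^ j else 0)"
  proof (induction j)
    case 0
    then show ?case by (simp add: t_def integral_power_eq)
  next
    case (Suc j)
    \<comment> \<open>At positive exponents of u the level j contributes nothing, so the recursion
      reduces to repeated multiplication by w. Since the moments are bounded and |w| < 1, they
      vanish.\<close>
    have step: "t (Suc j) (Suc k) = w ^ N * t (Suc j) (Suc k + N)" for k N
    proof (induction N)
      case (Suc N)
      then show ?case
        using rec[of j "Suc k + N"] \<open>\<forall>k. t j k = (if k = 0 then cnj w ^ j else 0)\<close> by (simp add: mult_ac)
    qed simp
    have "t (Suc j) (Suc k) = 0" for k
    proof -
      have "cmod (t (Suc j) (Suc k)) \<le> cmod w ^ N" for N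
        using step[of k N] bound[of "Suc j" "Suc k + N"]
        by (metis mult_left_le norm_ge_zero norm_mult norm_power zero_le_power)
      moreover have "(\<lambda>N. cmod w ^ N) \<longlonglongrightarrow> 0" using w by (intro LIMSEQ_realpow_zero) auto
      ultimately have "cmod (t (Suc j) (Suc k)) \<le> 0"
        by (intro LIMSEQ_le_const[where X="\<lambda>N. cmod w ^ N"]) auto
      then show ?thesis by simp
    qed
    moreover have "t (Suc j) 0 = cnj w ^ Suc j"
      using rec[of j 0] calculation[of 0] Suc by simp
    ultimately show ?case by (metis nat.exhaust)
  qed
  then show ?thesis by (simp add: t_def)
qed

text \<open>Multiplying both sides by h(u) = |1 - w u|^2 turns the right side into a constant
  multiple of \<open>U\<close>. On the left h is a trigonometric polynomial, so each moment involves
  only a few of the known moments conj(w)^j of the image law. Equality of all moments then gives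
  equality of the measures.\<close>

lemma distr_moebius:
  assumes w: "cmod w < 1"
  shows "distr U circle (\<lambda>u. (cnj w - u) / (1 - w * u)) = density U (\<lambda>u. ennreal (poisson_weight (w * u)))"
proof -
  define \<tau> where "\<tau> = (\<lambda>u. (cnj w - u) / (1 - w * u))"
  have nz: "1 - w * u \<noteq> 0" if "cmod u = 1" for u
    using w that by (metis eq_iff_diff_eq_0 mult.right_neutral norm_mult norm_one less_irrefl)
  have cont: "continuous_on (sphere 0 1) \<tau>"
    unfolding \<tau>_def using nz by (intro continuous_intros) auto
  have tau_norm: "cmod (\<tau> u) = 1" if u: "cmod u = 1" for u
  proof -
    have "cnj w - u = - u * cnj (1 - w * u)"
      using cnj_unit[OF u] by (simp add: algebra_simps)
    then have "cmod (cnj w - u) = cmod (1 - w * u)"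
      using u by (metis complex_mod_cnj mult.left_neutral norm_minus_cancel norm_mult)
    then show ?thesis using nz[OF u] by (simp add: \<tau>_def norm_divide)
  qed
  have meas: "\<tau> \<in> U \<rightarrow>\<^sub>M circle"
  proof -
    have "\<tau> \<in> borel_measurable circle" using cont by (rule borel_measurable_circle_continuous)
    then have "\<tau> \<in> circle \<rightarrow>\<^sub>M circle"
      unfolding circle_def by (intro measurable_restrict_space2) (auto simp: space_restrict_space tau_norm)
    then show ?thesis by simp
  qed
  define S where "S = distr U circle \<tau>"
  interpret S: prob_space S unfolding S_def by (rule prob_space_distr[OF meas])
  have sets_S[simp, measurable_cong]: "sets S = sets circle" by (simp add: S_def)
  have S_mom: "(\<integral>z. z ^ j \<partial>S) = cnj w ^ j" for j
  proof -
    have "(\<integral>z. z ^ j \<partial>S) = (\<integral>u. \<tau> u ^ j \<partial>U)"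
      unfolding S_def by (intro integral_distr meas borel_measurable_circle_continuous continuous_intros)
    then show ?thesis using moebius_moments[OF w, of j 0] by (simp add: \<tau>_def)
  qed
  have intS: "integrable S f" if "continuous_on (sphere 0 1) f" for f :: "complex \<Rightarrow> complex"
    by (intro integrable_circle_continuous that S.finite_measure_axioms sets_S)
  define h where "h u = (cmod (1 - w * u))\<^sup>2" for u
  have mcont[measurable]: "f \<in> borel_measurable circle" if "continuous_on UNIV f" for f :: "complex \<Rightarrow> real"
    using that continuous_on_subset by (intro borel_measurable_circle_continuous) blast
  have h_meas[measurable]: "h \<in> borel_measurable circle"
    unfolding h_def by (intro borel_measurable_circle_continuous continuous_intros)
  have p_meas[measurable]: "(\<lambda>u. poisson_weight (w * u)) \<in> borel_measurable circle"
    by (rule measurable_compose[OF _ measurable_poisson_weight],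
        intro borel_measurable_circle_continuous continuous_intros)
  have "density S (\<lambda>u. ennreal (h u)) = density U (\<lambda>u. ennreal (1 - (cmod w)\<^sup>2))"
  proof (rule measure_circle_eqI)
    have hfin: "finite_measure (density C (\<lambda>u. ennreal (f u)))"
      if "prob_space C" "sets C = sets circle" "continuous_on UNIV f" "\<And>u. f u \<ge> 0" for C f
    proof (rule finite_measureI)
      interpret C: prob_space C by fact
      have "integrable C f"
        by (intro integrable_circle_continuous C.finite_measure_axioms that
            continuous_on_subset[OF that(3)]) simp
      then show "emeasure (density C (\<lambda>u. ennreal (f u))) (space (density C (\<lambda>u. ennreal (f u)))) \<noteq> \<infinity>"
        using that(4) by (simp add: emeasure_density nn_integral_eq_integral
            borel_measurable_integrable cong: nn_integral_cong)
    qed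
    show "finite_measure (density S (\<lambda>u. ennreal (h u)))"
      unfolding h_def by (intro hfin S.prob_space_axioms sets_S continuous_intros) simp
    show "finite_measure (density U (\<lambda>u. ennreal (1 - (cmod w)\<^sup>2)))"
      using w by (intro hfin prob_space_axioms sets_U continuous_intros) (simp add: abs_square_le_1)
    fix j :: nat
    have "(\<integral>z. z ^ j \<partial>density S (\<lambda>u. ennreal (h u))) = (\<integral>z. h z *\<^sub>R z ^ j \<partial>S)"
      by (intro integral_density)
         (auto simp: h_def intro!: borel_measurable_sets_circle[OF sets_S] continuous_intros)
    also have "\<dots> = (if j = 0 then 1 - (cmod w)\<^sup>2 else 0)"
    proof (cases j)
      case 0
      have "(\<integral>z. h z *\<^sub>R z ^ j \<partial>S) = (\<integral>z. (1 + w * cnj w) - (w * z + cnj (w * z)) \<partial>S)"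
      proof (intro integral_cong_circle[OF sets_S])
        fix z :: complex assume z: "cmod z = 1"
        have "of_real (h z) = (1 - w * z) * cnj (1 - w * z)"
          unfolding h_def by (rule complex_norm_square)
        also have "\<dots> = (1 + w * cnj w * (z * cnj z)) - (w * z + cnj (w * z))"
          by (simp add: algebra_simps)
        finally show "h z *\<^sub>R z ^ j = (1 + w * cnj w) - (w * z + cnj (w * z))"
          using 0 cnj_unit[OF z] by (simp add: scaleR_conv_of_real)
      qed
      also have "\<dots> = (1 + w * cnj w) - (w * cnj w + cnj (w * cnj w))"
        using S_mom[of 1] intS[of "\<lambda>z. z"] by (subst Bochner_Integration.integral_diff)
          (auto intro!: intS continuous_intros simp: S.prob_space)
      also have "\<dots> = 1 - (cmod w)\<^sup>2"
        by (simp only: of_real_diff complex_norm_square) simp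
      finally show ?thesis using 0 by simp
    next
      case (Suc i)
      have "(\<integral>z. h z *\<^sub>R z ^ j \<partial>S) = (\<integral>z. (1 + w * cnj w) * z ^ Suc i - (w * z ^ Suc (Suc i) + cnj w * z ^ i) \<partial>S)"
      proof (intro integral_cong_circle[OF sets_S])
        fix z :: complex assume z: "cmod z = 1"
        have "of_real (h z) = (1 - w * z) * cnj (1 - w * z)"
          unfolding h_def by (rule complex_norm_square)
        also have "\<dots> * z ^ Suc i = (1 + w * cnj w * (z * cnj z)) * z ^ Suc i - (w * z ^ Suc (Suc i) + cnj w * (cnj z * z) * z ^ i)"
          by (simp add: algebra_simps)
        finally show "h z *\<^sub>R z ^ j = (1 + w * cnj w) * z ^ Suc i - (w * z ^ Suc (Suc i) + cnj w * z ^ i)"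
          using Suc cnj_unit[OF z] by (simp add: scaleR_conv_of_real)
      qed
      also have "\<dots> = (1 + w * cnj w) * cnj w ^ Suc i - (w * cnj w ^ Suc (Suc i) + cnj w * cnj w ^ i)"
      proof -
        show ?thesis
          by (subst Bochner_Integration.integral_diff, intro intS continuous_intros, intro intS continuous_intros,
              subst Bochner_Integration.integral_add, intro intS continuous_intros, intro intS continuous_intros)
             (simp only: integral_mult_right_zero S_mom)
      qed
      also have "\<dots> = 0" by (simp add: algebra_simps)
      finally show ?thesis using Suc by simp
    qed
    also have "\<dots> = (\<integral>z. (1 - (cmod w)\<^sup>2) *\<^sub>R z ^ j \<partial>U)"
      by (simp add: integral_power_eq scaleR_conv_of_real)
    also have "\<dots> = (\<integral>z. z ^ j \<partial>density U (\<lambda>u. ennreal (1 - (cmod w)\<^sup>2)))"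
      using w by (intro integral_density[symmetric])
        (auto simp: abs_square_le_1 intro!: borel_measurable_sets_circle[OF sets_U] continuous_intros)
    finally show "(\<integral>z. z ^ j \<partial>density S (\<lambda>u. ennreal (h u))) = (\<integral>z. z ^ j \<partial>density U (\<lambda>u. ennreal (1 - (cmod w)\<^sup>2)))" .
  qed simp_all
  \<comment> \<open>The factor h is divided out again; it has no zero on the circle because |w| <
    1.\<close>
  then have "density (density S (\<lambda>u. ennreal (h u))) (\<lambda>u. ennreal (1 / h u)) =
      density (density U (\<lambda>u. ennreal (1 - (cmod w)\<^sup>2))) (\<lambda>u. ennreal (1 / h u))"
    by (rule arg_cong)
  also have "density (density S (\<lambda>u. ennreal (h u))) (\<lambda>u. ennreal (1 / h u)) = density S (\<lambda>u. 1)"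
  proof (subst density_density_eq)
    have "ennreal (h u) * ennreal (1 / h u) = 1" if "cmod u = 1" for u
    proof -
      have "h u > 0" using nz[OF that] by (simp add: h_def)
      then show ?thesis by (subst ennreal_mult[symmetric]) simp_all
    qed
    then show "density S (\<lambda>u. ennreal (h u) * ennreal (1 / h u)) = density S (\<lambda>u. 1)"
      by (intro density_cong AE_circleI[OF sets_S]) auto
  qed auto
  also have "density (density U (\<lambda>u. ennreal (1 - (cmod w)\<^sup>2))) (\<lambda>u. ennreal (1 / h u)) =
      density U (\<lambda>u. ennreal (poisson_weight (w * u)))"
  proof (subst density_density_eq)
    have "ennreal (1 - (cmod w)\<^sup>2) * ennreal (1 / h u) = ennreal (poisson_weight (w * u))"
      if "cmod u = 1" for u
      using w that
      by (subst ennreal_mult[symmetric]) (simp_all add: h_def poisson_weight_def norm_mult abs_square_le_1)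
    then show "density U (\<lambda>u. ennreal (1 - (cmod w)\<^sup>2) * ennreal (1 / h u)) =
        density U (\<lambda>u. ennreal (poisson_weight (w * u)))"
      by (intro density_cong AE_circleI[OF sets_U]) auto
  qed auto
  finally show ?thesis
    by (simp only: density_1 S_def \<tau>_def)
qed

end

lemma nn_integral_rotationally_invariant:
  assumes "rotationally_invariant D" "sets D = sets borel" "cmod u = 1" "f \<in> borel_measurable borel"
  shows "(\<integral>\<^sup>+z. f (u * z) \<partial>D) = (\<integral>\<^sup>+z. f z \<partial>D)"
proof -
  have "(\<lambda>z. u * z) \<in> borel \<rightarrow>\<^sub>M borel" by measurable
  then have "(\<lambda>z. u * z) \<in> D \<rightarrow>\<^sub>M borel" using measurable_cong_sets[OF assms(2) refl] by blast
  then have "(\<integral>\<^sup>+z. f (u * z) \<partial>D) = (\<integral>\<^sup>+z. f z \<partial>distr D borel (\<lambda>z. u * z))"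
    using assms(4) by (intro nn_integral_distr[symmetric]) simp_all
  then show ?thesis using assms(1,3) by (simp add: rotationally_invariant_def)
qed

text \<open>By invariance w may be replaced by u w with u uniform and independent. At fixed w the
  Poisson kernel is then the density of a Moebius image of u, and this Moebius map acts on u w
  exactly as \<open>palm_flip\<close>.\<close>

lemma (in circle_uniform) nn_integral_palm_flip:
  assumes D: "prob_space D" "sets D = sets borel" "rotationally_invariant D" "AE w in D. cmod w < 1"
    and f[measurable]: "f \<in> borel_measurable borel"
  shows "(\<integral>\<^sup>+w. ennreal (poisson_weight w) * f w \<partial>D) = (\<integral>\<^sup>+w. f (palm_flip w) \<partial>D)"
proof -
  interpret D: prob_space D by fact
  interpret UD: pair_sigma_finite U D ..
  note D(2)[simp, measurable_cong]
  note measurable_id_circle[measurable]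
  have avg: "(\<integral>\<^sup>+w. g w \<partial>D) = (\<integral>\<^sup>+w. (\<integral>\<^sup>+u. g (u * w) \<partial>U) \<partial>D)" if g[measurable]: "g \<in> borel_measurable borel" for g
  proof -
    have [measurable]: "(\<lambda>(u, w). g (u * w)) \<in> borel_measurable (U \<Otimes>\<^sub>M D)"
    proof -
      have [measurable]: "fst \<in> borel_measurable (U \<Otimes>\<^sub>M D)"
        by (rule measurable_compose[OF measurable_fst]) simp
      have [measurable]: "snd \<in> borel_measurable (U \<Otimes>\<^sub>M D)"
        by (rule measurable_compose[OF measurable_snd measurable_ident_sets[OF D(2)]])
      show ?thesis unfolding split_beta by measurable
    qed
    have "(\<integral>\<^sup>+w. g w \<partial>D) = (\<integral>\<^sup>+u. (\<integral>\<^sup>+w. g w \<partial>D) \<partial>U)"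
      by (simp add: emeasure_space_1)
    also have "\<dots> = (\<integral>\<^sup>+u. (\<integral>\<^sup>+w. g (u * w) \<partial>D) \<partial>U)"
      by (intro nn_integral_cong nn_integral_rotationally_invariant[symmetric] D g) (simp add: space_U)
    also have "\<dots> = (\<integral>\<^sup>+w. (\<integral>\<^sup>+u. g (u * w) \<partial>U) \<partial>D)"
      by (rule UD.Fubini'[symmetric]) simp
    finally show ?thesis .
  qed
  have "(\<integral>\<^sup>+w. ennreal (poisson_weight w) * f w \<partial>D) =
      (\<integral>\<^sup>+w. (\<integral>\<^sup>+u. ennreal (poisson_weight (u * w)) * f (u * w) \<partial>U) \<partial>D)"
    by (rule avg) measurable
  also have "\<dots> = (\<integral>\<^sup>+w. (\<integral>\<^sup>+u. f (palm_flip (u * w)) \<partial>U) \<partial>D)"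
  proof (rule nn_integral_cong_AE, rule eventually_mono[OF D(4)])
    fix w :: complex assume w: "cmod w < 1"
    have nz: "1 - w * u \<noteq> 0" if "cmod u = 1" for u
      using w that by (metis eq_iff_diff_eq_0 mult.right_neutral norm_mult norm_one less_irrefl)
    have cm: "g \<in> U \<rightarrow>\<^sub>M borel" if "continuous_on (sphere 0 1) g" for g :: "complex \<Rightarrow> complex"
      using borel_measurable_circle_continuous[OF that] by simp
    have fm: "(\<lambda>u. f (u * w)) \<in> borel_measurable circle"
      by (rule measurable_compose[OF borel_measurable_circle_continuous f]) (intro continuous_intros)
    have pm: "(\<lambda>u. ennreal (poisson_weight (w * u))) \<in> borel_measurable U"
    proof -
      have "(\<lambda>u. w * u) \<in> U \<rightarrow>\<^sub>M borel" by (intro cm continuous_intros)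
      then show ?thesis by measurable
    qed
    have tm: "(\<lambda>u. (cnj w - u) / (1 - w * u)) \<in> U \<rightarrow>\<^sub>M circle"
    proof (rule ccontr)
      assume "\<not> ?thesis"
      moreover have "(\<lambda>u. (cnj w - u) / (1 - w * u)) \<in> borel_measurable circle"
        using nz by (intro borel_measurable_circle_continuous continuous_intros) auto
      moreover have "cmod ((cnj w - u) / (1 - w * u)) = 1" if u: "cmod u = 1" for u
      proof -
        have "cnj w - u = - u * cnj (1 - w * u)"
          using cnj_unit[OF u] by (simp add: algebra_simps)
        then have "cmod (cnj w - u) = cmod (1 - w * u)"
          using u by (metis complex_mod_cnj mult.left_neutral norm_minus_cancel norm_mult)
        then show ?thesis using nz[OF u] by (simp add: norm_divide)
      qed
      ultimately show False
        unfolding measurable_cong_sets[OF sets_U refl]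
        by (subst (asm) (2) circle_def) (auto simp: measurable_restrict_space2_iff)
    qed
    have "(\<integral>\<^sup>+u. ennreal (poisson_weight (u * w)) * f (u * w) \<partial>U) =
        (\<integral>\<^sup>+u. f (u * w) \<partial>density U (\<lambda>u. ennreal (poisson_weight (w * u))))"
      using pm fm by (subst nn_integral_density) (auto simp: mult.commute)
    also have "\<dots> = (\<integral>\<^sup>+u. f (u * w) \<partial>distr U circle (\<lambda>u. (cnj w - u) / (1 - w * u)))"
      by (simp add: distr_moebius[OF w])
    also have "\<dots> = (\<integral>\<^sup>+u. f ((cnj w - u) / (1 - w * u) * w) \<partial>U)"
      by (rule nn_integral_distr[OF tm]) (use fm in simp)
    also have "\<dots> = (\<integral>\<^sup>+u. f (palm_flip (u * w)) \<partial>U)"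
    proof (rule nn_integral_cong)
      fix u assume "u \<in> space U"
      then have u: "cmod u = 1" by (simp add: space_U)
      \<comment> \<open>Both sides equal |w|^2 - u w, as |u| = 1.\<close>
      have "(cnj w - u) * w = - (u * w) * (1 - cnj (u * w))"
        using cnj_unit[OF u] by (simp add: algebra_simps)
      then have "(cnj w - u) / (1 - w * u) * w = palm_flip (u * w)"
        by (simp add: palm_flip_def mult.commute)
      then show "f ((cnj w - u) / (1 - w * u) * w) = f (palm_flip (u * w))" by simp
    qed
    finally show "(\<integral>\<^sup>+u. ennreal (poisson_weight (u * w)) * f (u * w) \<partial>U) = (\<integral>\<^sup>+u. f (palm_flip (u * w)) \<partial>U)" .
  qed
  also have "\<dots> = (\<integral>\<^sup>+w. f (palm_flip w) \<partial>D)"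
    by (rule avg[symmetric]) measurable
  finally show ?thesis .
qed

section \<open>Products of rotation invariant laws\<close>

abbreviation coords :: "nat \<Rightarrow> (nat \<Rightarrow> complex) measure" where
  "coords n \<equiv> PiM {..<n} (\<lambda>_. borel)"

lemma measurable_szego_joint:
  assumes "k \<le> n"
  shows "(\<lambda>p. szego (snd p) (fst p) k) \<in> borel_measurable (circle \<Otimes>\<^sub>M coords n)"
  using assms
proof (induction k)
  case (Suc k)
  then have [measurable]: "(\<lambda>p. szego (snd p) (fst p) k) \<in> borel_measurable (circle \<Otimes>\<^sub>M coords n)"
    by simp
  have [measurable]: "fst \<in> borel_measurable (circle \<Otimes>\<^sub>M coords n)"
    by (rule measurable_compose[OF measurable_fst measurable_id_circle])
  have [measurable]: "(\<lambda>p. snd p k) \<in> borel_measurable (circle \<Otimes>\<^sub>M coords n)"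
    using Suc.prems by (intro measurable_compose[OF measurable_snd measurable_component_singleton]) auto
  show ?case unfolding szego.simps by measurable
qed simp

lemma measurable_relative_coeff_joint:
  assumes "k < n"
  shows "(\<lambda>p. relative_coeff (snd p) (fst p) k) \<in> borel_measurable (circle \<Otimes>\<^sub>M coords n)"
proof -
  have [measurable]: "(\<lambda>p. szego (snd p) (fst p) k) \<in> borel_measurable (circle \<Otimes>\<^sub>M coords n)"
    using assms by (intro measurable_szego_joint) simp
  have [measurable]: "fst \<in> borel_measurable (circle \<Otimes>\<^sub>M coords n)"
    by (rule measurable_compose[OF measurable_fst measurable_id_circle])
  have [measurable]: "(\<lambda>p. snd p k) \<in> borel_measurable (circle \<Otimes>\<^sub>M coords n)"
    using assms by (intro measurable_compose[OF measurable_snd measurable_component_singleton]) auto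
  show ?thesis unfolding relative_coeff_def by measurable
qed

lemma measurable_szego_fixed:
  assumes "cmod x = 1" "k \<le> n"
  shows "(\<lambda>v. szego v x k) \<in> borel_measurable (coords n)"
  using measurable_compose[OF measurable_Pair1' measurable_szego_joint[OF assms(2)], of x] assms(1)
  by simp

text \<open>A function that reads only the first \<open>k\<close> coordinates factors through
  restriction to them, and restriction is measurable between the product spaces.\<close>

lemma measurable_coords_mono:
  assumes "f \<in> borel_measurable (coords k)" "\<And>v w. (\<And>j. j < k \<Longrightarrow> v j = w j) \<Longrightarrow> f v = f w" "k \<le> n"
  shows "f \<in> borel_measurable (coords n)"
proof -
  have "(\<lambda>v. restrict v {..<k}) \<in> coords n \<rightarrow>\<^sub>M coords k"
    using assms(3) by (intro measurable_restrict_subset) auto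
  from measurable_compose[OF this assms(1)] show ?thesis
    by (rule measurable_cong[THEN iffD1, rotated]) (auto intro!: assms(2))
qed

locale rotational_family =
  fixes D :: "nat \<Rightarrow> complex measure"
  assumes prob_D: "prob_space (D i)"
    and sets_D [simp, measurable_cong]: "sets (D i) = sets borel"
    and rot_D: "rotationally_invariant (D i)"
begin

sublocale product_sigma_finite D
  by (rule product_sigma_finite.intro) (rule prob_space_imp_sigma_finite[OF prob_D])

lemma sets_PiM_D [measurable_cong]: "sets (PiM I D) = sets (PiM I (\<lambda>_. borel))"
  by (intro sets_PiM_cong) auto

lemma space_PiM_D: "space (PiM I D) = space (PiM I (\<lambda>_. borel :: complex measure))"
  by (rule sets_eq_imp_space_eq[OF sets_PiM_D])

lemma prob_space_PiM_D: "prob_space (PiM I D)"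
  by (rule prob_space_PiM) (rule prob_D)

lemma measurable_PiM_D_iff: "f \<in> PiM I D \<rightarrow>\<^sub>M N \<longleftrightarrow> f \<in> PiM I (\<lambda>_. borel) \<rightarrow>\<^sub>M N"
  using measurable_cong_sets[OF sets_PiM_D refl] by blast

lemma nn_integral_Suc:
  assumes "f \<in> borel_measurable (coords (Suc n))"
  shows "(\<integral>\<^sup>+v. f v \<partial>PiM {..<Suc n} D) = (\<integral>\<^sup>+v. (\<integral>\<^sup>+y. f (v(n := y)) \<partial>D n) \<partial>PiM {..<n} D)"
  using assms unfolding lessThan_Suc measurable_PiM_D_iff[symmetric]
  by (intro product_nn_integral_insert) auto

text \<open>The last coordinate is integrated first: with the earlier ones fixed its multiplier is a
  constant rotation, which its law absorbs. Repeating this removes all multipliers, and boxes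
  determine the product measure.\<close>

lemma distr_skew:
  fixes u :: "nat \<Rightarrow> (nat \<Rightarrow> complex) \<Rightarrow> complex"
  assumes meas: "\<And>k. k < n \<Longrightarrow> u k \<in> borel_measurable (coords k)"
    and norm: "\<And>k v. k < n \<Longrightarrow> cmod (u k v) = 1"
    and cong: "\<And>k v w. k < n \<Longrightarrow> (\<And>j. j < k \<Longrightarrow> v j = w j) \<Longrightarrow> u k v = u k w"
  shows "distr (PiM {..<n} D) (coords n) (\<lambda>v. \<lambda>k\<in>{..<n}. v k * u k v) = PiM {..<n} D"
proof (rule PiM_eqI)
  let ?T = "\<lambda>v. \<lambda>k\<in>{..<n}. v k * u k v"
  have T: "?T \<in> PiM {..<n} D \<rightarrow>\<^sub>M coords n"
    unfolding measurable_PiM_D_iff using measurable_coords_mono[OF meas cong]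
    by (intro measurable_restrict borel_measurable_times measurable_component_singleton) auto
  fix A assume A: "\<And>i. i \<in> {..<n} \<Longrightarrow> A i \<in> sets (D i)"
  have "(\<integral>\<^sup>+v. (\<Prod>k<i. indicator (A k) (v k * u k v)) \<partial>PiM {..<i} D) = (\<Prod>k<i. emeasure (D k) (A k))"
    if "i \<le> n" for i
    using that
  proof (induction i)
    case 0
    then show ?case by (simp add: PiM_empty)
  next
    case (Suc i)
    have meas_i: "u k \<in> borel_measurable (coords j)" if "k \<le> i" "k \<le> j" for k j
      using Suc.prems that by (intro measurable_coords_mono[OF meas cong]) auto
    have A': "A k \<in> sets borel" if "k \<le> i" for k using A[of k] that Suc.prems by simp
    have prod_meas: "(\<lambda>v. \<Prod>k<l. indicator (A k) (v k * u k v) :: ennreal) \<in> borel_measurable (coords l)"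
      if "l \<le> Suc i" for l
    proof (rule borel_measurable_prod_ennreal)
      fix k assume "k \<in> {..<l}"
      then have k: "k \<le> i" "k < l" using that by auto
      have "(\<lambda>v. v k * u k v) \<in> borel_measurable (coords l)"
        using k by (intro borel_measurable_times meas_i measurable_component_singleton) auto
      then show "(\<lambda>v. indicator (A k) (v k * u k v) :: ennreal) \<in> borel_measurable (coords l)"
        by (rule measurable_compose) (intro borel_measurable_indicator A' k)
    qed
    have "(\<integral>\<^sup>+v. (\<Prod>k<Suc i. indicator (A k) (v k * u k v)) \<partial>PiM {..<Suc i} D) =
        (\<integral>\<^sup>+v. (\<integral>\<^sup>+y. (\<Prod>k<Suc i. indicator (A k) ((v(i := y)) k * u k (v(i := y)))) \<partial>D i) \<partial>PiM {..<i} D)"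
      by (intro nn_integral_Suc prod_meas) simp
    also have "\<dots> = (\<integral>\<^sup>+v. (\<Prod>k<i. indicator (A k) (v k * u k v)) * emeasure (D i) (A i) \<partial>PiM {..<i} D)"
    proof (rule nn_integral_cong)
      fix v
      have c: "u k (v(i := y)) = u k v" if "k \<le> i" for k y
        using that Suc.prems by (intro cong) auto
      have "(\<integral>\<^sup>+y. (\<Prod>k<Suc i. indicator (A k) ((v(i := y)) k * u k (v(i := y)))) \<partial>D i) =
          (\<integral>\<^sup>+y. (\<Prod>k<i. indicator (A k) (v k * u k v)) * indicator (A i) (u i v * y) \<partial>D i)"
        by (intro nn_integral_cong) (simp add: c mult.commute)
      also have "\<dots> = (\<Prod>k<i. indicator (A k) (v k * u k v)) * (\<integral>\<^sup>+y. indicator (A i) (u i v * y) \<partial>D i)"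
      proof (rule nn_integral_cmult)
        have "(\<lambda>y. u i v * y) \<in> borel \<rightarrow>\<^sub>M borel" by measurable
        then have "(\<lambda>y. indicator (A i) (u i v * y) :: ennreal) \<in> borel_measurable borel"
          by (rule measurable_compose) (intro borel_measurable_indicator A' order_refl)
        then show "(\<lambda>y. indicator (A i) (u i v * y) :: ennreal) \<in> borel_measurable (D i)" by simp
      qed
      also have "(\<integral>\<^sup>+y. indicator (A i) (u i v * y) \<partial>D i) = (\<integral>\<^sup>+y. indicator (A i) y \<partial>D i)"
        using Suc.prems
        by (intro nn_integral_rotationally_invariant rot_D sets_D norm borel_measurable_indicator A') auto
      also have "\<dots> = emeasure (D i) (A i)" using A' by simp
      finally show "(\<integral>\<^sup>+y. (\<Prod>k<Suc i. indicator (A k) ((v(i := y)) k * u k (v(i := y)))) \<partial>D i) =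
          (\<Prod>k<i. indicator (A k) (v k * u k v)) * emeasure (D i) (A i)" .
    qed
    also have "\<dots> = (\<Prod>k<Suc i. emeasure (D k) (A k))"
      using Suc prod_meas[of i]
      by (subst nn_integral_multc) (simp_all add: measurable_PiM_D_iff)
    finally show ?case .
  qed
  note boxes = this[OF order_refl]
  have box_sets: "Pi\<^sub>E {..<n} A \<in> sets (coords n)"
    using A by (intro sets_PiM_I_finite) auto
  have "emeasure (distr (PiM {..<n} D) (coords n) ?T) (Pi\<^sub>E {..<n} A) =
      (\<integral>\<^sup>+v. indicator (Pi\<^sub>E {..<n} A) (?T v) \<partial>PiM {..<n} D)"
    using T box_sets by (simp add: nn_integral_indicator[symmetric] nn_integral_distr del: nn_integral_indicator)
  also have "\<dots> = (\<integral>\<^sup>+v. (\<Prod>k<n. indicator (A k) (v k * u k v)) \<partial>PiM {..<n} D)"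
  proof (rule nn_integral_cong)
    fix v
    show "indicator (Pi\<^sub>E {..<n} A) (?T v) = (\<Prod>k<n. indicator (A k) (v k * u k v) :: ennreal)"
    proof (cases "\<forall>k<n. v k * u k v \<in> A k")
      case True
      then show ?thesis by (auto simp: indicator_def PiE_iff)
    next
      case False
      then obtain k where k: "k < n" "v k * u k v \<notin> A k" by blast
      then have "(\<Prod>k<n. indicator (A k) (v k * u k v) :: ennreal) = 0"
        by (intro prod_zero) (auto intro!: bexI[of _ k])
      moreover have "?T v \<notin> Pi\<^sub>E {..<n} A" using k by (auto simp: PiE_iff)
      ultimately show ?thesis by simp
    qed
  qed
  finally show "emeasure (distr (PiM {..<n} D) (coords n) ?T) (Pi\<^sub>E {..<n} A) =
      (\<Prod>i\<in>{..<n}. emeasure (D i) (A i))"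
    using boxes by simp
qed (simp_all add: sets_PiM_D)

lemma nn_integral_skew:
  fixes u :: "nat \<Rightarrow> (nat \<Rightarrow> complex) \<Rightarrow> complex"
  assumes meas: "\<And>k. k < n \<Longrightarrow> u k \<in> borel_measurable (coords k)"
    and "\<And>k v. k < n \<Longrightarrow> cmod (u k v) = 1"
    and cong: "\<And>k v w. k < n \<Longrightarrow> (\<And>j. j < k \<Longrightarrow> v j = w j) \<Longrightarrow> u k v = u k w"
    and f: "f \<in> borel_measurable (coords n)"
  shows "(\<integral>\<^sup>+v. f (\<lambda>k\<in>{..<n}. v k * u k v) \<partial>PiM {..<n} D) = (\<integral>\<^sup>+v. f v \<partial>PiM {..<n} D)"
proof -
  have T: "(\<lambda>v. \<lambda>k\<in>{..<n}. v k * u k v) \<in> PiM {..<n} D \<rightarrow>\<^sub>M coords n"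
    unfolding measurable_PiM_D_iff using measurable_coords_mono[OF meas cong]
    by (intro measurable_restrict borel_measurable_times measurable_component_singleton) auto
  show ?thesis
    using nn_integral_distr[OF T, of f] f distr_skew[OF assms(1-3)] by simp
qed

text \<open>One coordinate is transformed at a time. The induction runs over all \<open>f\<close>,
  since integrating out the transformed last coordinate produces a new integrand for the remaining
  ones.\<close>

lemma nn_integral_palm_flip_prod:
  assumes U: "circle_uniform U" and disc: "\<And>k. k < m \<Longrightarrow> AE w in D k. cmod w < 1"
    and f: "f \<in> borel_measurable (coords m)"
  shows "(\<integral>\<^sup>+v. (\<Prod>k<m. ennreal (poisson_weight (v k))) * f v \<partial>PiM {..<m} D) =
    (\<integral>\<^sup>+v. f (\<lambda>k\<in>{..<m}. palm_flip (v k)) \<partial>PiM {..<m} D)"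
  using disc f
proof (induction m arbitrary: f)
  case 0
  then show ?case by (simp add: PiM_empty nn_integral_count_space_finite cong: restrict_cong)
next
  case (Suc m)
  interpret circle_uniform U by fact
  note f[measurable] = Suc.prems(2)
  have upd: "(\<lambda>p. (fst p)(m := snd p)) \<in> coords m \<Otimes>\<^sub>M borel \<rightarrow>\<^sub>M coords (Suc m)"
    using measurable_add_dim[of m "{..<m}" "\<lambda>_. borel :: complex measure"]
    by (simp add: lessThan_Suc split_beta')
  have upd_f: "(\<lambda>p. f ((fst p)(m := snd p))) \<in> borel_measurable (coords m \<Otimes>\<^sub>M borel)"
    by (rule measurable_compose[OF upd f])
  have flip_f: "(\<lambda>p. f ((fst p)(m := palm_flip (snd p)))) \<in> borel_measurable (coords m \<Otimes>\<^sub>M borel)"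
  proof -
    have "(\<lambda>p. (fst p, palm_flip (snd p))) \<in> coords m \<Otimes>\<^sub>M borel \<rightarrow>\<^sub>M coords m \<Otimes>\<^sub>M borel"
      by measurable
    from measurable_compose[OF this upd_f] show ?thesis by simp
  qed
  interpret Dm: prob_space "D m" by (rule prob_D)
  have g: "(\<lambda>v. \<integral>\<^sup>+y. f (v(m := palm_flip y)) \<partial>D m) \<in> borel_measurable (coords m)"
    using flip_f
    by (intro sigma_finite_measure.borel_measurable_nn_integral[OF sigma_finite_measures]) (simp add: split_beta' cong: measurable_cong_sets)
  have [measurable]: "(\<lambda>v. v k) \<in> borel_measurable (coords (Suc m))" if "k < Suc m" for k
    using that by (intro measurable_component_singleton) auto
  have "(\<integral>\<^sup>+v. (\<Prod>k<Suc m. ennreal (poisson_weight (v k))) * f v \<partial>PiM {..<Suc m} D) =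
      (\<integral>\<^sup>+v. (\<integral>\<^sup>+y. (\<Prod>k<Suc m. ennreal (poisson_weight ((v(m := y)) k))) * f (v(m := y)) \<partial>D m) \<partial>PiM {..<m} D)"
    by (rule nn_integral_Suc) (intro borel_measurable_times_ennreal f borel_measurable_prod_ennreal, measurable)
  also have "\<dots> = (\<integral>\<^sup>+v. (\<Prod>k<m. ennreal (poisson_weight (v k))) * (\<integral>\<^sup>+y. f (v(m := palm_flip y)) \<partial>D m) \<partial>PiM {..<m} D)"
  proof (rule nn_integral_cong)
    fix v assume "v \<in> space (PiM {..<m} D)"
    then have v: "v \<in> space (coords m)" by (simp add: space_PiM_D)
    have fv: "(\<lambda>y. f (v(m := y))) \<in> borel_measurable borel"
      using measurable_compose[OF measurable_Pair1'[OF v] upd_f] by simp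
    have "(\<integral>\<^sup>+y. (\<Prod>k<Suc m. ennreal (poisson_weight ((v(m := y)) k))) * f (v(m := y)) \<partial>D m) =
        (\<integral>\<^sup>+y. (\<Prod>k<m. ennreal (poisson_weight (v k))) * (ennreal (poisson_weight y) * f (v(m := y))) \<partial>D m)"
      by (intro nn_integral_cong) (simp add: mult_ac)
    also have "\<dots> = (\<Prod>k<m. ennreal (poisson_weight (v k))) * (\<integral>\<^sup>+y. ennreal (poisson_weight y) * f (v(m := y)) \<partial>D m)"
    proof (rule nn_integral_cmult)
      have "(\<lambda>y. ennreal (poisson_weight y) * f (v(m := y))) \<in> borel_measurable borel"
        by (intro borel_measurable_times_ennreal fv) measurable
      then show "(\<lambda>y. ennreal (poisson_weight y) * f (v(m := y))) \<in> borel_measurable (D m)"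
        using measurable_cong_sets[OF sets_D[of m] refl] by blast
    qed
    also have "(\<integral>\<^sup>+y. ennreal (poisson_weight y) * f (v(m := y)) \<partial>D m) = (\<integral>\<^sup>+y. f (v(m := palm_flip y)) \<partial>D m)"
      by (intro nn_integral_palm_flip prob_D sets_D rot_D Suc.prems fv) simp
    finally show "(\<integral>\<^sup>+y. (\<Prod>k<Suc m. ennreal (poisson_weight ((v(m := y)) k))) * f (v(m := y)) \<partial>D m) =
      (\<Prod>k<m. ennreal (poisson_weight (v k))) * (\<integral>\<^sup>+y. f (v(m := palm_flip y)) \<partial>D m)" .
  qed
  also have "\<dots> = (\<integral>\<^sup>+v. (\<integral>\<^sup>+y. f ((\<lambda>k\<in>{..<m}. palm_flip (v k))(m := palm_flip y)) \<partial>D m) \<partial>PiM {..<m} D)"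
    using Suc.prems by (intro Suc.IH g) simp
  also have "\<dots> = (\<integral>\<^sup>+v. (\<integral>\<^sup>+y. f (\<lambda>k\<in>{..<Suc m}. palm_flip ((v(m := y)) k)) \<partial>D m) \<partial>PiM {..<m} D)"
    by (intro nn_integral_cong arg_cong[of _ _ f]) (auto simp: fun_eq_iff restrict_def less_Suc_eq)
  also have "\<dots> = (\<integral>\<^sup>+v. f (\<lambda>k\<in>{..<Suc m}. palm_flip (v k)) \<partial>PiM {..<Suc m} D)"
  proof (rule nn_integral_Suc[symmetric])
    have "(\<lambda>v. \<lambda>k\<in>{..<Suc m}. palm_flip (v k)) \<in> coords (Suc m) \<rightarrow>\<^sub>M coords (Suc m)"
      by (intro measurable_restrict measurable_compose[OF _ measurable_palm_flip] measurable_component_singleton) auto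
    then show "(\<lambda>v. f (\<lambda>k\<in>{..<Suc m}. palm_flip (v k))) \<in> borel_measurable (coords (Suc m))"
      by (rule measurable_compose) (rule f)
  qed
  finally show ?case .
qed

text \<open>Moves a law on the plane that is carried by the circle to the space
  \<open>circle\<close> and back. The value 1 off the circle makes \<open>h\<close> total; almost
  surely \<open>h\<close> is the identity.\<close>

lemma circle_uniform_of_D:
  assumes "AE w in D m. cmod w = 1"
  defines "h \<equiv> \<lambda>z. if cmod z = 1 then z else 1"
  shows "circle_uniform (distr (D m) circle h)" "distr (distr (D m) circle h) borel (\<lambda>z. z) = D m"
proof -
  interpret Dm: prob_space "D m" by (rule prob_D)
  have h: "h \<in> borel \<rightarrow>\<^sub>M circle"
    unfolding circle_def h_def by (intro measurable_restrict_space2) (auto, measurable)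
  then have hD: "h \<in> D m \<rightarrow>\<^sub>M circle" by simp
  show "circle_uniform (distr (D m) circle h)"
  proof (intro circle_uniform.intro circle_uniform_axioms.intro)
    show "prob_space (distr (D m) circle h)" by (rule Dm.prob_space_distr[OF hD])
    fix u :: complex assume u: "cmod u = 1"
    have m: "(\<lambda>z. u * z) \<in> circle \<rightarrow>\<^sub>M circle"
      unfolding circle_def using u by (intro measurable_restrict_space3) (auto simp: norm_mult)
    have mb: "(\<lambda>z. u * z) \<in> borel \<rightarrow>\<^sub>M borel" by measurable
    have "distr (distr (D m) circle h) circle (\<lambda>z. u * z) = distr (D m) circle (\<lambda>z. u * h z)"
      using m hD by (simp add: distr_distr comp_def)
    also have "\<dots> = distr (D m) circle (\<lambda>z. h (u * z))"
    proof (rule distr_cong_AE)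
      show "AE z in D m. u * h z = h (u * z)"
        using assms(1) by eventually_elim (use u in \<open>simp add: h_def norm_mult\<close>)
      show "(\<lambda>z. u * h z) \<in> D m \<rightarrow>\<^sub>M circle" by (rule measurable_compose[OF hD m])
      show "(\<lambda>z. h (u * z)) \<in> D m \<rightarrow>\<^sub>M circle" using measurable_compose[OF mb h] by simp
    qed simp_all
    also have "\<dots> = distr (distr (D m) borel (\<lambda>z. u * z)) circle h"
      using mb h by (simp add: distr_distr comp_def)
    also have "\<dots> = distr (D m) circle h"
      using rot_D[of m] u by (simp add: rotationally_invariant_def)
    finally show "distr (distr (D m) circle h) circle (\<lambda>z. u * z) = distr (D m) circle h" .
  qed simp
  have "distr (distr (D m) circle h) borel (\<lambda>z. z) = distr (D m) borel h"
    using hD measurable_id_circle by (simp add: distr_distr comp_def)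
  also have "\<dots> = distr (D m) (D m) (\<lambda>z. z)"
  proof (rule distr_cong_AE)
    show "AE z in D m. h z = z" using assms(1) by eventually_elim (simp add: h_def)
    show "h \<in> D m \<rightarrow>\<^sub>M borel" using measurable_compose[OF hD measurable_id_circle] by simp
  qed simp_all
  also have "\<dots> = D m" by (rule distr_id)
  finally show "distr (distr (D m) circle h) borel (\<lambda>z. z) = D m" .
qed

end

section \<open>Disintegration of the random measure\<close>

lemma integral_bind_complex:
  fixes f :: "'b \<Rightarrow> complex"
  assumes "prob_space M" and N: "N \<in> M \<rightarrow>\<^sub>M prob_algebra K"
    and f[measurable]: "f \<in> borel_measurable K" and B: "\<And>x. x \<in> space K \<Longrightarrow> cmod (f x) \<le> B"
  shows "(\<integral>y. f y \<partial>(M \<bind> N)) = (\<integral>x. (\<integral>y. f y \<partial>N x) \<partial>M)"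
proof -
  interpret prob_space M by fact
  note N'[measurable] = measurable_prob_algebraD[OF N]
  have M: "M \<in> space (prob_algebra M)" by (simp add: space_prob_algebra prob_space_axioms)
  have Nx: "prob_space (N x)" "sets (N x) = sets K" "space (N x) = space K" if "x \<in> space M" for x
    using measurable_space[OF N that] sets_eq_imp_space_eq[of "N x" K] by (auto simp: space_prob_algebra)
  have int: "integrable Q f" if "prob_space Q" "sets Q = sets K" for Q
  proof -
    interpret Q: prob_space Q by fact
    have "f \<in> borel_measurable Q" using f measurable_cong_sets[OF that(2) refl] by blast
    then show ?thesis
      using B sets_eq_imp_space_eq[OF that(2)] by (intro Q.integrable_const_bound[where B=B]) auto
  qed
  have int_bind: "integrable (M \<bind> N) f"
    by (intro int prob_space_bind'[OF M N] sets_bind'[OF M N])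
  have "integrable M (\<lambda>x. \<integral>y. f y \<partial>N x)"
  proof (rule integrable_const_bound[where B=B])
    show "AE x in M. cmod (\<integral>y. f y \<partial>N x) \<le> B"
    proof (rule AE_I2)
      fix x assume x: "x \<in> space M"
      interpret Nx: prob_space "N x" using Nx[OF x] by blast
      have "cmod (\<integral>y. f y \<partial>N x) \<le> (\<integral>y. cmod (f y) \<partial>N x)" by (rule integral_norm_bound)
      also have "\<dots> \<le> (\<integral>y. B \<partial>N x)"
        using B Nx[OF x] int[OF Nx(1,2)[OF x]] by (intro integral_mono) auto
      finally show "cmod (\<integral>y. f y \<partial>N x) \<le> B" by (simp add: Nx.prob_space)
    qed
    show "(\<lambda>x. \<integral>y. f y \<partial>N x) \<in> borel_measurable M" by measurable
  qed
  note int_outer = this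
  have part: "(\<integral>y. g (f y) \<partial>(M \<bind> N)) = (\<integral>x. (\<integral>y. g (f y) \<partial>N x) \<partial>M)"
    if [measurable]: "g \<in> borel_measurable borel" and g: "\<And>z. \<bar>g z\<bar> \<le> cmod z" for g :: "complex \<Rightarrow> real"
  proof (rule integral_bind[where K=K and B=B and B'=1])
    show "AE x in M. emeasure (N x) (space (N x)) \<le> ennreal 1"
      using Nx prob_space.emeasure_space_1 by (intro AE_I2) fastforce
    fix y assume "y \<in> space K"
    then show "\<bar>g (f y)\<bar> \<le> B" using g[of "f y"] B[of y] by linarith
  qed (auto intro: finite_measure_axioms)
  show ?thesis
  proof (rule complex_eqI)
    have "Re (\<integral>y. f y \<partial>(M \<bind> N)) = (\<integral>y. Re (f y) \<partial>(M \<bind> N))"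
      by (rule integral_Re[symmetric]) (rule int_bind)
    also have "\<dots> = (\<integral>x. (\<integral>y. Re (f y) \<partial>N x) \<partial>M)"
      by (rule part) (auto simp: abs_Re_le_cmod)
    also have "\<dots> = (\<integral>x. Re (\<integral>y. f y \<partial>N x) \<partial>M)"
      using int Nx by (intro Bochner_Integration.integral_cong refl integral_Re) auto
    also have "\<dots> = Re (\<integral>x. (\<integral>y. f y \<partial>N x) \<partial>M)"
      by (rule integral_Re[OF int_outer])
    finally show "Re (\<integral>y. f y \<partial>(M \<bind> N)) = Re (\<integral>x. (\<integral>y. f y \<partial>N x) \<partial>M)" .
    have "Im (\<integral>y. f y \<partial>(M \<bind> N)) = (\<integral>y. Im (f y) \<partial>(M \<bind> N))"
      by (rule integral_Im[symmetric]) (rule int_bind)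
    also have "\<dots> = (\<integral>x. (\<integral>y. Im (f y) \<partial>N x) \<partial>M)"
      by (rule part) (auto simp: abs_Im_le_cmod)
    also have "\<dots> = (\<integral>x. Im (\<integral>y. f y \<partial>N x) \<partial>M)"
      using int Nx by (intro Bochner_Integration.integral_cong refl integral_Im) auto
    also have "\<dots> = Im (\<integral>x. (\<integral>y. f y \<partial>N x) \<partial>M)"
      by (rule integral_Im[OF int_outer])
    finally show "Im (\<integral>y. f y \<partial>(M \<bind> N)) = Im (\<integral>x. (\<integral>y. f y \<partial>N x) \<partial>M)" .
  qed
qed

text \<open>Truncated to the polydisc, where it is bounded.\<close>

definition szego_weight :: "nat \<Rightarrow> complex \<times> (nat \<Rightarrow> complex) \<Rightarrow> real" where
  "szego_weight m p = (if \<forall>k<m. cmod (snd p k) < 1 then (cmod (szego (snd p) (fst p) m))\<^sup>2 else 0)"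

definition norm_weight :: "nat \<Rightarrow> (nat \<Rightarrow> complex) \<Rightarrow> real" where
  "norm_weight m v = (if \<forall>k<m. cmod (v k) < 1 then \<Prod>k<m. 1 - (cmod (v k))\<^sup>2 else 0)"

lemma measurable_polydisc [measurable]:
  "Measurable.pred (coords m) (\<lambda>v. \<forall>k<m. cmod (v k) < 1)"
proof -
  have "Measurable.pred (coords m) (\<lambda>v. \<forall>k\<in>{..<m}. cmod (v k) < 1)"
    by (intro pred_intros_finite) auto
  then show ?thesis by simp
qed

lemma measurable_szego_weight [measurable]: "szego_weight m \<in> borel_measurable (circle \<Otimes>\<^sub>M coords m)"
proof -
  note [measurable] = measurable_szego_joint[of m m, OF order_refl]
  have [measurable]: "Measurable.pred (circle \<Otimes>\<^sub>M coords m) (\<lambda>p. \<forall>k<m. cmod (snd p k) < 1)"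
    by (rule measurable_compose[OF measurable_snd measurable_polydisc])
  show ?thesis unfolding szego_weight_def[abs_def] by measurable
qed

lemma measurable_norm_weight [measurable]: "norm_weight m \<in> borel_measurable (coords m)"
proof -
  have [measurable]: "(\<lambda>v. \<Prod>k<m. 1 - (cmod (v k))\<^sup>2) \<in> borel_measurable (coords m)"
  proof (rule borel_measurable_prod)
    fix k assume "k \<in> {..<m}"
    then have [measurable]: "(\<lambda>v. v k) \<in> borel_measurable (coords m)"
      by (intro measurable_component_singleton)
    show "(\<lambda>v. 1 - (cmod (v k))\<^sup>2) \<in> borel_measurable (coords m)" by measurable
  qed
  show ?thesis unfolding norm_weight_def[abs_def] by measurable
qed

lemma szego_weight_nonneg [simp]: "szego_weight m p \<ge> 0"
  by (simp add: szego_weight_def)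

lemma norm_weight_nonneg [simp]: "norm_weight m v \<ge> 0"
  unfolding norm_weight_def by (auto intro!: prod_nonneg simp: abs_square_le_1 less_imp_le)

text \<open>Each step of the recursion at most doubles the modulus, so |Phi_m| <= 2^m on the
  circle.\<close>

lemma szego_weight_le:
  assumes "cmod (fst p) = 1"
  shows "szego_weight m p \<le> 4 ^ m"
proof -
  have "cmod (szego v z k) \<le> 2 ^ k" if "\<forall>j<m. cmod (v j) < 1" "k \<le> m" "cmod z = 1" for v z k
    using that(2)
  proof (induction k)
    case (Suc k)
    have "cmod (szego v z (Suc k)) \<le> cmod (szego v z k) + cmod (v k) * cmod (szego v z k)"
      using that(3) norm_triangle_ineq4[of "z * szego v z k" "v k * z ^ k * cnj (szego v z k)"]
      by (simp add: norm_mult norm_power)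
    also have "\<dots> \<le> cmod (szego v z k) + 1 * cmod (szego v z k)"
      using that(1) Suc.prems by (intro add_mono mult_right_mono) (auto simp: less_imp_le)
    also have "\<dots> \<le> 2 ^ Suc k" using Suc by simp
    finally show ?case .
  qed simp
  from this[of "snd p" m "fst p"] assms show ?thesis
    using power_mono[of "cmod (szego (snd p) (fst p) m)" "2 ^ m" 2]
    by (auto simp: szego_weight_def power_mult[symmetric] mult.commute[of m] power_mult)
qed

section \<open>Laws of the coefficients and of a point drawn together with them\<close>

text \<open>\<open>m\<close> counts the coefficients inside the disc, one less than the number of
  atoms. Independence and marginals are stated together as one product law, the form in which
  coordinates can be integrated out one after another.\<close>

locale random_verblunsky = prob_space M + rotational_family D
  for M :: "'w measure" and D :: "nat \<Rightarrow> complex measure" +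
  fixes \<mu> :: "'w \<Rightarrow> complex measure" and m :: nat
  assumes measurable_mu [measurable]: "\<mu> \<in> M \<rightarrow>\<^sub>M prob_algebra circle"
    and card_supp: "AE \<omega> in M. finite (supp (\<mu> \<omega>)) \<and> card (supp (\<mu> \<omega>)) = Suc m"
    and law_gamma: "distr M (coords (Suc m)) (\<lambda>\<omega>. \<lambda>k\<in>{..<Suc m}. modified_verblunsky (\<mu> \<omega>) k) =
      PiM {..<Suc m} D"
begin

lemma mu_space: "\<omega> \<in> space M \<Longrightarrow> \<mu> \<omega> \<in> space (prob_algebra circle)"
  using measurable_space[OF measurable_mu] .

lemma sets_mu: "\<omega> \<in> space M \<Longrightarrow> sets (\<mu> \<omega>) = sets circle"
  using prob_algebra_circleD(2)[OF mu_space] .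

definition coef :: "'w \<Rightarrow> nat \<Rightarrow> complex" where
  "coef \<omega> = (\<lambda>k\<in>{..<Suc m}. szego_coeff (\<mu> \<omega>) k)"

text \<open>The coefficients that stay fixed while the last one is averaged out.\<close>

definition inner_coef :: "'w \<Rightarrow> nat \<Rightarrow> complex" where
  "inner_coef \<omega> = (\<lambda>k\<in>{..<m}. szego_coeff (\<mu> \<omega>) k)"

lemma measurable_coef [measurable]: "coef \<in> M \<rightarrow>\<^sub>M coords (Suc m)"
  unfolding coef_def[abs_def] by measurable

lemma measurable_inner_coef [measurable]: "inner_coef \<in> M \<rightarrow>\<^sub>M coords m"
  unfolding inner_coef_def[abs_def] by measurable

lemma inner_coef_eq: "inner_coef \<omega> = restrict (coef \<omega>) {..<m}"
  by (auto simp: inner_coef_def coef_def fun_eq_iff)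

text \<open>The coefficients arise from the modified ones through unimodular factors that depend on
  earlier modified coefficients only, and \<open>distr_skew\<close> says that such factors leave a
  product of rotation invariant laws unchanged.\<close>

lemma law_coef: "distr M (coords (Suc m)) coef = PiM {..<Suc m} D"
proof -
  define u :: "nat \<Rightarrow> (nat \<Rightarrow> complex) \<Rightarrow> complex"
    where "u k v = (\<Prod>j<k. unimodular (1 - cnj (v j)))" for k v
  let ?T = "\<lambda>v. \<lambda>k\<in>{..<Suc m}. v k * u k v"
  let ?G = "\<lambda>\<omega>. \<lambda>k\<in>{..<Suc m}. modified_verblunsky (\<mu> \<omega>) k"
  have u_meas: "u k \<in> borel_measurable (coords k)" for k
    unfolding u_def
    by (intro borel_measurable_prod measurable_compose[OF _ measurable_unimodular] borel_measurable_diff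
        borel_measurable_const measurable_compose[OF _ measurable_cnj] measurable_component_singleton)
  have u_norm: "cmod (u k v) = 1" for k v by (simp add: u_def prod_norm[symmetric])
  have u_cong: "u k v = u k w" if "\<And>j. j < k \<Longrightarrow> v j = w j" for k v w
    using that by (simp add: u_def)
  have G: "?G \<in> M \<rightarrow>\<^sub>M coords (Suc m)" by measurable
  have T: "?T \<in> coords (Suc m) \<rightarrow>\<^sub>M coords (Suc m)"
    using measurable_coords_mono[OF u_meas u_cong]
    by (intro measurable_restrict borel_measurable_times measurable_component_singleton) auto
  have "distr M (coords (Suc m)) coef = distr M (coords (Suc m)) (\<lambda>\<omega>. ?T (?G \<omega>))"
  proof (rule distr_cong_AE)
    show "AE \<omega> in M. coef \<omega> = ?T (?G \<omega>)"
      using card_supp AE_space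
    proof eventually_elim
      case (elim \<omega>)
      then show ?case
        using szego_coeff_eq_modified[OF mu_space, of \<omega> m]
        by (auto simp: coef_def fun_eq_iff u_def intro!: prod.cong)
    qed
    show "(\<lambda>\<omega>. ?T (?G \<omega>)) \<in> M \<rightarrow>\<^sub>M coords (Suc m)" by (rule measurable_compose[OF G T])
  qed simp_all
  also have "\<dots> = distr (distr M (coords (Suc m)) ?G) (coords (Suc m)) ?T"
    using G T by (simp add: distr_distr comp_def)
  also have "\<dots> = PiM {..<Suc m} D"
    unfolding law_gamma by (rule distr_skew[OF u_meas u_norm u_cong])
  finally show ?thesis .
qed

lemma AE_bounds:
  "AE \<omega> in M. (\<forall>k<m. cmod (szego_coeff (\<mu> \<omega>) k) < 1) \<and> cmod (szego_coeff (\<mu> \<omega>) m) = 1"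
  using card_supp AE_space
proof eventually_elim
  case (elim \<omega>)
  then show ?case using szego_coeff_bounds[OF mu_space, of \<omega> m] by blast
qed

text \<open>\<open>D k\<close> is the law of the k-th coefficient by \<open>law_coef\<close>, so
  almost sure properties of that coefficient pass to \<open>D k\<close>.\<close>

lemma AE_D:
  assumes "k < Suc m" and P[measurable]: "Measurable.pred borel P"
    and "AE \<omega> in M. P (szego_coeff (\<mu> \<omega>) k)"
  shows "AE w in D k. P w"
proof -
  have [measurable]: "(\<lambda>v. v k) \<in> borel_measurable (coords (Suc m))"
    using assms(1) by (intro measurable_component_singleton) simp
  have "AE v in distr M (coords (Suc m)) coef. P (v k)"
    using assms by (subst AE_distr_iff) (auto simp: coef_def)
  then have "AE v in PiM {..<Suc m} D. P (v k)" unfolding law_coef .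
  have E: "distr (PiM {..<Suc m} D) (D k) (\<lambda>v. v k) = D k"
    using assms(1) by (intro distr_PiM_component prob_D) simp
  have "(AE w in distr (PiM {..<Suc m} D) (D k) (\<lambda>v. v k). P w) \<longleftrightarrow> (AE v in PiM {..<Suc m} D. P (v k))"
    using assms(1) by (intro AE_distr_iff) (auto simp: measurable_component_singleton)
  then have "AE w in distr (PiM {..<Suc m} D) (D k) (\<lambda>v. v k). P w"
    using \<open>AE v in PiM {..<Suc m} D. P (v k)\<close> by blast
  then show ?thesis unfolding E .
qed

lemma AE_D_disc: "k < m \<Longrightarrow> AE w in D k. cmod w < 1"
  by (rule AE_D) (use AE_bounds in auto)

lemma AE_D_circle: "AE w in D m. cmod w = 1"
  by (rule AE_D) (use AE_bounds in auto)

definition U :: "complex measure" where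
  "U = distr (D m) circle (\<lambda>z. if cmod z = 1 then z else 1)"

sublocale U: circle_uniform U
  unfolding U_def by (rule circle_uniform_of_D(1)[OF AE_D_circle])

lemma D_m_eq: "D m = distr U borel (\<lambda>z. z)"
  using circle_uniform_of_D(2)[OF AE_D_circle] by (simp add: U_def)

text \<open>The absence of a constant term leaves only positive powers, whose uniform averages are
  zero.\<close>

lemma integral_D_m_poly: "(\<integral>y. y * poly p y \<partial>D m) = 0"
proof -
  have [measurable]: "(\<lambda>z. z) \<in> U \<rightarrow>\<^sub>M borel"
    using measurable_id_circle by simp
  have "(\<lambda>y. y * poly p y) \<in> borel_measurable borel"
    by (intro borel_measurable_continuous_onI continuous_intros)
  then have "(\<integral>y. y * poly p y \<partial>D m) = (\<integral>y. y * poly p y \<partial>U)"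
    unfolding D_m_eq by (intro integral_distr) simp
  also have "\<dots> = (\<integral>y. (\<Sum>i\<le>degree p. coeff p i * y ^ Suc i) \<partial>U)"
    by (simp add: poly_altdef sum_distrib_left mult_ac)
  also have "\<dots> = (\<Sum>i\<le>degree p. \<integral>y. coeff p i * y ^ Suc i \<partial>U)"
    by (intro Bochner_Integration.integral_sum U.integrable_U continuous_intros)
  also have "\<dots> = 0"
    by (simp add: U.integral_power del: power_Suc)
  finally show ?thesis .
qed

text \<open>A point drawn from the random measure, together with the inner coefficients.
  Conditioning its first component on the second amounts to averaging the measure over the last
  coefficient.\<close>

definition joint :: "(complex \<times> (nat \<Rightarrow> complex)) measure" where
  "joint = M \<bind> (\<lambda>\<omega>. distr (\<mu> \<omega>) (circle \<Otimes>\<^sub>M coords m) (\<lambda>x. (x, inner_coef \<omega>)))"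

lemma joint_kernel:
  "(\<lambda>\<omega>. distr (\<mu> \<omega>) (circle \<Otimes>\<^sub>M coords m) (\<lambda>x. (x, inner_coef \<omega>))) \<in> M \<rightarrow>\<^sub>M prob_algebra (circle \<Otimes>\<^sub>M coords m)"
  by (intro measurable_distr_prob_space2[OF measurable_mu]) measurable

lemma
  shows sets_joint [simp, measurable_cong]: "sets joint = sets (circle \<Otimes>\<^sub>M coords m)"
    and prob_space_joint: "prob_space joint"
proof -
  have M: "M \<in> space (prob_algebra M)" by (simp add: space_prob_algebra prob_space_axioms)
  show "sets joint = sets (circle \<Otimes>\<^sub>M coords m)"
    unfolding joint_def by (rule sets_bind'[OF M joint_kernel])
  show "prob_space joint"
    unfolding joint_def by (rule prob_space_bind'[OF M joint_kernel])
qed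

lemma measurable_fibre:
  assumes "\<omega> \<in> space M"
  shows "(\<lambda>x. (x, inner_coef \<omega>)) \<in> \<mu> \<omega> \<rightarrow>\<^sub>M circle \<Otimes>\<^sub>M coords m"
proof -
  have "(\<lambda>x. (x, inner_coef \<omega>)) \<in> circle \<rightarrow>\<^sub>M circle \<Otimes>\<^sub>M coords m"
    using measurable_space[OF measurable_inner_coef assms] by simp
  then show ?thesis using measurable_cong_sets[OF sets_mu[OF assms] refl] by blast
qed

lemma nn_integral_joint:
  assumes "f \<in> borel_measurable (circle \<Otimes>\<^sub>M coords m)"
  shows "(\<integral>\<^sup>+p. f p \<partial>joint) = (\<integral>\<^sup>+\<omega>. (\<integral>\<^sup>+x. f (x, inner_coef \<omega>) \<partial>\<mu> \<omega>) \<partial>M)"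
  unfolding joint_def nn_integral_bind[OF assms measurable_prob_algebraD[OF joint_kernel]]
  by (intro nn_integral_cong nn_integral_distr measurable_fibre, assumption)
     (subst measurable_distr_eq1, rule assms)

lemma integral_joint:
  fixes f :: "_ \<Rightarrow> complex"
  assumes "f \<in> borel_measurable (circle \<Otimes>\<^sub>M coords m)"
    and "\<And>p. p \<in> space (circle \<Otimes>\<^sub>M coords m) \<Longrightarrow> cmod (f p) \<le> B"
  shows "(\<integral>p. f p \<partial>joint) = (\<integral>\<omega>. (\<integral>x. f (x, inner_coef \<omega>) \<partial>\<mu> \<omega>) \<partial>M)"
  unfolding joint_def
  by (rule trans[OF integral_bind_complex[OF prob_space_axioms joint_kernel assms]], assumption)
     (intro Bochner_Integration.integral_cong refl integral_distr measurable_fibre assms)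

lemma szego_inner_coef: "szego (inner_coef \<omega>) x m = szego (szego_coeff (\<mu> \<omega>)) x m"
  by (rule szego_cong) (simp add: inner_coef_def)

lemma nn_integral_coef_inner:
  assumes [measurable]: "f \<in> borel_measurable (coords m)"
  shows "(\<integral>\<^sup>+\<omega>. f (inner_coef \<omega>) \<partial>M) = (\<integral>\<^sup>+v. f v \<partial>PiM {..<m} D)"
proof -
  have [measurable]: "(\<lambda>v. restrict v {..<m}) \<in> coords (Suc m) \<rightarrow>\<^sub>M coords m"
    by (intro measurable_restrict_subset) auto
  have "(\<integral>\<^sup>+\<omega>. f (inner_coef \<omega>) \<partial>M) = (\<integral>\<^sup>+v. f (restrict v {..<m}) \<partial>distr M (coords (Suc m)) coef)"
    by (subst nn_integral_distr) (simp_all add: inner_coef_eq)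
  also have "\<dots> = (\<integral>\<^sup>+v. (\<integral>\<^sup>+y. f (restrict (v(m := y)) {..<m}) \<partial>D m) \<partial>PiM {..<m} D)"
    unfolding law_coef by (rule nn_integral_Suc) measurable
  also have "\<dots> = (\<integral>\<^sup>+v. f v \<partial>PiM {..<m} D)"
  proof (rule nn_integral_cong)
    fix v assume "v \<in> space (PiM {..<m} D)"
    then have "restrict (v(m := y)) {..<m} = v" for y
      by (auto simp: space_PiM PiE_def extensional_def fun_eq_iff)
    then show "(\<integral>\<^sup>+y. f (restrict (v(m := y)) {..<m}) \<partial>D m) = f v"
      by (simp add: prob_space.emeasure_space_1[OF prob_D])
  qed
  finally show ?thesis .
qed

text \<open>The case j = 0 stands apart because there is no power of x to exchange for the last
  coefficient; it is the squared norm of Phi_m, which depends on the inner coefficients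
  alone.\<close>

lemma integral_fibre_power:
  assumes "\<omega> \<in> space M" "finite (supp (\<mu> \<omega>))" "card (supp (\<mu> \<omega>)) = Suc m"
  shows "(\<integral>x. of_real (szego_weight m (x, inner_coef \<omega>)) * x ^ j \<partial>\<mu> \<omega>) =
    (if j = 0 then of_real (norm_weight m (inner_coef \<omega>))
     else coef \<omega> m * shifted_moment (coef \<omega>) m (j - 1))"
proof -
  let ?\<nu> = "\<mu> \<omega>"
  note good = mu_space[OF assms(1)] assms(2,3)
  have lt: "\<forall>k<m. cmod (inner_coef \<omega> k) < 1"
    using szego_coeff_bounds(1)[OF good] by (auto simp: inner_coef_def)
  have w: "szego_weight m (x, inner_coef \<omega>) = (cmod (szego (szego_coeff ?\<nu>) x m))\<^sup>2" for x
    using lt by (simp add: szego_weight_def szego_inner_coef)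
  show ?thesis
  proof (cases j)
    case 0
    have "(\<Prod>k<m. 1 - (cmod (szego_coeff ?\<nu> k))\<^sup>2) = norm_weight m (inner_coef \<omega>)"
      using lt by (simp add: norm_weight_def inner_coef_def)
    then show ?thesis
      using 0 integral_norm_szego[OF good] by (simp add: w del: of_real_power)
  next
    case (Suc i)
    have "shifted_moment (coef \<omega>) m i = shifted_moment (szego_coeff ?\<nu>) m i"
      by (rule shifted_moment_cong) (simp add: coef_def)
    then show ?thesis
      using Suc integral_power_norm_szego[OF good, of i]
      by (simp add: w coef_def mult.commute del: of_real_power power_Suc)
  qed
qed

text \<open>With the inner coefficients fixed, the integrand is a polynomial in the last coefficient
  without constant term, so already the inner integral over \<open>D m\<close> vanishes.\<close>

lemma integral_shifted_moment:
  assumes S: "S \<in> sets (coords m)"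
  shows "(\<integral>\<omega>. indicator S (inner_coef \<omega>) * (coef \<omega> m * shifted_moment (coef \<omega>) m i) \<partial>M) = 0"
proof -
  define F where "F v = indicator S (restrict v {..<m}) * (v m * shifted_moment v m i)" for v
  have [measurable]: "(\<lambda>v. restrict v {..<m}) \<in> coords (Suc m) \<rightarrow>\<^sub>M coords m"
    by (intro measurable_restrict_subset) auto
  have [measurable]: "(\<lambda>v. v m) \<in> borel_measurable (coords (Suc m))"
    by (intro measurable_component_singleton) simp
  have F[measurable]: "F \<in> borel_measurable (coords (Suc m))"
    unfolding F_def[abs_def] using S measurable_shifted_moment[of m i] by measurable
  have FM: "(\<lambda>\<omega>. F (coef \<omega>)) = (\<lambda>\<omega>. indicator S (inner_coef \<omega>) * (coef \<omega> m * shifted_moment (coef \<omega>) m i))"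
    by (simp add: F_def inner_coef_eq)
  \<comment> \<open>Integrability, on which the iterated integration rests, is not read off from the
    algebraic formula. The expression is a moment of a weighted probability measure on the circle,
    so the bound on the weight applies.\<close>
  have bound: "AE \<omega> in M. cmod (F (coef \<omega>)) \<le> 4 ^ m"
    using card_supp AE_space
  proof eventually_elim
    case (elim \<omega>)
    note nu = prob_algebra_circleD[OF mu_space[OF elim(2)]]
    interpret nu: prob_space "\<mu> \<omega>" by (rule nu)
    have "cmod (coef \<omega> m * shifted_moment (coef \<omega>) m i) =
        cmod (\<integral>x. of_real (szego_weight m (x, inner_coef \<omega>)) * x ^ Suc i \<partial>\<mu> \<omega>)"
      using integral_fibre_power[OF elim(2), of "Suc i"] elim by (simp del: power_Suc)
    also have "\<dots> \<le> (\<integral>x. cmod (of_real (szego_weight m (x, inner_coef \<omega>)) * x ^ Suc i) \<partial>\<mu> \<omega>)"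
      by (rule integral_norm_bound)
    also have "\<dots> \<le> (\<integral>x. 4 ^ m \<partial>\<mu> \<omega>)"
    proof (rule integral_mono')
      show "cmod (of_real (szego_weight m (x, inner_coef \<omega>)) * x ^ Suc i) \<le> 4 ^ m" if "x \<in> space (\<mu> \<omega>)" for x
        using that nu(3) szego_weight_le[of "(x, inner_coef \<omega>)" m] by (simp add: norm_mult norm_power)
    qed auto
    also have "\<dots> = 4 ^ m" by (simp add: nu.prob_space)
    finally show ?case by (auto simp: F_def inner_coef_eq indicator_def)
  qed
  have "integrable M (\<lambda>\<omega>. F (coef \<omega>))"
    by (rule integrable_const_bound[OF bound]) measurable
  then have int: "integrable (PiM {..<Suc m} D) F"
    unfolding law_coef[symmetric] by (subst integrable_distr_eq) simp_all
  have "(\<integral>\<omega>. F (coef \<omega>) \<partial>M) = (\<integral>v. F v \<partial>PiM {..<Suc m} D)"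
    unfolding law_coef[symmetric] by (rule integral_distr[symmetric]) simp_all
  also have "\<dots> = (\<integral>v. (\<integral>y. F (v(m := y)) \<partial>D m) \<partial>PiM {..<m} D)"
    using int unfolding lessThan_Suc by (intro product_integral_insert) auto
  also have "\<dots> = (\<integral>v. 0 \<partial>PiM {..<m} D)"
  proof (intro Bochner_Integration.integral_cong refl)
    fix v assume "v \<in> space (PiM {..<m} D)"
    then have v: "restrict (v(m := y)) {..<m} = v" for y
      by (auto simp: space_PiM PiE_def extensional_def fun_eq_iff)
    obtain p where "\<And>y. shifted_moment (v(m := y)) m i = poly p y"
      using poly_in_coord_shifted_moment[of m i] unfolding poly_in_coord_def by blast
    then have "(\<integral>y. F (v(m := y)) \<partial>D m) = (\<integral>y. indicator S v * (y * poly p y) \<partial>D m)"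
      by (simp add: F_def v)
    also have "\<dots> = 0" by (simp only: integral_mult_right_zero integral_D_m_poly mult_zero_right)
    finally show "(\<integral>y. F (v(m := y)) \<partial>D m) = 0" .
  qed
  finally show ?thesis using FM by simp
qed

text \<open>For fixed \<open>S\<close> both sides are finite measures in \<open>X\<close>, compared by their moments: those of
  positive order are averages of polynomials in the last coefficient without constant term.\<close>

lemma joint_rectangle:
  assumes S: "S \<in> sets (coords m)" and X: "X \<in> sets circle"
  shows "emeasure (density joint (\<lambda>p. ennreal (szego_weight m p))) (X \<times> S) =
    emeasure U X * (\<integral>\<^sup>+v. ennreal (norm_weight m v) * indicator S v \<partial>PiM {..<m} D)"
proof -
  interpret J: prob_space joint by (rule prob_space_joint)
  have [measurable]: "fst \<in> borel_measurable (circle \<Otimes>\<^sub>M coords m)"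
    by (rule measurable_compose[OF measurable_fst measurable_id_circle])
  \<comment> \<open>Including the event on the coefficients in the weight reduces the claim to a
    statement about measures in the point alone.\<close>
  define w where "w p = szego_weight m p * indicator S (snd p)" for p
  have w[measurable]: "w \<in> borel_measurable (circle \<Otimes>\<^sub>M coords m)"
    unfolding w_def[abs_def] using S by measurable
  have w_le: "0 \<le> w p" "w p \<le> 4 ^ m" if "p \<in> space (circle \<Otimes>\<^sub>M coords m)" for p
    using that szego_weight_le[of p m] by (auto simp: w_def space_pair_measure indicator_def)
  have sp: "space joint = space (circle \<Otimes>\<^sub>M coords m)"
    by (rule sets_eq_imp_space_eq) simp
  \<comment> \<open>The marginal of the drawn point under this weight. It turns out to be
    \<open>c\<close> times the uniform law, because all its moments of positive order
    vanish.\<close>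
  define A where "A = distr (density joint (\<lambda>p. ennreal (w p))) circle fst"
  define c where "c = (\<integral>v. norm_weight m v * indicator S v \<partial>PiM {..<m} D)"
  interpret Q: prob_space "PiM {..<m} D" by (rule prob_space_PiM_D)
  have nw_le: "norm_weight m v \<le> 1" for v
    unfolding norm_weight_def by (auto intro!: prod_le_1 simp: abs_square_le_1 less_imp_le)
  have c_meas: "(\<lambda>v. norm_weight m v * indicator S v) \<in> borel_measurable (PiM {..<m} D)"
    unfolding measurable_PiM_D_iff using S by measurable
  have c_int: "integrable (PiM {..<m} D) (\<lambda>v. norm_weight m v * indicator S v)"
    using nw_le by (intro Q.integrable_const_bound[where B=1] c_meas) (auto simp: indicator_def)
  have c: "(\<integral>\<^sup>+v. ennreal (norm_weight m v) * indicator S v \<partial>PiM {..<m} D) = ennreal c" "c \<ge> 0"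
    using c_int unfolding c_def
    by (subst nn_integral_eq_integral[symmetric])
       (auto simp: ennreal_mult ennreal_indicator intro!: Bochner_Integration.integral_nonneg)
  have cM: "c = (\<integral>\<omega>. norm_weight m (inner_coef \<omega>) * indicator S (inner_coef \<omega>) \<partial>M)"
  proof -
    have "ennreal c = (\<integral>\<^sup>+\<omega>. ennreal (norm_weight m (inner_coef \<omega>) * indicator S (inner_coef \<omega>)) \<partial>M)"
      unfolding c(1)[symmetric] using S
      by (subst nn_integral_coef_inner[symmetric]) (auto simp: ennreal_mult ennreal_indicator)
    also have "\<dots> = ennreal (\<integral>\<omega>. norm_weight m (inner_coef \<omega>) * indicator S (inner_coef \<omega>) \<partial>M)"
      using S nw_le
      by (intro nn_integral_eq_integral integrable_const_bound[where B=1] AE_I2)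
         (auto simp: indicator_def)
    finally show ?thesis
      using c(2) by (subst (asm) ennreal_inj) (auto intro!: Bochner_Integration.integral_nonneg)
  qed
  have "A = density U (\<lambda>_. ennreal c)"
  proof (rule measure_circle_eqI)
    have "emeasure A (space A) \<le>
        emeasure (density joint (\<lambda>p. ennreal (w p))) (space (density joint (\<lambda>p. ennreal (w p))))"
      unfolding A_def space_distr by (subst emeasure_distr) (auto simp: sp simp del: space_circle intro!: emeasure_mono)
    also have "\<dots> = (\<integral>\<^sup>+p. ennreal (w p) \<partial>joint)"
      by (subst emeasure_density) (auto simp: sp intro!: nn_integral_cong)
    also have "\<dots> \<le> (\<integral>\<^sup>+p. ennreal (4 ^ m) \<partial>joint)"
      using w_le(2) by (intro nn_integral_mono ennreal_leI) (simp add: sp)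
    also have "\<dots> < \<infinity>" by (simp add: J.emeasure_space_1)
    finally show "finite_measure A" by (intro finite_measureI) auto
    show "finite_measure (density U (\<lambda>_. ennreal c))"
      by (intro finite_measureI) (simp add: emeasure_density_const[OF sets.top] U.emeasure_space_1)
    fix j :: nat
    have "(\<integral>z. z ^ j \<partial>A) = (\<integral>p. fst p ^ j \<partial>density joint (\<lambda>p. ennreal (w p)))"
      unfolding A_def
      by (intro integral_distr) (auto intro!: borel_measurable_circle_continuous continuous_intros)
    also have "\<dots> = (\<integral>p. w p *\<^sub>R fst p ^ j \<partial>joint)"
      using w_le(1) by (intro integral_density AE_I2) (auto simp: sp)
    also have "\<dots> = (\<integral>\<omega>. (\<integral>x. w (x, inner_coef \<omega>) *\<^sub>R fst (x, inner_coef \<omega>) ^ j \<partial>\<mu> \<omega>) \<partial>M)"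
      using w_le by (intro integral_joint[where B="4 ^ m"])
        (auto simp: space_pair_measure norm_power)
    also have "\<dots> = (\<integral>\<omega>. indicator S (inner_coef \<omega>) *
        (if j = 0 then of_real (norm_weight m (inner_coef \<omega>))
         else coef \<omega> m * shifted_moment (coef \<omega>) m (j - 1)) \<partial>M)"
    proof (rule integral_cong_AE)
      have [measurable]: "(\<lambda>v. v m) \<in> borel_measurable (coords (Suc m))"
        by (intro measurable_component_singleton) simp
      show "(\<lambda>\<omega>. indicator S (inner_coef \<omega>) *
        (if j = 0 then of_real (norm_weight m (inner_coef \<omega>))
         else coef \<omega> m * shifted_moment (coef \<omega>) m (j - 1))) \<in> borel_measurable M"
        using S measurable_shifted_moment[of m "j - 1"] by measurable
      have "(\<lambda>q. w (snd q, inner_coef (fst q)) *\<^sub>R snd q ^ j) \<in> borel_measurable (M \<Otimes>\<^sub>M circle)"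
      proof -
        have [measurable]: "snd \<in> borel_measurable (M \<Otimes>\<^sub>M circle)"
          by (rule measurable_compose[OF measurable_snd measurable_id_circle])
        have "(\<lambda>q. (snd q, inner_coef (fst q))) \<in> M \<Otimes>\<^sub>M circle \<rightarrow>\<^sub>M circle \<Otimes>\<^sub>M coords m"
          by (intro measurable_Pair measurable_snd measurable_compose[OF measurable_fst measurable_inner_coef])
        from measurable_compose[OF this w] show ?thesis by measurable
      qed
      from integral_measurable_kernel[OF this measurable_mu]
      show "(\<lambda>\<omega>. \<integral>x. w (x, inner_coef \<omega>) *\<^sub>R fst (x, inner_coef \<omega>) ^ j \<partial>\<mu> \<omega>) \<in> borel_measurable M"
        by simp
      show "AE \<omega> in M. (\<integral>x. w (x, inner_coef \<omega>) *\<^sub>R fst (x, inner_coef \<omega>) ^ j \<partial>\<mu> \<omega>) =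
        indicator S (inner_coef \<omega>) *
        (if j = 0 then of_real (norm_weight m (inner_coef \<omega>))
         else coef \<omega> m * shifted_moment (coef \<omega>) m (j - 1))"
        using card_supp AE_space
      proof eventually_elim
        case (elim \<omega>)
        have "(\<integral>x. w (x, inner_coef \<omega>) *\<^sub>R fst (x, inner_coef \<omega>) ^ j \<partial>\<mu> \<omega>) =
          (\<integral>x. indicator S (inner_coef \<omega>) * (of_real (szego_weight m (x, inner_coef \<omega>)) * x ^ j) \<partial>\<mu> \<omega>)"
          by (simp add: w_def scaleR_conv_of_real indicator_def)
        then show ?case
          using integral_fibre_power[OF elim(2), of j] elim by (simp only: integral_mult_right_zero)
      qed
    qed
    also have "\<dots> = (if j = 0 then of_real c else 0)"
    proof (cases "j = 0")
      case True
      have "(\<integral>\<omega>. indicator S (inner_coef \<omega>) * complex_of_real (norm_weight m (inner_coef \<omega>)) \<partial>M) =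
          (\<integral>\<omega>. complex_of_real (norm_weight m (inner_coef \<omega>) * indicator S (inner_coef \<omega>)) \<partial>M)"
        by (intro Bochner_Integration.integral_cong) (auto simp: indicator_def)
      then show ?thesis using True by (simp only: if_True integral_complex_of_real cM refl)
    next
      case False
      then show ?thesis using integral_shifted_moment[OF S] by simp
    qed
    also have "\<dots> = (\<integral>z. c *\<^sub>R z ^ j \<partial>U)"
      by (simp add: U.integral_power_eq scaleR_conv_of_real)
    also have "\<dots> = (\<integral>z. z ^ j \<partial>density U (\<lambda>_. ennreal c))"
      using c(2) by (intro integral_density[symmetric])
        (auto intro!: borel_measurable_sets_circle[OF U.sets_U] continuous_intros)
    finally show "(\<integral>z. z ^ j \<partial>A) = (\<integral>z. z ^ j \<partial>density U (\<lambda>_. ennreal c))" .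
  qed (simp_all add: A_def)
  then have "emeasure A X = ennreal c * emeasure U X"
    using X by (simp add: emeasure_density nn_integral_cmult_indicator)
  moreover have "emeasure A X = emeasure (density joint (\<lambda>p. ennreal (szego_weight m p))) (X \<times> S)"
  proof -
    have fX: "fst -` X \<inter> space joint \<in> sets joint" and XS: "X \<times> S \<in> sets joint"
      using X S measurable_sets[OF measurable_fst X, of "coords m"] by (auto simp: sp)
    have "emeasure A X = emeasure (density joint (\<lambda>p. ennreal (w p))) (fst -` X \<inter> space joint)"
      unfolding A_def using X by (subst emeasure_distr) auto
    also have "\<dots> = (\<integral>\<^sup>+p. ennreal (w p) * indicator (fst -` X \<inter> space joint) p \<partial>joint)"
      by (rule emeasure_density[OF _ fX]) measurable
    also have "\<dots> = (\<integral>\<^sup>+p. ennreal (szego_weight m p) * indicator (X \<times> S) p \<partial>joint)"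
    proof (rule nn_integral_cong)
      fix p assume "p \<in> space joint"
      then show "ennreal (w p) * indicator (fst -` X \<inter> space joint) p =
          ennreal (szego_weight m p) * indicator (X \<times> S) p"
        by (cases p) (auto simp: w_def indicator_def)
    qed
    also have "\<dots> = emeasure (density joint (\<lambda>p. ennreal (szego_weight m p))) (X \<times> S)"
      by (rule emeasure_density[OF _ XS, symmetric]) measurable
    finally show ?thesis .
  qed
  ultimately show ?thesis unfolding c(1) by (simp only: mult.commute)
qed

end

section \<open>The Palm measure\<close>

lemma palm_kernel:
  "(\<lambda>\<nu>. \<nu> \<bind> (\<lambda>x. return (prob_algebra circle) (rotate_to_one \<nu> x))) \<in>
    prob_algebra circle \<rightarrow>\<^sub>M prob_algebra (prob_algebra circle)"
  and palm_inner_kernel: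
  "(\<lambda>(\<nu>, x). return (prob_algebra circle) (rotate_to_one \<nu> x)) \<in>
    prob_algebra circle \<Otimes>\<^sub>M circle \<rightarrow>\<^sub>M prob_algebra (prob_algebra circle)"
proof -
  show *: "(\<lambda>(\<nu>, x). return (prob_algebra circle) (rotate_to_one \<nu> x)) \<in>
      prob_algebra circle \<Otimes>\<^sub>M circle \<rightarrow>\<^sub>M prob_algebra (prob_algebra circle)"
    using measurable_compose[OF rotate_measurable measurable_return_prob_space]
    by (simp add: split_beta')
  show "(\<lambda>\<nu>. \<nu> \<bind> (\<lambda>x. return (prob_algebra circle) (rotate_to_one \<nu> x))) \<in>
      prob_algebra circle \<rightarrow>\<^sub>M prob_algebra (prob_algebra circle)"
    by (rule measurable_bind_prob_space2[OF _ *]) simp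
qed

lemma
  assumes "L \<in> space (prob_algebra (prob_algebra circle))"
  shows sets_palm_law: "sets (palm_law L) = sets (prob_algebra circle)"
    and prob_space_palm_law: "prob_space (palm_law L)"
  unfolding palm_law_def by (rule sets_bind'[OF assms palm_kernel], rule prob_space_bind'[OF assms palm_kernel])

lemma nn_integral_palm_law:
  assumes L: "L \<in> space (prob_algebra (prob_algebra circle))"
    and G: "G \<in> borel_measurable (prob_algebra circle)"
  shows "(\<integral>\<^sup>+\<nu>. G \<nu> \<partial>palm_law L) = (\<integral>\<^sup>+\<nu>. (\<integral>\<^sup>+x. G (rotate_to_one \<nu> x) \<partial>\<nu>) \<partial>L)"
proof -
  have sL: "sets L = sets (prob_algebra circle)" "space L = space (prob_algebra circle)"
    using L sets_eq_imp_space_eq[of L "prob_algebra circle"] by (auto simp: space_prob_algebra)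
  have "(\<lambda>\<nu>. \<nu> \<bind> (\<lambda>x. return (prob_algebra circle) (rotate_to_one \<nu> x))) \<in>
      L \<rightarrow>\<^sub>M subprob_algebra (prob_algebra circle)"
    using measurable_prob_algebraD[OF palm_kernel] measurable_cong_sets[OF sL(1) refl] by blast
  then have "(\<integral>\<^sup>+\<nu>. G \<nu> \<partial>palm_law L) =
      (\<integral>\<^sup>+\<nu>. (\<integral>\<^sup>+\<nu>'. G \<nu>' \<partial>(\<nu> \<bind> (\<lambda>x. return (prob_algebra circle) (rotate_to_one \<nu> x)))) \<partial>L)"
    unfolding palm_law_def by (rule nn_integral_bind[OF G])
  also have "\<dots> = (\<integral>\<^sup>+\<nu>. (\<integral>\<^sup>+x. G (rotate_to_one \<nu> x) \<partial>\<nu>) \<partial>L)"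
  proof (rule nn_integral_cong)
    fix \<nu> assume "\<nu> \<in> space L"
    then have \<nu>: "\<nu> \<in> space (prob_algebra circle)" by (simp add: sL)
    note nu = prob_algebra_circleD[OF \<nu>]
    have "(\<lambda>x. return (prob_algebra circle) (rotate_to_one \<nu> x)) \<in> circle \<rightarrow>\<^sub>M prob_algebra (prob_algebra circle)"
      using measurable_compose[OF measurable_Pair1'[OF \<nu>] palm_inner_kernel] by simp
    then have k: "(\<lambda>x. return (prob_algebra circle) (rotate_to_one \<nu> x)) \<in> \<nu> \<rightarrow>\<^sub>M subprob_algebra (prob_algebra circle)"
      using measurable_prob_algebraD measurable_cong_sets[OF nu(2) refl] by blast
    have "(\<integral>\<^sup>+\<nu>'. G \<nu>' \<partial>(\<nu> \<bind> (\<lambda>x. return (prob_algebra circle) (rotate_to_one \<nu> x)))) =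
        (\<integral>\<^sup>+x. (\<integral>\<^sup>+\<nu>'. G \<nu>' \<partial>return (prob_algebra circle) (rotate_to_one \<nu> x)) \<partial>\<nu>)"
      by (rule nn_integral_bind[OF G k])
    also have "\<dots> = (\<integral>\<^sup>+x. G (rotate_to_one \<nu> x) \<partial>\<nu>)"
      using rotate_to_one_in_prob_algebra[OF \<nu>] G nu(3)
      by (intro nn_integral_cong nn_integral_return) auto
    finally show "(\<integral>\<^sup>+\<nu>'. G \<nu>' \<partial>(\<nu> \<bind> (\<lambda>x. return (prob_algebra circle) (rotate_to_one \<nu> x)))) =
        (\<integral>\<^sup>+x. G (rotate_to_one \<nu> x) \<partial>\<nu>)" .
  qed
  finally show ?thesis .
qed

context random_verblunsky
begin

text \<open>Under the weight |Phi_m(x)|^2 the point and the inner coefficients decouple: masses of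
  rectangles factorise, and finite measures that agree on rectangles are equal.\<close>

lemma joint_density:
  "density joint (\<lambda>p. ennreal (szego_weight m p)) =
    density (U \<Otimes>\<^sub>M PiM {..<m} D) (\<lambda>p. ennreal (norm_weight m (snd p)))"
proof -
  interpret Q: prob_space "PiM {..<m} D" by (rule prob_space_PiM_D)
  let ?E = "{X \<times> S | X S. X \<in> sets circle \<and> S \<in> sets (coords m)}"
  let ?\<Omega> = "space circle \<times> space (coords m)"
  have sp: "sets (circle \<Otimes>\<^sub>M coords m) = sigma_sets ?\<Omega> ?E"
    by (rule sets_pair_measure)
  have sets_UQ: "sets (U \<Otimes>\<^sub>M PiM {..<m} D) = sets (circle \<Otimes>\<^sub>M coords m)"
    by (intro sets_pair_measure_cong U.sets_U sets_PiM_D)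
  have nw: "(\<lambda>p. ennreal (norm_weight m (snd p))) \<in> borel_measurable (U \<Otimes>\<^sub>M PiM {..<m} D)"
    unfolding measurable_cong_sets[OF sets_UQ refl] by measurable
  have right: "emeasure (density (U \<Otimes>\<^sub>M PiM {..<m} D) (\<lambda>p. ennreal (norm_weight m (snd p)))) (X \<times> S) =
      emeasure U X * (\<integral>\<^sup>+v. ennreal (norm_weight m v) * indicator S v \<partial>PiM {..<m} D)"
    if X: "X \<in> sets circle" and S: "S \<in> sets (coords m)" for X S
  proof -
    have XS: "X \<times> S \<in> sets (U \<Otimes>\<^sub>M PiM {..<m} D)"
      unfolding sets_UQ using X S by (rule pair_measureI)
    have "emeasure (density (U \<Otimes>\<^sub>M PiM {..<m} D) (\<lambda>p. ennreal (norm_weight m (snd p)))) (X \<times> S) =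
        (\<integral>\<^sup>+p. ennreal (norm_weight m (snd p)) * indicator (X \<times> S) p \<partial>(U \<Otimes>\<^sub>M PiM {..<m} D))"
      by (rule emeasure_density[OF nw XS])
    also have "\<dots> = (\<integral>\<^sup>+x. (\<integral>\<^sup>+v. ennreal (norm_weight m (snd (x, v))) * indicator (X \<times> S) (x, v) \<partial>PiM {..<m} D) \<partial>U)"
      by (rule Q.nn_integral_fst[symmetric]) (intro borel_measurable_times_ennreal nw borel_measurable_indicator XS)
    also have "\<dots> = (\<integral>\<^sup>+x. (\<integral>\<^sup>+v. indicator X x * (ennreal (norm_weight m v) * indicator S v) \<partial>PiM {..<m} D) \<partial>U)"
      by (intro nn_integral_cong) (auto simp: indicator_def)
    also have "\<dots> = (\<integral>\<^sup>+x. indicator X x * (\<integral>\<^sup>+v. ennreal (norm_weight m v) * indicator S v \<partial>PiM {..<m} D) \<partial>U)"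
    proof (intro nn_integral_cong nn_integral_cmult)
      show "(\<lambda>v. ennreal (norm_weight m v) * indicator S v) \<in> borel_measurable (PiM {..<m} D)"
        unfolding measurable_PiM_D_iff using S by measurable
    qed
    also have "\<dots> = emeasure U X * (\<integral>\<^sup>+v. ennreal (norm_weight m v) * indicator S v \<partial>PiM {..<m} D)"
      using X by (subst nn_integral_multc) simp_all
    finally show ?thesis .
  qed
  show ?thesis
  proof (rule measure_eqI_generator_eq[where E="?E" and \<Omega>="?\<Omega>" and A="\<lambda>_. ?\<Omega>"])
    show "Int_stable ?E" by (rule Int_stable_pair_measure_generator)
    show "?E \<subseteq> Pow ?\<Omega>" by (rule pair_measure_closed)
    show "emeasure (density joint (\<lambda>p. ennreal (szego_weight m p))) Y =
        emeasure (density (U \<Otimes>\<^sub>M PiM {..<m} D) (\<lambda>p. ennreal (norm_weight m (snd p)))) Y" if "Y \<in> ?E" for Y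
    proof -
      obtain X S where Y: "Y = X \<times> S" and XS: "X \<in> sets circle" "S \<in> sets (coords m)"
        using \<open>Y \<in> ?E\<close> by blast
      show ?thesis unfolding Y right[OF XS] by (rule joint_rectangle[OF XS(2,1)])
    qed
    show "sets (density joint (\<lambda>p. ennreal (szego_weight m p))) = sigma_sets ?\<Omega> ?E"
      by (simp add: sp)
    show "sets (density (U \<Otimes>\<^sub>M PiM {..<m} D) (\<lambda>p. ennreal (norm_weight m (snd p)))) = sigma_sets ?\<Omega> ?E"
      by (simp only: sets_density sets_UQ sp)
    have "?\<Omega> \<in> ?E" by (intro CollectI exI[of _ "space circle"] exI[of _ "space (coords m)"] conjI refl sets.top)
    then show "range (\<lambda>_. ?\<Omega>) \<subseteq> ?E" by (simp only: image_subset_iff) simp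
    show "(\<Union>i. ?\<Omega>) = ?\<Omega>" by simp
    fix i :: nat
    have "(\<integral>\<^sup>+v. ennreal (norm_weight m v) * indicator (space (coords m)) v \<partial>PiM {..<m} D) \<le>
        (\<integral>\<^sup>+v. 1 \<partial>PiM {..<m} D)"
    proof (rule nn_integral_mono)
      fix v
      have "norm_weight m v \<le> 1"
        unfolding norm_weight_def by (auto intro!: prod_le_1 simp: abs_square_le_1 less_imp_le)
      then show "ennreal (norm_weight m v) * indicator (space (coords m)) v \<le> 1"
        by (simp add: indicator_def)
    qed
    also have "\<dots> = 1" by (simp add: Q.emeasure_space_1)
    finally have "(\<integral>\<^sup>+v. ennreal (norm_weight m v) * indicator (space (coords m)) v \<partial>PiM {..<m} D) \<noteq> \<infinity>"
      by (auto simp: top_unique)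
    then show "emeasure (density joint (\<lambda>p. ennreal (szego_weight m p))) ?\<Omega> \<noteq> \<infinity>"
      using joint_rectangle[OF sets.top sets.top] U.emeasure_finite[of "space circle"]
      by (simp add: ennreal_mult_eq_top_iff)
  qed
qed

text \<open>|Phi_m(x)|^2 is the product of the |1 - g_k|^2 over the relative coefficients g_k, and
  |g_k| = |v_k|, so numerator and denominator split along the same index.\<close>

lemma weight_quotient:
  assumes "cmod x = 1" "\<And>k. k < m \<Longrightarrow> cmod (v k) < 1"
  shows "szego_weight m (x, v) > 0"
    and "norm_weight m v / szego_weight m (x, v) = (\<Prod>k<m. poisson_weight (relative_coeff v x k))"
proof -
  have w: "szego_weight m (x, v) = (cmod (szego v x m))\<^sup>2"
    using assms by (simp add: szego_weight_def)
  then show "szego_weight m (x, v) > 0"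
    using szego_nonzero[OF assms] by simp
  show "norm_weight m v / szego_weight m (x, v) = (\<Prod>k<m. poisson_weight (relative_coeff v x k))"
  proof -
    have "(cmod (szego v x m))\<^sup>2 = (\<Prod>k<m. (cmod (1 - relative_coeff v x k))\<^sup>2)"
      using norm_szego[of x m v] assms by (simp add: prod_power_distrib)
    moreover have "norm_weight m v = (\<Prod>k<m. 1 - (cmod (relative_coeff v x k))\<^sup>2)"
      using assms by (simp add: norm_weight_def norm_relative_coeff)
    ultimately show ?thesis
      unfolding w poisson_weight_def by (simp add: prod_dividef)
  qed
qed

text \<open>Divides \<open>joint_density\<close> by the weight, which is positive almost surely
  since Phi_m has no zero on the circle once the inner coefficients lie in the disc.\<close>

lemma disintegration:
  assumes H[measurable]: "H \<in> borel_measurable (circle \<Otimes>\<^sub>M coords m)"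
  shows "(\<integral>\<^sup>+\<omega>. (\<integral>\<^sup>+x. H (x, inner_coef \<omega>) \<partial>\<mu> \<omega>) \<partial>M) =
    (\<integral>\<^sup>+x. (\<integral>\<^sup>+v. (\<Prod>k<m. ennreal (poisson_weight (relative_coeff v x k))) * H (x, v) \<partial>PiM {..<m} D) \<partial>U)"
proof -
  interpret Q: prob_space "PiM {..<m} D" by (rule prob_space_PiM_D)
  have sets_UQ: "sets (U \<Otimes>\<^sub>M PiM {..<m} D) = sets (circle \<Otimes>\<^sub>M coords m)"
    by (intro sets_pair_measure_cong U.sets_U sets_PiM_D)
  let ?W = "\<lambda>p. ennreal (szego_weight m p)" and ?R = "\<lambda>p. ennreal (1 / szego_weight m p) * H p"
  have [measurable]: "?R \<in> borel_measurable (circle \<Otimes>\<^sub>M coords m)" by measurable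
  have "(\<integral>\<^sup>+\<omega>. (\<integral>\<^sup>+x. H (x, inner_coef \<omega>) \<partial>\<mu> \<omega>) \<partial>M) =
      (\<integral>\<^sup>+\<omega>. (\<integral>\<^sup>+x. ?W (x, inner_coef \<omega>) * ?R (x, inner_coef \<omega>) \<partial>\<mu> \<omega>) \<partial>M)"
  proof (rule nn_integral_cong_AE)
    show "AE \<omega> in M. (\<integral>\<^sup>+x. H (x, inner_coef \<omega>) \<partial>\<mu> \<omega>) =
        (\<integral>\<^sup>+x. ?W (x, inner_coef \<omega>) * ?R (x, inner_coef \<omega>) \<partial>\<mu> \<omega>)"
      using AE_bounds AE_space
    proof eventually_elim
      case (elim \<omega>)
      show ?case
      proof (rule nn_integral_cong)
        fix x assume "x \<in> space (\<mu> \<omega>)"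
        then have "cmod x = 1" using prob_algebra_circleD(3)[OF mu_space[OF elim(2)]] by simp
        then have "szego_weight m (x, inner_coef \<omega>) > 0"
          using elim(1) by (intro weight_quotient) (auto simp: inner_coef_def)
        then have "?W (x, inner_coef \<omega>) * ennreal (1 / szego_weight m (x, inner_coef \<omega>)) = 1"
          by (subst ennreal_mult[symmetric]) simp_all
        then show "H (x, inner_coef \<omega>) = ?W (x, inner_coef \<omega>) * ?R (x, inner_coef \<omega>)"
          by (simp add: mult.assoc[symmetric])
      qed
    qed
  qed
  also have "\<dots> = (\<integral>\<^sup>+p. ?W p * ?R p \<partial>joint)"
    by (rule nn_integral_joint[symmetric]) measurable
  also have "\<dots> = (\<integral>\<^sup>+p. ?R p \<partial>density joint ?W)"
    by (rule nn_integral_density[symmetric]) measurable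
  also have "\<dots> = (\<integral>\<^sup>+p. ennreal (norm_weight m (snd p)) * ?R p \<partial>(U \<Otimes>\<^sub>M PiM {..<m} D))"
    unfolding joint_density
    by (rule nn_integral_density; unfold measurable_cong_sets[OF sets_UQ refl]) measurable
  also have "\<dots> = (\<integral>\<^sup>+x. (\<integral>\<^sup>+v. ennreal (norm_weight m (snd (x, v))) * ?R (x, v) \<partial>PiM {..<m} D) \<partial>U)"
    by (rule Q.nn_integral_fst[symmetric], unfold measurable_cong_sets[OF sets_UQ refl]) measurable
  also have "\<dots> = (\<integral>\<^sup>+x. (\<integral>\<^sup>+v. (\<Prod>k<m. ennreal (poisson_weight (relative_coeff v x k))) * H (x, v) \<partial>PiM {..<m} D) \<partial>U)"
  proof (rule nn_integral_cong, rule nn_integral_cong_AE)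
    fix x assume "x \<in> space U"
    then have x: "cmod x = 1" by (simp add: U.space_U)
    have "AE v in PiM {..<m} D. \<forall>k\<in>{..<m}. cmod (v k) < 1"
      by (intro AE_finite_allI AE_PiM_component prob_D AE_D_disc) auto
    then show "AE v in PiM {..<m} D. ennreal (norm_weight m (snd (x, v))) * ?R (x, v) =
        (\<Prod>k<m. ennreal (poisson_weight (relative_coeff v x k))) * H (x, v)"
    proof eventually_elim
      case (elim v)
      then have v: "\<And>k. k < m \<Longrightarrow> cmod (v k) < 1" by simp
      have pos: "poisson_weight (relative_coeff v x k) \<ge> 0" if "k < m" for k
        using v[OF that] x
        by (simp add: poisson_weight_def norm_relative_coeff abs_square_le_1 less_imp_le)
      have "ennreal (norm_weight m v) * ennreal (1 / szego_weight m (x, v)) =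
          ennreal (norm_weight m v / szego_weight m (x, v))"
        by (subst ennreal_mult[symmetric]) simp_all
      also have "\<dots> = ennreal (\<Prod>k<m. poisson_weight (relative_coeff v x k))"
        using weight_quotient(2)[of x v] x v by simp
      also have "\<dots> = (\<Prod>k<m. ennreal (poisson_weight (relative_coeff v x k)))"
        using pos by (subst prod_ennreal) auto
      finally show ?case by (simp add: mult.assoc[symmetric])
    qed
  qed
  finally show ?thesis .
qed

definition law :: "complex measure measure" where
  "law = distr M (prob_algebra circle) \<mu>"

lemma law_in_space: "law \<in> space (prob_algebra (prob_algebra circle))"
  unfolding law_def space_prob_algebra using prob_space_distr[OF measurable_mu] by simp

text \<open>Restores the last coefficient, which is 1 when the measure is rotated so that an atom
  sits at 1.\<close>

definition extend_one :: "(nat \<Rightarrow> complex) \<Rightarrow> nat \<Rightarrow> complex" where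
  "extend_one w = (\<lambda>k\<in>{..<Suc m}. if k < m then w k else 1)"

lemma measurable_extend_one [measurable]: "extend_one \<in> coords m \<rightarrow>\<^sub>M coords (Suc m)"
  unfolding extend_one_def[abs_def]
proof (rule measurable_restrict)
  fix k assume "k \<in> {..<Suc m}"
  show "(\<lambda>w. if k < m then w k else 1) \<in> borel_measurable (coords m)"
    by (cases "k < m") (auto intro!: measurable_component_singleton)
qed

text \<open>The Palm integral is rewritten as one over the inner coefficients and a uniform point.
  Substituting relative coefficients for coefficients removes the point, and the Poisson weights are
  then absorbed by \<open>palm_flip\<close>.\<close>

lemma distr_palm_law:
  "distr (palm_law law) (coords (Suc m)) (\<lambda>\<nu>. \<lambda>i\<in>{..<Suc m}. modified_verblunsky \<nu> i) =
    distr M (coords (Suc m)) (\<lambda>\<omega>. \<lambda>i\<in>{..<Suc m}. if i < m then palm_flip (modified_verblunsky (\<mu> \<omega>) i) else 1)"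
proof (rule measure_eqI)
  let ?V = "\<lambda>\<nu>. \<lambda>i\<in>{..<Suc m}. modified_verblunsky \<nu> i"
  let ?V' = "\<lambda>\<omega>. \<lambda>i\<in>{..<Suc m}. if i < m then palm_flip (modified_verblunsky (\<mu> \<omega>) i) else 1"
  let ?\<Gamma> = "\<lambda>x v. \<lambda>k\<in>{..<m}. relative_coeff v x k"
  fix B assume "B \<in> sets (distr (palm_law law) (coords (Suc m)) ?V)"
  then have B[measurable]: "B \<in> sets (coords (Suc m))" by simp
  define f where "f w = (indicator B (extend_one w) :: ennreal)" for w
  have f[measurable]: "f \<in> borel_measurable (coords m)" unfolding f_def[abs_def] by measurable
  have V: "?V \<in> prob_algebra circle \<rightarrow>\<^sub>M coords (Suc m)" by measurable
  then have Vp: "?V \<in> palm_law law \<rightarrow>\<^sub>M coords (Suc m)"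
    using measurable_cong_sets[OF sets_palm_law[OF law_in_space] refl] by blast
  have V': "?V' \<in> M \<rightarrow>\<^sub>M coords (Suc m)"
  proof (rule measurable_restrict)
    fix i assume "i \<in> {..<Suc m}"
    show "(\<lambda>\<omega>. if i < m then palm_flip (modified_verblunsky (\<mu> \<omega>) i) else 1) \<in> borel_measurable M"
      by (cases "i < m") simp_all
  qed
  have \<Gamma>: "(\<lambda>p. ?\<Gamma> (fst p) (snd p)) \<in> circle \<Otimes>\<^sub>M coords m \<rightarrow>\<^sub>M coords m"
    by (intro measurable_restrict measurable_relative_coeff_joint) simp
  have VB: "(\<lambda>\<nu>. indicator B (?V \<nu>) :: ennreal) \<in> borel_measurable (prob_algebra circle)"
    using V B by measurable
  have "emeasure (distr (palm_law law) (coords (Suc m)) ?V) B = (\<integral>\<^sup>+\<nu>. indicator B (?V \<nu>) \<partial>palm_law law)"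
    using Vp B by (simp add: nn_integral_indicator[symmetric] nn_integral_distr del: nn_integral_indicator)
  also have "\<dots> = (\<integral>\<^sup>+\<nu>. (\<integral>\<^sup>+x. indicator B (?V (rotate_to_one \<nu> x)) \<partial>\<nu>) \<partial>law)"
    by (rule nn_integral_palm_law[OF law_in_space VB])
  also have "\<dots> = (\<integral>\<^sup>+\<omega>. (\<integral>\<^sup>+x. indicator B (?V (rotate_to_one (\<mu> \<omega>) x)) \<partial>\<mu> \<omega>) \<partial>M)"
  proof -
    have "(\<lambda>\<nu>. \<integral>\<^sup>+x. indicator B (?V (rotate_to_one \<nu> x)) \<partial>\<nu>) \<in> borel_measurable (prob_algebra circle)"
    proof (rule nn_integral_measurable_subprob_algebra2[where N=circle])
      show "(\<lambda>(\<nu>, x). indicator B (?V (rotate_to_one \<nu> x)) :: ennreal) \<in> borel_measurable (prob_algebra circle \<Otimes>\<^sub>M circle)"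
        using measurable_compose[OF rotate_measurable VB] by (simp add: split_beta')
      show "(\<lambda>\<nu>. \<nu>) \<in> prob_algebra circle \<rightarrow>\<^sub>M subprob_algebra circle"
        by (rule measurable_prob_algebraD) simp
    qed
    then show ?thesis unfolding law_def by (intro nn_integral_distr) simp_all
  qed
  \<comment> \<open>The drawn point almost surely lies in the support. There the rotated measure has
    the relative coefficients as its modified ones, with last value 1, and they depend on the inner
    coefficients alone.\<close>
  also have "\<dots> = (\<integral>\<^sup>+\<omega>. (\<integral>\<^sup>+x. f (?\<Gamma> x (inner_coef \<omega>)) \<partial>\<mu> \<omega>) \<partial>M)"
  proof (rule nn_integral_cong_AE)
    show "AE \<omega> in M. (\<integral>\<^sup>+x. indicator B (?V (rotate_to_one (\<mu> \<omega>) x)) \<partial>\<mu> \<omega>) =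
        (\<integral>\<^sup>+x. f (?\<Gamma> x (inner_coef \<omega>)) \<partial>\<mu> \<omega>)"
      using card_supp AE_space
    proof eventually_elim
      case (elim \<omega>)
      note good = mu_space[OF elim(2)] elim(1)[THEN conjunct1] elim(1)[THEN conjunct2]
      have "?V (rotate_to_one (\<mu> \<omega>) x) = extend_one (?\<Gamma> x (inner_coef \<omega>))" if x: "x \<in> supp (\<mu> \<omega>)" for x
      proof
        fix k
        have xc: "cmod x = 1" using x supp_subset_sphere[of "\<mu> \<omega>"] by auto
        have "relative_coeff (inner_coef \<omega>) x k = relative_coeff (szego_coeff (\<mu> \<omega>)) x k" if "k < m"
          using that by (intro relative_coeff_cong) (simp add: inner_coef_def)
        then show "?V (rotate_to_one (\<mu> \<omega>) x) k = extend_one (?\<Gamma> x (inner_coef \<omega>)) k"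
          using modified_verblunsky_rotate[OF good _ xc, of k] relative_coeff_supp[OF good x]
          by (auto simp: extend_one_def less_Suc_eq)
      qed
      then show ?case
        unfolding f_def by (intro nn_integral_cong_AE eventually_mono[OF compl_supp[OF sets_mu[OF elim(2)]]]) simp
    qed
  qed
  also have "\<dots> = (\<integral>\<^sup>+x. (\<integral>\<^sup>+v. (\<Prod>k<m. ennreal (poisson_weight (relative_coeff v x k))) * f (?\<Gamma> x v) \<partial>PiM {..<m} D) \<partial>U)"
    using disintegration[of "\<lambda>p. f (?\<Gamma> (fst p) (snd p))"] measurable_compose[OF \<Gamma> f] by simp
  \<comment> \<open>For fixed x the relative coefficients are the coefficients times unimodular
    functions of the earlier ones, so \<open>nn_integral_skew\<close> replaces them by independent
    variables and x disappears.\<close>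
  also have "\<dots> = (\<integral>\<^sup>+x. (\<integral>\<^sup>+v. (\<Prod>k<m. ennreal (poisson_weight (v k))) * f v \<partial>PiM {..<m} D) \<partial>U)"
  proof (rule nn_integral_cong)
    fix x assume "x \<in> space U"
    then have x: "cmod x = 1" by (simp add: U.space_U)
    let ?u = "\<lambda>k v. x ^ k * unimodular (szego v x k) / x"
    have [measurable]: "(\<lambda>v. v k) \<in> borel_measurable (coords m)" if "k \<in> {..<m}" for k
      using that by (intro measurable_component_singleton)
    have "(\<integral>\<^sup>+v. (\<lambda>v. (\<Prod>k<m. ennreal (poisson_weight (v k))) * f v) (\<lambda>k\<in>{..<m}. v k * ?u k v) \<partial>PiM {..<m} D) =
        (\<integral>\<^sup>+v. (\<Prod>k<m. ennreal (poisson_weight (v k))) * f v \<partial>PiM {..<m} D)"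
    proof (rule nn_integral_skew)
      fix k
      show "?u k \<in> borel_measurable (coords k)"
      proof -
        note [measurable] = measurable_szego_fixed[OF x order_refl, of k]
        show ?thesis by measurable
      qed
      show "cmod (?u k v) = 1" for v using x by (simp add: norm_mult norm_divide norm_power)
      show "?u k v = ?u k w" if "\<And>j. j < k \<Longrightarrow> v j = w j" for v w
        using szego_cong[of k v w x] that by simp
    next
      show "(\<lambda>v. (\<Prod>k<m. ennreal (poisson_weight (v k))) * f v) \<in> borel_measurable (coords m)"
        by (intro borel_measurable_times_ennreal f borel_measurable_prod_ennreal) measurable
    qed
    moreover have "(\<lambda>k\<in>{..<m}. v k * ?u k v) = ?\<Gamma> x v" for v
      by (simp add: relative_coeff_def)
    moreover have "(\<Prod>k<m. ennreal (poisson_weight (?\<Gamma> x v k))) = (\<Prod>k<m. ennreal (poisson_weight (relative_coeff v x k)))" for v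
      by (intro prod.cong) auto
    ultimately show "(\<integral>\<^sup>+v. (\<Prod>k<m. ennreal (poisson_weight (relative_coeff v x k))) * f (?\<Gamma> x v) \<partial>PiM {..<m} D) =
        (\<integral>\<^sup>+v. (\<Prod>k<m. ennreal (poisson_weight (v k))) * f v \<partial>PiM {..<m} D)"
      by (simp only:)
  qed
  also have "\<dots> = (\<integral>\<^sup>+v. (\<Prod>k<m. ennreal (poisson_weight (v k))) * f v \<partial>PiM {..<m} D)"
    by (simp add: U.emeasure_space_1)
  also have "\<dots> = (\<integral>\<^sup>+v. f (\<lambda>k\<in>{..<m}. palm_flip (v k)) \<partial>PiM {..<m} D)"
    by (rule nn_integral_palm_flip_prod[OF U.circle_uniform_axioms AE_D_disc f])
  \<comment> \<open>The integrand ignores the last modified coefficient, which is integrated out to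
    reach the product of the first \<open>m\<close> laws.\<close>
  also have "\<dots> = emeasure (distr M (coords (Suc m)) ?V') B"
  proof -
    let ?G = "\<lambda>\<omega>. \<lambda>k\<in>{..<Suc m}. modified_verblunsky (\<mu> \<omega>) k"
    let ?h = "\<lambda>v. f (\<lambda>k\<in>{..<m}. palm_flip (v k))"
    have h: "?h \<in> borel_measurable (coords (Suc m))"
    proof -
      have "(\<lambda>v. \<lambda>k\<in>{..<m}. palm_flip (v k)) \<in> coords (Suc m) \<rightarrow>\<^sub>M coords m"
        by (intro measurable_restrict measurable_compose[OF _ measurable_palm_flip] measurable_component_singleton) auto
      from measurable_compose[OF this f] show ?thesis .
    qed
    have G: "?G \<in> M \<rightarrow>\<^sub>M coords (Suc m)" by measurable
    have "emeasure (distr M (coords (Suc m)) ?V') B = (\<integral>\<^sup>+\<omega>. indicator B (?V' \<omega>) \<partial>M)"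
      using V' B by (simp add: nn_integral_indicator[symmetric] nn_integral_distr del: nn_integral_indicator)
    also have "\<dots> = (\<integral>\<^sup>+\<omega>. ?h (?G \<omega>) \<partial>M)"
      unfolding f_def
      by (intro nn_integral_cong arg_cong[of _ _ "indicator B"]) (auto simp: extend_one_def fun_eq_iff)
    also have "\<dots> = (\<integral>\<^sup>+v. ?h v \<partial>PiM {..<Suc m} D)"
      unfolding law_gamma[symmetric]
      by (rule nn_integral_distr[OF G, symmetric], subst measurable_distr_eq1, rule h)
    also have "\<dots> = (\<integral>\<^sup>+v. (\<integral>\<^sup>+y. ?h (v(m := y)) \<partial>D m) \<partial>PiM {..<m} D)"
      by (rule nn_integral_Suc[OF h])
    also have "\<dots> = (\<integral>\<^sup>+v. (\<integral>\<^sup>+y. ?h v \<partial>D m) \<partial>PiM {..<m} D)"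
      by (intro nn_integral_cong arg_cong[of _ _ f]) (auto simp: fun_eq_iff restrict_def)
    also have "\<dots> = (\<integral>\<^sup>+v. ?h v \<partial>PiM {..<m} D)"
      by (simp add: prob_space.emeasure_space_1[OF prob_D])
    finally show ?thesis by simp
  qed
  finally show "emeasure (distr (palm_law law) (coords (Suc m)) ?V) B = emeasure (distr M (coords (Suc m)) ?V') B" .
qed simp

end

section \<open>Rotation invariance of the law\<close>

lemma rotate_rotate:
  assumes "\<nu> \<in> space (prob_algebra circle)" "cmod x = 1" "cmod y = 1"
  shows "rotate_to_one (rotate_to_one \<nu> x) y = rotate_to_one \<nu> (x * y)"
proof -
  have "(\<lambda>z. z / x) \<in> \<nu> \<rightarrow>\<^sub>M circle"
    using measurable_divide_circle[OF assms(2)] measurable_cong_sets[OF prob_algebra_circleD(2)[OF assms(1)] refl]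
    by blast
  then show ?thesis
    unfolding rotate_to_one_def
    by (subst distr_distr[OF measurable_divide_circle[OF assms(3)]]) (simp_all add: comp_def)
qed

lemma rotate_1: "\<nu> \<in> space (prob_algebra circle) \<Longrightarrow> rotate_to_one \<nu> 1 = \<nu>"
  unfolding rotate_to_one_def using distr_id2[OF prob_algebra_circleD(2)[symmetric], of \<nu>] by simp

lemma nn_integral_rotate_to_one:
  assumes "\<nu> \<in> space (prob_algebra circle)" "cmod x = 1" "f \<in> borel_measurable circle"
  shows "(\<integral>\<^sup>+z. f z \<partial>rotate_to_one \<nu> x) = (\<integral>\<^sup>+z. f (z / x) \<partial>\<nu>)"
proof -
  have "(\<lambda>z. z / x) \<in> \<nu> \<rightarrow>\<^sub>M circle"
    using measurable_divide_circle[OF assms(2)] measurable_cong_sets[OF prob_algebra_circleD(2)[OF assms(1)] refl]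
    by blast
  then show ?thesis unfolding rotate_to_one_def by (rule nn_integral_distr) (use assms(3) in simp)
qed

section \<open>Recovering a law on measures from the law of the coefficients\<close>

definition good_measures :: "nat \<Rightarrow> complex measure set" where
  "good_measures m = {\<nu> \<in> space (prob_algebra circle). finite (supp \<nu>) \<and> card (supp \<nu>) = Suc m}"

definition coef_map :: "nat \<Rightarrow> complex measure \<Rightarrow> nat \<Rightarrow> complex" where
  "coef_map m \<nu> = (\<lambda>k\<in>{..<Suc m}. szego_coeff \<nu> k)"

lemma measurable_coef_map [measurable]: "coef_map m \<in> prob_algebra circle \<rightarrow>\<^sub>M coords (Suc m)"
  unfolding coef_map_def[abs_def] by measurable

text \<open>A measure with \<open>Suc m\<close> atoms depends measurably on its coefficients: its moments are explicit
  functions of them, and by trigonometric approximation so are the masses of closed sets.\<close>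

lemma measurable_reconstruction:
  "(\<lambda>\<nu>. \<nu>) \<in> vimage_algebra (good_measures m) (coef_map m) (coords (Suc m)) \<rightarrow>\<^sub>M prob_algebra circle"
    (is "_ \<in> ?V \<rightarrow>\<^sub>M _")
proof (rule measurable_prob_algebra_generated[OF sets_circle_closed Int_stable_closed_subsets])
  have good: "\<nu> \<in> space (prob_algebra circle)" "finite (supp \<nu>)" "card (supp \<nu>) = Suc m"
    if "\<nu> \<in> space ?V" for \<nu>
    using that by (auto simp: good_measures_def)
  have V: "coef_map m \<in> ?V \<rightarrow>\<^sub>M coords (Suc m)"
    by (intro measurable_vimage_algebra1) (auto simp: coef_map_def space_PiM)
  have mom: "(\<lambda>\<nu>. \<integral>z. z ^ i \<partial>\<nu>) \<in> borel_measurable ?V" for i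
  proof -
    have "(\<lambda>\<nu>. moment (coef_map m \<nu>) m i) \<in> borel_measurable ?V"
      by (rule measurable_compose[OF V measurable_moment])
    then show ?thesis
    proof (rule measurable_cong[THEN iffD2, rotated])
      fix \<nu> assume \<nu>: "\<nu> \<in> space ?V"
      have "moment (coef_map m \<nu>) m i = moment (szego_coeff \<nu>) m i"
        by (rule moment_cong) (simp add: coef_map_def)
      then show "(\<integral>z. z ^ i \<partial>\<nu>) = moment (coef_map m \<nu>) m i"
        using integral_power_eq_moment[OF good[OF \<nu>]] by simp
    qed
  qed
  have trig: "(\<lambda>\<nu>. \<integral>z. Re (poly p z) \<partial>\<nu>) \<in> borel_measurable ?V" for p
  proof -
    have [measurable]: "(\<lambda>\<nu>. Re (\<Sum>i\<le>degree p. coeff p i * (\<integral>z. z ^ i \<partial>\<nu>))) \<in> borel_measurable ?V"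
      using mom by measurable
    then show ?thesis
    proof (rule measurable_cong[THEN iffD2, rotated])
      fix \<nu> assume "\<nu> \<in> space ?V"
      note nu = prob_algebra_circleD[OF good(1)[OF this]]
      note int = integrable_circle_continuous[OF nu(4,2)]
      have "(\<integral>z. Re (poly p z) \<partial>\<nu>) = Re (\<integral>z. poly p z \<partial>\<nu>)"
        by (intro integral_Re int continuous_intros)
      also have "(\<integral>z. poly p z \<partial>\<nu>) = (\<Sum>i\<le>degree p. coeff p i * (\<integral>z. z ^ i \<partial>\<nu>))"
        unfolding poly_altdef
        by (subst Bochner_Integration.integral_sum) (auto intro!: int continuous_intros)
      finally show "(\<integral>z. Re (poly p z) \<partial>\<nu>) = Re (\<Sum>i\<le>degree p. coeff p i * (\<integral>z. z ^ i \<partial>\<nu>))" .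
    qed
  qed
  have cont: "(\<lambda>\<nu>. \<integral>z. g z \<partial>\<nu>) \<in> borel_measurable ?V" if g: "continuous_on (sphere 0 1) g" for g :: "complex \<Rightarrow> real"
  proof -
    have "\<exists>p. \<forall>z. cmod z = 1 \<longrightarrow> \<bar>g z - Re (poly p z)\<bar> < inverse (real (Suc l))" for l
      by (rule trigonometric_approximation[OF g]) simp
    then obtain p where p: "\<And>l z. cmod z = 1 \<Longrightarrow> \<bar>g z - Re (poly (p l) z)\<bar> < inverse (real (Suc l))"
      by metis
    \<comment> \<open>The approximating polynomials are chosen independently of the measure, so the
      integral is a pointwise limit of a single sequence of measurable functions.\<close>
    show ?thesis
    proof (rule borel_measurable_LIMSEQ_real)
      show "(\<lambda>\<nu>. \<integral>z. Re (poly (p l) z) \<partial>\<nu>) \<in> borel_measurable ?V" for l by (rule trig)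
      fix \<nu> assume "\<nu> \<in> space ?V"
      note nu = prob_algebra_circleD[OF good(1)[OF this]]
      interpret prob_space \<nu> by (rule nu)
      note int = integrable_circle_continuous[OF nu(4,2)]
      have "dist (\<integral>z. Re (poly (p l) z) \<partial>\<nu>) (\<integral>z. g z \<partial>\<nu>) \<le> inverse (real (Suc l))" for l
      proof -
        have "(\<integral>z. Re (poly (p l) z) \<partial>\<nu>) - (\<integral>z. g z \<partial>\<nu>) = (\<integral>z. Re (poly (p l) z) - g z \<partial>\<nu>)"
          by (rule Bochner_Integration.integral_diff[symmetric]) (intro int g continuous_intros)+
        also have "\<bar>\<dots>\<bar> \<le> (\<integral>z. \<bar>Re (poly (p l) z) - g z\<bar> \<partial>\<nu>)" by (rule integral_abs_bound)
        also have "\<dots> \<le> (\<integral>z. inverse (real (Suc l)) \<partial>\<nu>)"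
          using p[of _ l] by (intro integral_mono_AE int continuous_intros g AE_circleI[OF nu(2)])
            (auto simp: abs_minus_commute less_imp_le)
        finally show ?thesis by (simp add: dist_real_def prob_space)
      qed
      then show "(\<lambda>l. \<integral>z. Re (poly (p l) z) \<partial>\<nu>) \<longlonglongrightarrow> (\<integral>z. g z \<partial>\<nu>)"
        by (intro metric_tendsto_imp_tendsto[OF LIMSEQ_inverse_real_of_nat] always_eventually allI)
           (simp add: dist_real_def)
    qed
  qed
  fix F :: "complex set" assume F: "F \<in> {F. closed F \<and> F \<subseteq> sphere 0 1}"
  show "(\<lambda>\<nu>. emeasure \<nu> F) \<in> borel_measurable ?V"
  proof (cases "F = {}")
    case False
    have "(\<lambda>\<nu>. measure \<nu> F) \<in> borel_measurable ?V"
    proof (rule borel_measurable_LIMSEQ_real)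
      show "(\<lambda>\<nu>. \<integral>z. bump F k z \<partial>\<nu>) \<in> borel_measurable ?V" for k
        by (rule cont[OF continuous_on_bump])
      fix \<nu> assume "\<nu> \<in> space ?V"
      note nu = prob_algebra_circleD[OF good(1)[OF this]]
      show "(\<lambda>k. \<integral>z. bump F k z \<partial>\<nu>) \<longlonglongrightarrow> measure \<nu> F"
        using F False by (intro bump_tendsto_measure nu) auto
    qed
    then have "(\<lambda>\<nu>. ennreal (measure \<nu> F)) \<in> borel_measurable ?V" by measurable
    then show ?thesis
    proof (rule measurable_cong[THEN iffD2, rotated])
      fix \<nu> assume "\<nu> \<in> space ?V"
      then interpret finite_measure \<nu> using prob_algebra_circleD(4)[OF good(1)] by blast
      show "emeasure \<nu> F = ennreal (measure \<nu> F)" by (rule emeasure_eq_measure)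
    qed
  qed simp
qed (auto simp: good_measures_def space_prob_algebra)

text \<open>Because reconstruction is measurable, every event agrees on
  \<open>good_measures m\<close> with the preimage of an event about the coefficients; the law of
  the coefficients therefore fixes all probabilities.\<close>

lemma law_eqI:
  assumes L: "sets L = sets (prob_algebra circle)" "AE \<nu> in L. \<nu> \<in> good_measures m"
    and L': "sets L' = sets (prob_algebra circle)" "AE \<nu> in L'. \<nu> \<in> good_measures m"
    and eq: "distr L (coords (Suc m)) (coef_map m) = distr L' (coords (Suc m)) (coef_map m)"
  shows "L = L'"
proof (rule measure_eqI)
  fix W assume "W \<in> sets L"
  then have W: "W \<in> sets (prob_algebra circle)" by (simp add: L)
  let ?V = "vimage_algebra (good_measures m) (coef_map m) (coords (Suc m))"
  have "(\<lambda>\<nu>. \<nu>) -` W \<inter> space ?V \<in> sets ?V"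
    by (rule measurable_sets[OF measurable_reconstruction W])
  then have "W \<inter> good_measures m \<in> sets ?V" by simp
  then obtain W' where W': "W' \<in> sets (coords (Suc m))"
    "W \<inter> good_measures m = coef_map m -` W' \<inter> good_measures m"
    by (subst (asm) sets_vimage_algebra2) (auto simp: coef_map_def space_PiM)
  have *: "emeasure Q W = emeasure (distr Q (coords (Suc m)) (coef_map m)) W'"
    if Q: "sets Q = sets (prob_algebra circle)" "AE \<nu> in Q. \<nu> \<in> good_measures m" for Q
  proof -
    have m: "coef_map m \<in> Q \<rightarrow>\<^sub>M coords (Suc m)"
      using measurable_coef_map measurable_cong_sets[OF Q(1) refl] by blast
    have "emeasure Q W = emeasure Q (coef_map m -` W' \<inter> space Q)"
    proof (rule emeasure_eq_AE)
      show "AE \<nu> in Q. \<nu> \<in> W \<longleftrightarrow> \<nu> \<in> coef_map m -` W' \<inter> space Q"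
        using Q(2) AE_space by eventually_elim (use W'(2) in blast)
      show "W \<in> sets Q" using W Q(1) by simp
      show "coef_map m -` W' \<inter> space Q \<in> sets Q" by (rule measurable_sets[OF m W'(1)])
    qed
    then show ?thesis using m W'(1) by (simp add: emeasure_distr)
  qed
  show "emeasure L W = emeasure L' W"
    using *[OF L] *[OF L'] eq by simp
qed (simp add: L L')

lemma measurable_inverse_circle: "(\<lambda>u. 1 / u) \<in> circle \<rightarrow>\<^sub>M circle"
proof -
  have "(\<lambda>u::complex. 1 / u) \<in> borel_measurable circle"
    by (rule borel_measurable_circle_continuous) (auto intro!: continuous_intros)
  then show ?thesis
    by (subst (2) circle_def) (auto intro!: measurable_restrict_space2 simp: norm_divide)
qed

text \<open>Multiplication of the random point by u: it moves an atom at 1 to u and undoes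
  \<open>rotate_to_one\<close> at u.\<close>

definition rotate_by :: "complex \<Rightarrow> complex measure \<Rightarrow> complex measure" where
  "rotate_by u \<nu> = rotate_to_one \<nu> (1 / u)"

lemma measurable_rotate_by:
  "(\<lambda>(u, \<nu>). rotate_by u \<nu>) \<in> circle \<Otimes>\<^sub>M prob_algebra circle \<rightarrow>\<^sub>M prob_algebra circle"
proof -
  have "(\<lambda>p. (snd p, 1 / fst p)) \<in> circle \<Otimes>\<^sub>M prob_algebra circle \<rightarrow>\<^sub>M prob_algebra circle \<Otimes>\<^sub>M circle"
    by (intro measurable_Pair measurable_snd measurable_compose[OF measurable_fst measurable_inverse_circle])
  from measurable_compose[OF this rotate_measurable] show ?thesis
    by (simp add: rotate_by_def split_beta')
qed

lemma measurable_rotate_by_fixed: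
  assumes "cmod u = 1"
  shows "rotate_by u \<in> prob_algebra circle \<rightarrow>\<^sub>M prob_algebra circle"
proof -
  have "u \<in> space circle" using assms by simp
  from measurable_compose[OF measurable_Pair1'[OF this] measurable_rotate_by] show ?thesis by simp
qed

lemma rotate_by_space:
  "\<nu> \<in> space (prob_algebra circle) \<Longrightarrow> cmod u = 1 \<Longrightarrow> rotate_by u \<nu> \<in> space (prob_algebra circle)"
  unfolding rotate_by_def by (intro rotate_to_one_in_prob_algebra) (simp_all add: norm_divide)

context random_verblunsky
begin

lemma sets_law [simp]: "sets law = sets (prob_algebra circle)"
  by (simp add: law_def)

lemma space_law: "space law = space (prob_algebra circle)"
  by (simp add: law_def)

lemma AE_law_good: "AE \<nu> in law. \<nu> \<in> good_measures m"
proof -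
  have "AE \<nu> in law. finite (supp \<nu>) \<and> card (supp \<nu>) = Suc m"
    unfolding law_def using card_supp by (subst AE_distr_iff) simp_all
  then show ?thesis
    using AE_space by eventually_elim (simp add: good_measures_def space_law)
qed

lemma distr_law_coef_map: "distr law (coords (Suc m)) (coef_map m) = PiM {..<Suc m} D"
proof -
  have "coef_map m \<circ> \<mu> = coef" by (auto simp: coef_map_def coef_def fun_eq_iff)
  then show ?thesis
    unfolding law_def by (subst distr_distr) (simp_all add: law_coef)
qed

text \<open>A rotation multiplies the k-th coefficient by the constant u^(k+1), the simplest case of
  \<open>distr_skew\<close>, and \<open>law_eqI\<close> lifts the invariance from the coefficients
  to the measure.\<close>

lemma law_rotation_invariant:
  assumes u: "cmod u = 1"
  shows "distr law (prob_algebra circle) (rotate_by u) = law"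
proof (rule law_eqI[where m=m])
  have R: "rotate_by u \<in> law \<rightarrow>\<^sub>M prob_algebra circle"
    using measurable_rotate_by_fixed[OF u] measurable_cong_sets[OF sets_law refl] by blast
  have u0: "u \<noteq> 0" and u1: "cmod (1 / u) = 1" using u by (auto simp: norm_divide)
  have good: "rotate_by u \<nu> \<in> good_measures m" if "\<nu> \<in> good_measures m" for \<nu>
    using that rotate_by_space[OF _ u] card_supp_rotate_to_one[OF _ u1, of \<nu>]
    by (auto simp: good_measures_def rotate_by_def)
  have gm: "good_measures m \<in> sets (prob_algebra circle)"
    unfolding good_measures_def using measurable_finite_supp[of "Suc m"] by (rule predE)
  show "AE \<nu> in distr law (prob_algebra circle) (rotate_by u). \<nu> \<in> good_measures m"
    using AE_law_good R gm by (subst AE_distr_iff) (auto elim!: eventually_mono intro: good simp: good_measures_def[symmetric])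
  let ?u = "\<lambda>k (v :: nat \<Rightarrow> complex). u ^ Suc k"
  let ?T = "\<lambda>v. \<lambda>k\<in>{..<Suc m}. v k * ?u k v"
  have T: "?T \<in> coords (Suc m) \<rightarrow>\<^sub>M coords (Suc m)"
    by (intro measurable_restrict borel_measurable_times measurable_component_singleton) auto
  have cm: "coef_map m \<in> law \<rightarrow>\<^sub>M coords (Suc m)"
    using measurable_coef_map measurable_cong_sets[OF sets_law refl] by blast
  have "distr (distr law (prob_algebra circle) (rotate_by u)) (coords (Suc m)) (coef_map m) =
      distr law (coords (Suc m)) (coef_map m \<circ> rotate_by u)"
    using R by (intro distr_distr measurable_coef_map)
  also have "\<dots> = distr law (coords (Suc m)) (?T \<circ> coef_map m)"
  proof (rule distr_cong_AE)
    show "AE \<nu> in law. (coef_map m \<circ> rotate_by u) \<nu> = (?T \<circ> coef_map m) \<nu>"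
      using AE_law_good
    proof eventually_elim
      case (elim \<nu>)
      then have "szego_coeff (rotate_by u \<nu>) k = szego_coeff \<nu> k * u ^ Suc k" if "k < Suc m" for k
        using szego_coeff_rotate[OF _ _ u1, of \<nu> k] that u0
        by (simp add: good_measures_def rotate_by_def power_divide del: power_Suc)
      then show ?case by (auto simp: coef_map_def fun_eq_iff)
    qed
    show "coef_map m \<circ> rotate_by u \<in> law \<rightarrow>\<^sub>M coords (Suc m)"
      using R measurable_coef_map by (rule measurable_comp)
    show "?T \<circ> coef_map m \<in> law \<rightarrow>\<^sub>M coords (Suc m)"
      using cm T by (rule measurable_comp)
  qed simp_all
  also have "\<dots> = distr (distr law (coords (Suc m)) (coef_map m)) (coords (Suc m)) ?T"
    using cm T by (intro distr_distr[symmetric])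
  also have "\<dots> = PiM {..<Suc m} D"
    unfolding distr_law_coef_map
    by (rule distr_skew) (use u in \<open>simp_all add: norm_power norm_mult\<close>)
  also have "\<dots> = distr law (coords (Suc m)) (coef_map m)" by (rule distr_law_coef_map[symmetric])
  finally show "distr (distr law (prob_algebra circle) (rotate_by u)) (coords (Suc m)) (coef_map m) =
      distr law (coords (Suc m)) (coef_map m)" .
qed (simp_all add: AE_law_good)

end

section \<open>Biasing by small arcs\<close>

text \<open>Cutting out the arc by a half plane makes it measurable. The cosine decreases on
  [0, pi], whence the restriction on the angle.\<close>

lemma arc_around_one_eq:
  assumes "0 < \<epsilon>" "\<epsilon> < pi"
  shows "arc_around_one \<epsilon> = {z. Re z > cos \<epsilon>} \<inter> sphere 0 1"
proof (intro equalityI subsetI)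
  fix z assume "z \<in> arc_around_one \<epsilon>"
  then obtain \<theta> where \<theta>: "z = cis \<theta>" "- \<epsilon> < \<theta>" "\<theta> < \<epsilon>" by (auto simp: arc_around_one_def)
  have "cos \<epsilon> < cos \<bar>\<theta>\<bar>" using \<theta> assms by (intro cos_monotone_0_pi) auto
  then show "z \<in> {z. Re z > cos \<epsilon>} \<inter> sphere 0 1" using \<theta> by simp
next
  fix z assume z: "z \<in> {z. Re z > cos \<epsilon>} \<inter> sphere 0 1"
  then have z_eq: "z = cis (Arg z)"
  proof -
    have "z \<noteq> 0" using z by auto
    then show ?thesis using cis_Arg[of z] z by (simp add: sgn_eq)
  qed
  have "cos \<epsilon> < cos \<bar>Arg z\<bar>"
    using z arg_cong[OF z_eq, of Re] by simp
  moreover have "\<bar>Arg z\<bar> \<le> pi" using Arg_bounded[of z] by auto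
  ultimately have "\<bar>Arg z\<bar> < \<epsilon>"
    using cos_mono_less_eq[of \<epsilon> "\<bar>Arg z\<bar>"] assms by auto
  then show "z \<in> arc_around_one \<epsilon>"
    unfolding arc_around_one_def by (intro CollectI exI[of _ "Arg z"] conjI z_eq) auto
qed

lemma arc_in_sets_circle:
  assumes "0 < \<epsilon>" "\<epsilon> < pi"
  shows "arc_around_one \<epsilon> \<in> sets circle"
  unfolding arc_around_one_eq[OF assms] in_sets_circle
  by (auto intro!: sets.Int borel_open borel_closed open_Collect_less continuous_intros)

text \<open>Rotations of the arc by the multiples of \<open>\<epsilon>\<close> cover the circle. If
  the arc were null, so would be all of them and hence the whole circle.\<close>

lemma (in circle_uniform) emeasure_arc_pos:
  assumes \<epsilon>: "0 < \<epsilon>" "\<epsilon> < pi"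
  shows "emeasure U (arc_around_one \<epsilon>) \<noteq> 0"
proof
  let ?A = "arc_around_one \<epsilon>"
  note A = arc_in_sets_circle[OF \<epsilon>]
  assume 0: "emeasure U ?A = 0"
  have null: "AE z in U. cis (- (real k * \<epsilon>)) * z \<notin> ?A" for k :: nat
  proof -
    have ind: "(indicator ?A :: complex \<Rightarrow> ennreal) \<in> borel_measurable circle"
      using A by simp
    have "(\<integral>\<^sup>+z. indicator ?A (cis (- (real k * \<epsilon>)) * z) \<partial>U) = (\<integral>\<^sup>+z. indicator ?A z \<partial>U)"
      using ind by (intro nn_integral_rotation) simp_all
    also have "\<dots> = 0" using A 0 by simp
    finally have "AE z in U. indicator ?A (cis (- (real k * \<epsilon>)) * z) = (0 :: ennreal)"
      using measurable_compose[OF measurable_rotation ind, of "cis (- (real k * \<epsilon>))"]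
      by (subst (asm) nn_integral_0_iff_AE) simp_all
    then show ?thesis by eventually_elim (simp add: indicator_eq_0_iff)
  qed
  have "AE z in U. \<forall>k. cis (- (real k * \<epsilon>)) * z \<notin> ?A"
    by (subst AE_all_countable) (use null in blast)
  then have "AE z in U. False"
    using AE_space
  proof eventually_elim
    case (elim z)
    then have z: "cmod z = 1" by (simp add: space_U)
    define t where "t = Arg2pi z"
    have t: "0 \<le> t" "z = cis t"
      using Arg2pi_ge_0[of z] Arg2pi_eq[of z] z by (auto simp: t_def cis_conv_exp)
    \<comment> \<open>Rounding down leaves a remainder t - k \<open>\<epsilon>\<close> in [0,
      \<open>\<epsilon>\<close>), inside the open arc.\<close>
    define k where "k = nat \<lfloor>t / \<epsilon>\<rfloor>"
    have "real k = of_int \<lfloor>t / \<epsilon>\<rfloor>" using t(1) \<epsilon>(1) by (simp add: k_def)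
    then have "real k \<le> t / \<epsilon>" "t / \<epsilon> < real k + 1" by linarith+
    then have "real k * \<epsilon> \<le> t" "t < real k * \<epsilon> + \<epsilon>"
      using \<epsilon>(1) by (simp_all add: field_simps)
    moreover have "cis (- (real k * \<epsilon>)) * z = cis (t - real k * \<epsilon>)"
      by (simp add: t(2) cis_mult)
    ultimately have "cis (- (real k * \<epsilon>)) * z \<in> ?A"
      unfolding arc_around_one_def using \<epsilon>(1) by (intro CollectI exI[of _ "t - real k * \<epsilon>"]) auto
    then show False using elim by blast
  qed
  then show False by simp
qed

section \<open>Continuity of rotated measures in the rotation\<close>

text \<open>The rotation is moved into the integrand, where bounded convergence along sequences
  applies.\<close>

lemma continuous_on_rotation_integral:
  fixes g :: "complex \<Rightarrow> real"
  assumes \<nu>: "\<nu> \<in> space (prob_algebra circle)" and g: "continuous_on (sphere 0 1) g"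
  shows "continuous_on (sphere 0 1) (\<lambda>u. \<integral>z. g z \<partial>rotate_by u \<nu>)"
proof -
  note nu = prob_algebra_circleD[OF \<nu>]
  interpret prob_space \<nu> by (rule nu)
  have eq: "(\<integral>z. g z \<partial>rotate_by u \<nu>) = (\<integral>z. g (z * u) \<partial>\<nu>)" if "u \<in> sphere 0 1" for u
    using that unfolding rotate_by_def
    by (subst integral_rotate_to_one[OF \<nu>]) (auto simp: norm_divide intro!: borel_measurable_circle_continuous g)
  have gu: "continuous_on (sphere 0 1) (\<lambda>z. g (z * u))" if "cmod u = 1" for u
    using that by (intro continuous_on_compose2[OF g]) (auto intro!: continuous_intros simp: norm_mult)
  have "compact (g ` sphere 0 1)" by (intro compact_continuous_image g) auto
  then obtain B where B: "\<And>z. cmod z = 1 \<Longrightarrow> \<bar>g z\<bar> \<le> B"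
    using compact_imp_bounded by (fastforce simp: bounded_iff)
  have "continuous_on (sphere 0 1) (\<lambda>u. \<integral>z. g (z * u) \<partial>\<nu>)"
    unfolding continuous_on_sequentially
  proof (intro allI ballI impI, elim conjE)
    fix s :: "nat \<Rightarrow> complex" and u assume u: "u \<in> sphere 0 1" and s: "\<forall>n. s n \<in> sphere 0 1" and lim: "s \<longlonglongrightarrow> u"
    have "(\<lambda>n. \<integral>z. g (z * s n) \<partial>\<nu>) \<longlonglongrightarrow> (\<integral>z. g (z * u) \<partial>\<nu>)"
    proof (rule integral_dominated_convergence[where w="\<lambda>_. B"])
      show "(\<lambda>z. g (z * u)) \<in> borel_measurable \<nu>" "(\<lambda>z. g (z * s n)) \<in> borel_measurable \<nu>" for n
        using u s by (auto intro!: borel_measurable_sets_circle[OF nu(2)] gu)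
      show "AE z in \<nu>. (\<lambda>n. g (z * s n)) \<longlonglongrightarrow> g (z * u)"
      proof (rule AE_circleI[OF nu(2)])
        fix z :: complex assume z: "cmod z = 1"
        have "(\<lambda>n. z * s n) \<longlonglongrightarrow> z * u" by (intro tendsto_intros lim)
        then show "(\<lambda>n. g (z * s n)) \<longlonglongrightarrow> g (z * u)"
          using z u s by (intro continuous_on_tendsto_compose[OF g]) (auto simp: norm_mult)
      qed
      show "AE z in \<nu>. norm (g (z * s n)) \<le> B" for n
        using s B by (intro AE_circleI[OF nu(2)]) (simp add: norm_mult)
    qed simp
    then show "((\<lambda>u. \<integral>z. g (z * u) \<partial>\<nu>) \<circ> s) \<longlonglongrightarrow> (\<integral>z. g (z * u) \<partial>\<nu>)" by (simp add: comp_def)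
  qed
  then show ?thesis by (rule continuous_on_cong[THEN iffD1, OF refl, rotated]) (simp add: eq)
qed

text \<open>The weak topology is the initial one for integration against continuous functions, so
  continuity of the rotated measure in \<open>u\<close> can be tested on one function at a
  time.\<close>

lemma continuous_on_weak_rotation:
  fixes f :: "complex measure \<Rightarrow> real"
  assumes \<nu>: "\<nu> \<in> space (prob_algebra circle)" and f: "continuous_map weak_topology euclideanreal f"
  shows "continuous_on (sphere 0 1) (\<lambda>u. f (rotate_by u \<nu>))"
proof -
  have "continuous_map (top_of_set (sphere 0 1)) weak_topology (\<lambda>u. rotate_by u \<nu>)"
    unfolding weak_topology_def Let_def
  proof (rule continuous_map_pullback')
    show "continuous_map (top_of_set (sphere 0 1))
        (product_topology (\<lambda>_. euclideanreal) {g. continuous_on (sphere 0 1) g})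
        ((\<lambda>\<nu>. \<lambda>g\<in>{g. continuous_on (sphere 0 1) g}. \<integral>z. g z \<partial>\<nu>) \<circ> (\<lambda>u. rotate_by u \<nu>))"
      unfolding continuous_map_componentwise
      using continuous_on_rotation_integral[OF \<nu>] by (auto simp: comp_def)
    show "topspace (top_of_set (sphere 0 1)) \<subseteq> (\<lambda>u. rotate_by u \<nu>) -` space (prob_algebra circle)"
      using rotate_by_space[OF \<nu>] by auto
  qed
  from continuous_map_compose[OF this f] show ?thesis by (simp add: comp_def)
qed

section \<open>The Palm inversion formula and the limit of small arcs\<close>

context random_verblunsky
begin

text \<open>The inversion formula of Palm theory: a random measure with a point drawn from it has
  the law of the Palm measure turned by an independent uniform u, together with u. Turning measure
  and point simultaneously does not change their law; averaging over all turns and substituting u /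
  x for the turn moves the drawn point to 1.\<close>

lemma palm_inversion:
  assumes h: "h \<in> borel_measurable (prob_algebra circle \<Otimes>\<^sub>M circle)"
  shows "(\<integral>\<^sup>+\<nu>. (\<integral>\<^sup>+x. h (\<nu>, x) \<partial>\<nu>) \<partial>law) =
    (\<integral>\<^sup>+\<nu>. (\<integral>\<^sup>+u. h (rotate_by u \<nu>, u) \<partial>U) \<partial>palm_law law)"
proof -
  let ?P = "prob_algebra circle"
  have law: "law \<in> space (prob_algebra ?P)" by (rule law_in_space)
  interpret L: prob_space law using law by (simp add: space_prob_algebra)
  \<comment> \<open>The joint law of the random measure and the drawn point, the Campbell measure of
    \<open>law\<close>.\<close>
  define K where "K = law \<bind> (\<lambda>\<nu>. distr \<nu> (?P \<Otimes>\<^sub>M circle) (Pair \<nu>))"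
  have Kk: "(\<lambda>\<nu>. distr \<nu> (?P \<Otimes>\<^sub>M circle) (Pair \<nu>)) \<in> ?P \<rightarrow>\<^sub>M prob_algebra (?P \<Otimes>\<^sub>M circle)"
    by (rule measurable_distr_prob_space2[where M=circle]) simp_all
  have setsK: "sets K = sets (?P \<Otimes>\<^sub>M circle)" and probK: "prob_space K"
    unfolding K_def by (rule sets_bind'[OF law Kk], rule prob_space_bind'[OF law Kk])
  have spaceK: "space K = space (?P \<Otimes>\<^sub>M circle)" by (rule sets_eq_imp_space_eq[OF setsK])
  interpret K: prob_space K by (rule probK)
  interpret UK: pair_sigma_finite U K ..
  have nnK: "(\<integral>\<^sup>+p. F p \<partial>K) = (\<integral>\<^sup>+\<nu>. (\<integral>\<^sup>+x. F (\<nu>, x) \<partial>\<nu>) \<partial>law)"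
    if F: "F \<in> borel_measurable (?P \<Otimes>\<^sub>M circle)" for F
  proof -
    have k: "(\<lambda>\<nu>. distr \<nu> (?P \<Otimes>\<^sub>M circle) (Pair \<nu>)) \<in> law \<rightarrow>\<^sub>M subprob_algebra (?P \<Otimes>\<^sub>M circle)"
      using measurable_prob_algebraD[OF Kk] measurable_cong_sets[OF sets_law refl] by blast
    have "(\<integral>\<^sup>+p. F p \<partial>K) = (\<integral>\<^sup>+\<nu>. (\<integral>\<^sup>+p. F p \<partial>distr \<nu> (?P \<Otimes>\<^sub>M circle) (Pair \<nu>)) \<partial>law)"
      unfolding K_def by (rule nn_integral_bind[OF F k])
    also have "\<dots> = (\<integral>\<^sup>+\<nu>. (\<integral>\<^sup>+x. F (\<nu>, x) \<partial>\<nu>) \<partial>law)"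
    proof (rule nn_integral_cong)
      fix \<nu> assume "\<nu> \<in> space law"
      then have \<nu>: "\<nu> \<in> space ?P" by (simp add: space_law)
      have "Pair \<nu> \<in> \<nu> \<rightarrow>\<^sub>M ?P \<Otimes>\<^sub>M circle"
        using measurable_Pair1'[OF \<nu>] measurable_cong_sets[OF prob_algebra_circleD(2)[OF \<nu>] refl] by blast
      then show "(\<integral>\<^sup>+p. F p \<partial>distr \<nu> (?P \<Otimes>\<^sub>M circle) (Pair \<nu>)) = (\<integral>\<^sup>+x. F (\<nu>, x) \<partial>\<nu>)"
        by (rule nn_integral_distr) (use F in simp)
    qed
    finally show ?thesis .
  qed
  have fibre: "(\<lambda>\<nu>. \<integral>\<^sup>+x. F (\<nu>, x) \<partial>\<nu>) \<in> borel_measurable ?P"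
    if F: "F \<in> borel_measurable (?P \<Otimes>\<^sub>M circle)" for F :: "complex measure \<times> complex \<Rightarrow> ennreal"
  proof (rule nn_integral_measurable_subprob_algebra2[where N=circle])
    show "(\<lambda>\<nu>. \<nu>) \<in> ?P \<rightarrow>\<^sub>M subprob_algebra circle" by (rule measurable_prob_algebraD) simp
    show "(\<lambda>(\<nu>, x). F (\<nu>, x)) \<in> borel_measurable (?P \<Otimes>\<^sub>M circle)" using F by simp
  qed
  have mult: "(\<lambda>p. snd p * fst p) \<in> circle \<Otimes>\<^sub>M circle \<rightarrow>\<^sub>M circle"
  proof -
    have [measurable]: "fst \<in> borel_measurable (circle \<Otimes>\<^sub>M circle)" "snd \<in> borel_measurable (circle \<Otimes>\<^sub>M circle)"
      by (rule measurable_compose[OF measurable_fst measurable_id_circle],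
          rule measurable_compose[OF measurable_snd measurable_id_circle])
    have "(\<lambda>p. snd p * fst p) \<in> borel_measurable (circle \<Otimes>\<^sub>M circle)" by measurable
    then show ?thesis
      by (subst (3) circle_def) (auto intro!: measurable_restrict_space2 simp: space_pair_measure norm_mult)
  qed
  have turn: "(\<lambda>q. (rotate_by (fst q) (fst (snd q)), snd (snd q) * fst q)) \<in>
      circle \<Otimes>\<^sub>M (?P \<Otimes>\<^sub>M circle) \<rightarrow>\<^sub>M ?P \<Otimes>\<^sub>M circle"
  proof (rule measurable_Pair)
    have "(\<lambda>q. (fst q, fst (snd q))) \<in> circle \<Otimes>\<^sub>M (?P \<Otimes>\<^sub>M circle) \<rightarrow>\<^sub>M circle \<Otimes>\<^sub>M ?P" by measurable
    from measurable_compose[OF this measurable_rotate_by]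
    show "(\<lambda>q. rotate_by (fst q) (fst (snd q))) \<in> circle \<Otimes>\<^sub>M (?P \<Otimes>\<^sub>M circle) \<rightarrow>\<^sub>M ?P" by simp
    have "(\<lambda>q. (fst q, snd (snd q))) \<in> circle \<Otimes>\<^sub>M (?P \<Otimes>\<^sub>M circle) \<rightarrow>\<^sub>M circle \<Otimes>\<^sub>M circle" by measurable
    from measurable_compose[OF this mult]
    show "(\<lambda>q. snd (snd q) * fst q) \<in> circle \<Otimes>\<^sub>M (?P \<Otimes>\<^sub>M circle) \<rightarrow>\<^sub>M circle" by simp
  qed
  note turn_h = measurable_compose[OF turn h]
  \<comment> \<open>Turning the measure together with its point amounts to drawing from the turned
    measure, whose law is unchanged.\<close>
  have inv: "(\<integral>\<^sup>+p. h (rotate_by u (fst p), snd p * u) \<partial>K) = (\<integral>\<^sup>+\<nu>. (\<integral>\<^sup>+x. h (\<nu>, x) \<partial>\<nu>) \<partial>law)"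
    if u: "cmod u = 1" for u
  proof -
    have "u \<in> space circle" using u by simp
    then have "(\<lambda>p. h (rotate_by u (fst p), snd p * u)) \<in> borel_measurable (?P \<Otimes>\<^sub>M circle)"
      using measurable_compose[OF measurable_Pair1' turn_h, of u] by simp
    then have "(\<integral>\<^sup>+p. h (rotate_by u (fst p), snd p * u) \<partial>K) =
        (\<integral>\<^sup>+\<nu>. (\<integral>\<^sup>+x. h (rotate_by u \<nu>, x * u) \<partial>\<nu>) \<partial>law)"
      by (subst nnK) simp_all
    also have "\<dots> = (\<integral>\<^sup>+\<nu>. (\<integral>\<^sup>+x. h (rotate_by u \<nu>, x) \<partial>rotate_by u \<nu>) \<partial>law)"
    proof (rule nn_integral_cong)
      fix \<nu> assume "\<nu> \<in> space law"
      then have \<nu>: "\<nu> \<in> space ?P" by (simp add: space_law)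
      have "(\<lambda>x. h (rotate_by u \<nu>, x)) \<in> borel_measurable circle"
        by (rule measurable_compose[OF measurable_Pair1'[OF rotate_by_space[OF \<nu> u]] h])
      then show "(\<integral>\<^sup>+x. h (rotate_by u \<nu>, x * u) \<partial>\<nu>) = (\<integral>\<^sup>+x. h (rotate_by u \<nu>, x) \<partial>rotate_by u \<nu>)"
        using u nn_integral_rotate_to_one[OF \<nu>, of "1 / u" "\<lambda>x. h (rotate_by u \<nu>, x)"]
        by (simp add: rotate_by_def norm_divide)
    qed
    also have "\<dots> = (\<integral>\<^sup>+\<nu>. (\<integral>\<^sup>+x. h (\<nu>, x) \<partial>\<nu>) \<partial>distr law ?P (rotate_by u))"
    proof (rule nn_integral_distr[symmetric])
      show "rotate_by u \<in> law \<rightarrow>\<^sub>M ?P"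
        using measurable_rotate_by_fixed[OF u] measurable_cong_sets[OF sets_law refl] by blast
      show "(\<lambda>\<nu>. \<integral>\<^sup>+x. h (\<nu>, x) \<partial>\<nu>) \<in> borel_measurable (distr law ?P (rotate_by u))"
        using fibre[OF h] by simp
    qed
    finally show ?thesis by (simp add: law_rotation_invariant[OF u])
  qed
  define G where "G \<nu> = (\<integral>\<^sup>+u. h (rotate_by u \<nu>, u) \<partial>U)" for \<nu>
  have G: "G \<in> borel_measurable ?P"
  proof -
    have "(\<lambda>p. (rotate_by (snd p) (fst p), snd p)) \<in> ?P \<Otimes>\<^sub>M circle \<rightarrow>\<^sub>M ?P \<Otimes>\<^sub>M circle"
    proof (rule measurable_Pair)
      have "(\<lambda>p. (snd p, fst p)) \<in> ?P \<Otimes>\<^sub>M circle \<rightarrow>\<^sub>M circle \<Otimes>\<^sub>M ?P" by measurable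
      from measurable_compose[OF this measurable_rotate_by]
      show "(\<lambda>p. rotate_by (snd p) (fst p)) \<in> ?P \<Otimes>\<^sub>M circle \<rightarrow>\<^sub>M ?P" by simp
    qed measurable
    from measurable_compose[OF this h]
    have "(\<lambda>(\<nu>, u). h (rotate_by u \<nu>, u)) \<in> borel_measurable (?P \<Otimes>\<^sub>M U)"
      using measurable_cong_sets[OF sets_pair_measure_cong[OF refl U.sets_U] refl, of ?P borel]
      by (simp add: split_beta')
    then show ?thesis
      unfolding G_def[abs_def] by (rule U.borel_measurable_nn_integral)
  qed
  have "(\<integral>\<^sup>+\<nu>. (\<integral>\<^sup>+x. h (\<nu>, x) \<partial>\<nu>) \<partial>law) = (\<integral>\<^sup>+u. (\<integral>\<^sup>+\<nu>. (\<integral>\<^sup>+x. h (\<nu>, x) \<partial>\<nu>) \<partial>law) \<partial>U)"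
    by (simp add: U.emeasure_space_1)
  also have "\<dots> = (\<integral>\<^sup>+u. (\<integral>\<^sup>+p. h (rotate_by u (fst p), snd p * u) \<partial>K) \<partial>U)"
    by (intro nn_integral_cong inv[symmetric]) (simp add: U.space_U)
  also have "\<dots> = (\<integral>\<^sup>+p. (\<integral>\<^sup>+u. h (rotate_by u (fst p), snd p * u) \<partial>U) \<partial>K)"
  proof (rule UK.Fubini'[symmetric])
    show "(\<lambda>(u, p). h (rotate_by u (fst p), snd p * u)) \<in> borel_measurable (U \<Otimes>\<^sub>M K)"
      unfolding measurable_cong_sets[OF sets_pair_measure_cong[OF U.sets_U setsK] refl]
      using turn_h by (simp add: split_beta')
  qed
  also have "\<dots> = (\<integral>\<^sup>+p. G (rotate_to_one (fst p) (snd p)) \<partial>K)"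
  proof (rule nn_integral_cong)
    fix p assume "p \<in> space K"
    then obtain \<nu> x where p: "p = (\<nu>, x)" and \<nu>: "\<nu> \<in> space ?P" and x: "cmod x = 1"
      by (auto simp: spaceK space_pair_measure)
    have x0: "x \<noteq> 0" using x by auto
    have meas: "(\<lambda>u. h (rotate_by u (rotate_to_one \<nu> x), u)) \<in> borel_measurable circle"
    proof -
      have "(\<lambda>u. (rotate_by u (rotate_to_one \<nu> x), u)) \<in> circle \<rightarrow>\<^sub>M ?P \<Otimes>\<^sub>M circle"
      proof (rule measurable_Pair)
        have "(\<lambda>u. (u, rotate_to_one \<nu> x)) \<in> circle \<rightarrow>\<^sub>M circle \<Otimes>\<^sub>M ?P"
          using rotate_to_one_in_prob_algebra[OF \<nu> x] by simp
        from measurable_compose[OF this measurable_rotate_by]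
        show "(\<lambda>u. rotate_by u (rotate_to_one \<nu> x)) \<in> circle \<rightarrow>\<^sub>M ?P" by simp
      qed simp
      from measurable_compose[OF this h] show ?thesis .
    qed
    \<comment> \<open>In terms of the measure with x moved to 1, the turn is by x u, and x u is
      again uniform.\<close>
    have "(\<integral>\<^sup>+u. h (rotate_by u \<nu>, x * u) \<partial>U) =
        (\<integral>\<^sup>+u. (\<lambda>u. h (rotate_by u (rotate_to_one \<nu> x), u)) (x * u) \<partial>U)"
    proof (rule nn_integral_cong)
      fix u assume "u \<in> space U"
      then have u: "cmod u = 1" by (simp add: U.space_U)
      have "rotate_by (x * u) (rotate_to_one \<nu> x) = rotate_by u \<nu>"
        unfolding rotate_by_def using x0 u x
        by (subst rotate_rotate[OF \<nu>]) (simp_all add: norm_divide norm_mult)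
      then show "h (rotate_by u \<nu>, x * u) = (\<lambda>u. h (rotate_by u (rotate_to_one \<nu> x), u)) (x * u)" by simp
    qed
    also have "\<dots> = (\<integral>\<^sup>+u. h (rotate_by u (rotate_to_one \<nu> x), u) \<partial>U)"
      by (rule U.nn_integral_rotation[OF x meas])
    finally show "(\<integral>\<^sup>+u. h (rotate_by u (fst p), snd p * u) \<partial>U) = G (rotate_to_one (fst p) (snd p))"
      by (simp add: p G_def)
  qed
  also have "\<dots> = (\<integral>\<^sup>+\<nu>. (\<integral>\<^sup>+x. G (rotate_to_one \<nu> x) \<partial>\<nu>) \<partial>law)"
    using measurable_compose[OF rotate_measurable G] by (subst nnK) (simp_all add: split_beta')
  also have "\<dots> = (\<integral>\<^sup>+\<nu>. G \<nu> \<partial>palm_law law)"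
    by (rule nn_integral_palm_law[OF law G, symmetric])
  finally show ?thesis by (simp add: G_def)
qed

text \<open>The inversion formula is applied to the product of an event for the measure and the
  indicator of \<open>A\<close> at the drawn point. The mass of \<open>A\<close> used as bias
  becomes the restriction of the uniform turn to \<open>A\<close>.\<close>

lemma biased_law_eq:
  assumes A: "A \<in> sets circle" and pos: "emeasure U A \<noteq> 0"
  shows "biased_law law A =
    distr (uniform_measure U A \<Otimes>\<^sub>M palm_law law) (prob_algebra circle) (\<lambda>(u, \<nu>). rotate_by u \<nu>)"
proof (rule measure_eqI)
  let ?P = "prob_algebra circle"
  note sP = sets_palm_law[OF law_in_space]
  interpret P: prob_space "palm_law law" by (rule prob_space_palm_law[OF law_in_space])
  interpret UA: prob_space "uniform_measure U A"
    by (rule prob_space_uniform_measure) (use pos in simp_all)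
  interpret UP: pair_sigma_finite U "palm_law law" ..
  fix W assume "W \<in> sets (biased_law law A)"
  then have W: "W \<in> sets ?P" by (simp add: biased_law_def)
  have indA: "(indicator A :: complex \<Rightarrow> ennreal) \<in> borel_measurable circle" using A by simp
  have indW: "(indicator W :: complex measure \<Rightarrow> ennreal) \<in> borel_measurable ?P" using W by simp
  have key: "(\<integral>\<^sup>+\<nu>. indicator V \<nu> * emeasure \<nu> A \<partial>law) =
      (\<integral>\<^sup>+\<nu>. (\<integral>\<^sup>+u. indicator V (rotate_by u \<nu>) * indicator A u \<partial>U) \<partial>palm_law law)"
    if V: "V \<in> sets ?P" for V
  proof -
    have h: "(\<lambda>p. indicator V (fst p) * indicator A (snd p) :: ennreal) \<in> borel_measurable (?P \<Otimes>\<^sub>M circle)"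
      using V A by measurable
    have "(\<integral>\<^sup>+\<nu>. indicator V \<nu> * emeasure \<nu> A \<partial>law) = (\<integral>\<^sup>+\<nu>. (\<integral>\<^sup>+x. indicator V \<nu> * indicator A x \<partial>\<nu>) \<partial>law)"
    proof (rule nn_integral_cong)
      fix \<nu> assume "\<nu> \<in> space law"
      then have "A \<in> sets \<nu>" using prob_algebra_circleD(2)[of \<nu>] A by (simp add: space_law)
      then show "indicator V \<nu> * emeasure \<nu> A = (\<integral>\<^sup>+x. indicator V \<nu> * indicator A x \<partial>\<nu>)"
        by (simp add: nn_integral_cmult_indicator)
    qed
    then show ?thesis using palm_inversion[OF h] by simp
  qed
  \<comment> \<open>The normalising constant is the case of the sure event.\<close>
  have total: "(\<integral>\<^sup>+\<nu>. emeasure \<nu> A \<partial>law) = emeasure U A"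
  proof -
    have "(\<integral>\<^sup>+\<nu>. emeasure \<nu> A \<partial>law) = (\<integral>\<^sup>+\<nu>. indicator (space ?P) \<nu> * emeasure \<nu> A \<partial>law)"
      by (intro nn_integral_cong) (simp add: space_law)
    also have "\<dots> = (\<integral>\<^sup>+\<nu>. (\<integral>\<^sup>+u. indicator (space ?P) (rotate_by u \<nu>) * indicator A u \<partial>U) \<partial>palm_law law)"
      by (rule key[OF sets.top])
    also have "\<dots> = (\<integral>\<^sup>+\<nu>. (\<integral>\<^sup>+u. indicator A u \<partial>U) \<partial>palm_law law)"
    proof (intro nn_integral_cong)
      fix \<nu> u assume "\<nu> \<in> space (palm_law law)" "u \<in> space U"
      then have "rotate_by u \<nu> \<in> space ?P"
        using sets_eq_imp_space_eq[OF sP] by (intro rotate_by_space) (simp_all add: U.space_U)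
      then show "indicator (space ?P) (rotate_by u \<nu>) * indicator A u = (indicator A u :: ennreal)" by simp
    qed
    also have "\<dots> = emeasure U A" using A by (simp add: P.emeasure_space_1)
    finally show ?thesis .
  qed
  have rot: "(\<lambda>(u, \<nu>). rotate_by u \<nu>) \<in> uniform_measure U A \<Otimes>\<^sub>M palm_law law \<rightarrow>\<^sub>M ?P"
  proof -
    have "sets (uniform_measure U A \<Otimes>\<^sub>M palm_law law) = sets (circle \<Otimes>\<^sub>M ?P)"
      by (intro sets_pair_measure_cong sP) simp
    then show ?thesis using measurable_rotate_by measurable_cong_sets[OF _ refl] by blast
  qed
  have rotW: "(\<lambda>p. indicator W (rotate_by (fst p) (snd p)) :: ennreal) \<in> borel_measurable (circle \<Otimes>\<^sub>M palm_law law)"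
    unfolding measurable_cong_sets[OF sets_pair_measure_cong[OF refl sP] refl]
    using measurable_compose[OF measurable_rotate_by indW] by (simp add: split_beta')
  have inner: "(\<lambda>u. \<integral>\<^sup>+\<nu>. indicator W (rotate_by u \<nu>) \<partial>palm_law law) \<in> borel_measurable circle"
    using rotW by (intro P.borel_measurable_nn_integral) (simp add: split_beta')
  have emA: "(\<lambda>\<nu>. emeasure \<nu> A) \<in> borel_measurable law"
  proof -
    have "(\<lambda>\<nu>. \<nu>) \<in> ?P \<rightarrow>\<^sub>M subprob_algebra circle" by (rule measurable_prob_algebraD) simp
    from measurable_compose[OF this measurable_emeasure_subprob_algebra[OF A]]
    show ?thesis unfolding measurable_cong_sets[OF sets_law refl] .
  qed
  have "emeasure (biased_law law A) W = (\<integral>\<^sup>+\<nu>. emeasure \<nu> A / emeasure U A * indicator W \<nu> \<partial>law)"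
    unfolding biased_law_def total using emA W by (intro emeasure_density) simp_all
  also have "\<dots> = (\<integral>\<^sup>+\<nu>. (indicator W \<nu> * emeasure \<nu> A) / emeasure U A \<partial>law)"
    by (intro nn_integral_cong) (simp add: divide_ennreal_def mult_ac)
  also have "\<dots> = (\<integral>\<^sup>+\<nu>. indicator W \<nu> * emeasure \<nu> A \<partial>law) / emeasure U A"
  proof (rule nn_integral_divide)
    have "(indicator W :: complex measure \<Rightarrow> ennreal) \<in> borel_measurable law"
      unfolding measurable_cong_sets[OF sets_law refl] by (rule indW)
    then show "(\<lambda>\<nu>. indicator W \<nu> * emeasure \<nu> A) \<in> borel_measurable law"
      using emA by (rule borel_measurable_times_ennreal)
  qed
  also have "\<dots> = (\<integral>\<^sup>+\<nu>. (\<integral>\<^sup>+u. indicator W (rotate_by u \<nu>) * indicator A u \<partial>U) \<partial>palm_law law) / emeasure U A"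
    by (simp only: key[OF W])
  also have "(\<integral>\<^sup>+\<nu>. (\<integral>\<^sup>+u. indicator W (rotate_by u \<nu>) * indicator A u \<partial>U) \<partial>palm_law law) =
      (\<integral>\<^sup>+u. (\<integral>\<^sup>+\<nu>. indicator W (rotate_by u \<nu>) * indicator A u \<partial>palm_law law) \<partial>U)"
  proof (rule UP.Fubini')
    have "(\<lambda>p. indicator W (rotate_by (fst p) (snd p)) * indicator A (fst p) :: ennreal) \<in>
        borel_measurable (circle \<Otimes>\<^sub>M palm_law law)"
      by (intro borel_measurable_times_ennreal rotW measurable_compose[OF measurable_fst indA])
    then show "(\<lambda>(u, \<nu>). indicator W (rotate_by u \<nu>) * indicator A u :: ennreal) \<in>
        borel_measurable (U \<Otimes>\<^sub>M palm_law law)"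
      using measurable_cong_sets[OF sets_pair_measure_cong[OF U.sets_U refl] refl, of "palm_law law" borel]
      by (simp add: split_beta')
  qed
  also have "\<dots> = (\<integral>\<^sup>+u. (\<integral>\<^sup>+\<nu>. indicator W (rotate_by u \<nu>) \<partial>palm_law law) * indicator A u \<partial>U)"
  proof (rule nn_integral_cong)
    fix u assume "u \<in> space U"
    then have "(\<lambda>\<nu>. indicator W (rotate_by u \<nu>) :: ennreal) \<in> borel_measurable (palm_law law)"
      using measurable_compose[OF measurable_Pair1' rotW, of u] by (simp add: U.space_U)
    then show "(\<integral>\<^sup>+\<nu>. indicator W (rotate_by u \<nu>) * indicator A u \<partial>palm_law law) =
        (\<integral>\<^sup>+\<nu>. indicator W (rotate_by u \<nu>) \<partial>palm_law law) * indicator A u"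
      by (rule nn_integral_multc)
  qed
  also have "\<dots> / emeasure U A =
      (\<integral>\<^sup>+u. (\<integral>\<^sup>+\<nu>. indicator W (rotate_by u \<nu>) \<partial>palm_law law) \<partial>uniform_measure U A)"
    using inner A by (subst nn_integral_uniform_measure) simp_all
  also have "\<dots> = (\<integral>\<^sup>+p. indicator W (rotate_by (fst p) (snd p)) \<partial>(uniform_measure U A \<Otimes>\<^sub>M palm_law law))"
  proof -
    have "(\<lambda>p. indicator W (rotate_by (fst p) (snd p)) :: ennreal) \<in>
        borel_measurable (uniform_measure U A \<Otimes>\<^sub>M palm_law law)"
      using measurable_compose[OF rot indW] by (simp add: split_beta')
    from P.nn_integral_fst[OF this] show ?thesis by simp
  qed
  also have "\<dots> = emeasure (distr (uniform_measure U A \<Otimes>\<^sub>M palm_law law) ?P (\<lambda>(u, \<nu>). rotate_by u \<nu>)) W"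
    using rot W by (simp add: nn_integral_indicator[symmetric] nn_integral_distr split_beta' del: nn_integral_indicator)
  finally show "emeasure (biased_law law A) W =
      emeasure (distr (uniform_measure U A \<Otimes>\<^sub>M palm_law law) ?P (\<lambda>(u, \<nu>). rotate_by u \<nu>)) W" .
qed (simp add: biased_law_def)

text \<open>By \<open>biased_law_eq\<close> the integral is the average over the arc of a continuous
  function of the turn, and its value at 1 is the integral against the Palm law.\<close>

lemma biased_law_tendsto:
  fixes f :: "complex measure \<Rightarrow> real"
  assumes f: "continuous_map weak_topology euclideanreal f" and meas: "f \<in> borel_measurable (prob_algebra circle)"
    and B: "\<And>\<nu>. \<nu> \<in> space (prob_algebra circle) \<Longrightarrow> \<bar>f \<nu>\<bar> \<le> B"
  shows "((\<lambda>\<epsilon>. \<integral>\<nu>. f \<nu> \<partial>biased_law law (arc_around_one \<epsilon>)) \<longlongrightarrow> (\<integral>\<nu>. f \<nu> \<partial>palm_law law)) (at_right 0)"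
proof -
  let ?P = "prob_algebra circle"
  note sP = sets_palm_law[OF law_in_space]
  note spP = sets_eq_imp_space_eq[OF sP]
  interpret P: prob_space "palm_law law" by (rule prob_space_palm_law[OF law_in_space])
  define \<phi> where "\<phi> u = (\<integral>\<nu>. f (rotate_by u \<nu>) \<partial>palm_law law)" for u
  have rot_meas: "(\<lambda>\<nu>. f (rotate_by u \<nu>)) \<in> borel_measurable (palm_law law)" if "cmod u = 1" for u
    unfolding measurable_cong_sets[OF sP refl]
    by (rule measurable_compose[OF measurable_rotate_by_fixed[OF that] meas])
  have bound: "\<bar>f (rotate_by u \<nu>)\<bar> \<le> B" if "cmod u = 1" "\<nu> \<in> space (palm_law law)" for u \<nu>
    using that by (intro B rotate_by_space) (simp_all add: spP)
  have cont: "continuous_on (sphere 0 1) \<phi>"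
    unfolding continuous_on_sequentially
  proof (intro allI ballI impI, elim conjE)
    fix s :: "nat \<Rightarrow> complex" and u assume u: "u \<in> sphere 0 1" and s: "\<forall>n. s n \<in> sphere 0 1" and lim: "s \<longlonglongrightarrow> u"
    have "(\<lambda>n. \<phi> (s n)) \<longlonglongrightarrow> \<phi> u"
      unfolding \<phi>_def
    proof (rule integral_dominated_convergence[where w="\<lambda>_. B"])
      show "(\<lambda>\<nu>. f (rotate_by u \<nu>)) \<in> borel_measurable (palm_law law)"
        "(\<lambda>\<nu>. f (rotate_by (s n) \<nu>)) \<in> borel_measurable (palm_law law)" for n
        using u s by (simp_all add: rot_meas)
      show "AE \<nu> in palm_law law. (\<lambda>n. f (rotate_by (s n) \<nu>)) \<longlonglongrightarrow> f (rotate_by u \<nu>)"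
      proof (rule AE_I2)
        fix \<nu> assume "\<nu> \<in> space (palm_law law)"
        then have "continuous_on (sphere 0 1) (\<lambda>u. f (rotate_by u \<nu>))"
          by (intro continuous_on_weak_rotation f) (simp add: spP)
        then show "(\<lambda>n. f (rotate_by (s n) \<nu>)) \<longlonglongrightarrow> f (rotate_by u \<nu>)"
          using u s lim by (elim continuous_on_tendsto_compose) simp_all
      qed
      show "AE \<nu> in palm_law law. norm (f (rotate_by (s n) \<nu>)) \<le> B" for n
        using s by (intro AE_I2) (simp add: bound)
    qed simp
    then show "(\<phi> \<circ> s) \<longlonglongrightarrow> \<phi> u" by (simp add: comp_def)
  qed
  have \<phi>1: "\<phi> 1 = (\<integral>\<nu>. f \<nu> \<partial>palm_law law)"
    unfolding \<phi>_def
    by (intro Bochner_Integration.integral_cong refl) (simp add: rotate_by_def rotate_1 spP)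
  have eq: "(\<integral>\<nu>. f \<nu> \<partial>biased_law law A) = (\<integral>u. \<phi> u \<partial>uniform_measure U A)"
    if A: "A \<in> sets circle" "emeasure U A \<noteq> 0" for A
  proof -
    interpret UA: prob_space "uniform_measure U A"
      by (rule prob_space_uniform_measure) (use A in simp_all)
    interpret UP: pair_sigma_finite "uniform_measure U A" "palm_law law" ..
    interpret UPp: prob_space "uniform_measure U A \<Otimes>\<^sub>M palm_law law"
      by (rule prob_space_pair[OF UA.prob_space_axioms P.prob_space_axioms])
    have sUP: "sets (uniform_measure U A \<Otimes>\<^sub>M palm_law law) = sets (circle \<Otimes>\<^sub>M ?P)"
      by (intro sets_pair_measure_cong sP) simp
    have rot: "(\<lambda>(u, \<nu>). rotate_by u \<nu>) \<in> uniform_measure U A \<Otimes>\<^sub>M palm_law law \<rightarrow>\<^sub>M ?P"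
      unfolding measurable_cong_sets[OF sUP refl] by (rule measurable_rotate_by)
    have int: "integrable (uniform_measure U A \<Otimes>\<^sub>M palm_law law) (\<lambda>p. f (rotate_by (fst p) (snd p)))"
    proof (rule UPp.integrable_const_bound[where B=B])
      show "(\<lambda>p. f (rotate_by (fst p) (snd p))) \<in> borel_measurable (uniform_measure U A \<Otimes>\<^sub>M palm_law law)"
        using measurable_compose[OF rot meas] by (simp add: split_beta')
      show "AE p in uniform_measure U A \<Otimes>\<^sub>M palm_law law. norm (f (rotate_by (fst p) (snd p))) \<le> B"
        by (intro AE_I2) (auto simp: space_pair_measure U.space_U intro!: bound)
    qed
    have "(\<integral>\<nu>. f \<nu> \<partial>biased_law law A) =
        (\<integral>p. f (rotate_by (fst p) (snd p)) \<partial>(uniform_measure U A \<Otimes>\<^sub>M palm_law law))"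
      unfolding biased_law_eq[OF A] by (subst integral_distr[OF rot meas]) (simp add: split_beta')
    also have "\<dots> = (\<integral>u. (\<integral>\<nu>. f (rotate_by (fst (u, \<nu>)) (snd (u, \<nu>))) \<partial>palm_law law) \<partial>uniform_measure U A)"
      by (rule UP.integral_fst'[OF int, symmetric])
    finally show ?thesis by (simp add: \<phi>_def)
  qed
  show ?thesis
  proof (rule tendstoI)
    fix e :: real assume e: "e > 0"
    have "continuous_on UNIV (\<lambda>\<theta>. \<phi> (cis \<theta>))"
      by (intro continuous_on_compose2[OF cont]) (auto intro!: continuous_intros)
    then have "isCont (\<lambda>\<theta>. \<phi> (cis \<theta>)) 0" by (simp add: continuous_on_eq_continuous_at)
    from this[unfolded continuous_at_eps_delta, rule_format, OF half_gt_zero[OF e]]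
    obtain d where "d > 0" "\<forall>\<theta>. dist \<theta> 0 < d \<longrightarrow> dist (\<phi> (cis \<theta>)) (\<phi> (cis 0)) < e / 2"
      by blast
    then have d: "d > 0" "\<And>\<theta>. \<bar>\<theta>\<bar> < d \<Longrightarrow> \<bar>\<phi> (cis \<theta>) - \<phi> 1\<bar> < e / 2"
      by (simp_all add: dist_real_def)
    \<comment> \<open>\<open>d\<close> comes from continuity at angle 0; below pi the arc is known
      to be measurable and of positive mass.\<close>
    have "dist (\<integral>\<nu>. f \<nu> \<partial>biased_law law (arc_around_one \<epsilon>)) (\<integral>\<nu>. f \<nu> \<partial>palm_law law) < e"
      if \<epsilon>: "0 < \<epsilon>" "\<epsilon> < min d pi" for \<epsilon>
    proof -
      let ?A = "arc_around_one \<epsilon>"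
      have A: "?A \<in> sets circle" "emeasure U ?A \<noteq> 0"
        using arc_in_sets_circle[of \<epsilon>] U.emeasure_arc_pos[of \<epsilon>] \<epsilon> by simp_all
      let ?UA = "uniform_measure U ?A"
      interpret UA: prob_space ?UA
        by (rule prob_space_uniform_measure) (use A in simp_all)
      have UA_1: "measure ?UA (space U) = 1" using UA.prob_space by simp
      have int: "integrable ?UA \<phi>"
        by (rule integrable_circle_continuous[OF UA.finite_measure_axioms _ cont]) simp
      have "(\<integral>u. \<phi> u \<partial>?UA) - \<phi> 1 = (\<integral>u. \<phi> u - \<phi> 1 \<partial>?UA)"
        using int by (simp add: UA_1)
      also have "\<bar>\<dots>\<bar> \<le> (\<integral>u. \<bar>\<phi> u - \<phi> 1\<bar> \<partial>?UA)" by (rule integral_abs_bound)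
      also have "\<dots> \<le> (\<integral>u. e / 2 \<partial>?UA)"
      proof (rule integral_mono_AE)
        show "AE u in ?UA. \<bar>\<phi> u - \<phi> 1\<bar> \<le> e / 2"
        proof (rule AE_uniform_measureI)
          show "?A \<in> sets U" using A by simp
          have "\<bar>\<phi> u - \<phi> 1\<bar> \<le> e / 2" if u: "u \<in> ?A" for u
          proof -
            obtain \<theta> where "u = cis \<theta>" "- \<epsilon> < \<theta>" "\<theta> < \<epsilon>" using u by (auto simp: arc_around_one_def)
            then show ?thesis using d(2)[of \<theta>] \<epsilon> by (simp add: abs_less_iff less_imp_le)
          qed
          then show "AE u in U. u \<in> ?A \<longrightarrow> \<bar>\<phi> u - \<phi> 1\<bar> \<le> e / 2" by simp
        qed
      qed (use int in simp_all)
      also have "\<dots> = e / 2" by (simp add: UA_1)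
      finally show ?thesis
        using e unfolding eq[OF A] \<phi>1[symmetric] by (simp add: dist_real_def)
    qed
    then show "\<forall>\<^sub>F \<epsilon> in at_right 0. dist (\<integral>\<nu>. f \<nu> \<partial>biased_law law (arc_around_one \<epsilon>)) (\<integral>\<nu>. f \<nu> \<partial>palm_law law) < e"
      unfolding eventually_at_right_field using d(1) by (intro exI[of _ "min d pi"]) simp
  qed
qed

text \<open>For a non-measurable \<open>f\<close> all the integrals have the junk value 0.\<close>

lemma converges_to_palm_law:
  "converges_in_distribution (\<lambda>\<epsilon>. biased_law law (arc_around_one \<epsilon>)) (palm_law law) (at_right 0)"
  unfolding converges_in_distribution_def
proof (intro allI impI, elim conjE)
  fix f :: "complex measure \<Rightarrow> real"
  assume f: "continuous_map weak_topology euclideanreal f" and "bounded (f ` space (prob_algebra circle))"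
  then obtain B where B: "\<And>\<nu>. \<nu> \<in> space (prob_algebra circle) \<Longrightarrow> \<bar>f \<nu>\<bar> \<le> B"
    by (auto simp: bounded_iff)
  show "((\<lambda>\<epsilon>. \<integral>\<nu>. f \<nu> \<partial>biased_law law (arc_around_one \<epsilon>)) \<longlongrightarrow> (\<integral>\<nu>. f \<nu> \<partial>palm_law law)) (at_right 0)"
  proof (cases "f \<in> borel_measurable (prob_algebra circle)")
    case True
    then show ?thesis by (rule biased_law_tendsto[OF f _ B])
  next
    case False
    have "(\<integral>\<nu>. f \<nu> \<partial>L) = 0" if L: "sets L = sets (prob_algebra circle)" for L
    proof (rule not_integrable_integral_eq)
      have "f \<notin> borel_measurable L" using False measurable_cong_sets[OF L refl] by blast
      then show "\<not> integrable L f" using borel_measurable_integrable by blast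
    qed
    then have "(\<integral>\<nu>. f \<nu> \<partial>biased_law law A) = 0" "(\<integral>\<nu>. f \<nu> \<partial>palm_law law) = 0" for A
      by (simp_all add: biased_law_def sets_palm_law[OF law_in_space])
    then show ?thesis by simp
  qed
qed

end

section \<open>From independent coefficients to the product law\<close>

lemma rotationally_invariant_return_0: "rotationally_invariant (return borel 0)"
  unfolding rotationally_invariant_def by (auto simp: distr_return)

theorem proposition5:
  fixes M :: "'w measure" and \<mu> :: "'w \<Rightarrow> complex measure" and n :: nat
    and \<gamma> \<gamma>' :: "nat \<Rightarrow> 'w \<Rightarrow> complex" and law :: "complex measure measure"
  defines "\<gamma> \<equiv> \<lambda>i \<omega>. modified_verblunsky (\<mu> \<omega>) i"
    and "\<gamma>' \<equiv> \<lambda>i \<omega>. if i < n - 1 then - \<gamma> i \<omega> * ((1 - cnj (\<gamma> i \<omega>)) / (1 - \<gamma> i \<omega>)) else 1"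
    and "law \<equiv> distr M (prob_algebra circle) \<mu>"
  assumes "prob_space M"
    and "\<mu> \<in> M \<rightarrow>\<^sub>M prob_algebra circle"
    and "AE \<omega> in M. finite (supp (\<mu> \<omega>)) \<and> card (supp (\<mu> \<omega>)) = n"
    and "prob_space.indep_vars M (\<lambda>_. borel) \<gamma> {..<n}"
    and "\<And>i. i < n \<Longrightarrow> rotationally_invariant (distr M borel (\<gamma> i))"
  shows "converges_in_distribution (\<lambda>\<epsilon>. biased_law law (arc_around_one \<epsilon>)) (palm_law law)
           (at_right 0) \<and>
         distr (palm_law law) (\<Pi>\<^sub>M i\<in>{..<n}. borel)
           (\<lambda>\<nu>. \<lambda>i\<in>{..<n}. modified_verblunsky \<nu> i) =
         distr M (\<Pi>\<^sub>M i\<in>{..<n}. borel) (\<lambda>\<omega>. \<lambda>i\<in>{..<n}. \<gamma>' i \<omega>)"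
proof -
  interpret prob_space M by fact
  note mu = assms(5)
  have AE_n: "AE \<omega> in M. finite (supp (\<mu> \<omega>)) \<and> card (supp (\<mu> \<omega>)) = n" by fact
  \<comment> \<open>A probability measure gives full mass to its support, so the support is not
    empty. Positivity of n also makes the index set nonempty where independence is turned into a
    product law.\<close>
  have "n \<noteq> 0"
  proof
    assume "n = 0"
    have "AE \<omega> in M. False"
      using AE_n AE_space
    proof eventually_elim
      case (elim \<omega>)
      note nu = prob_algebra_circleD[OF measurable_space[OF mu elim(2)]]
      interpret nu: prob_space "\<mu> \<omega>" by (rule nu)
      have "supp (\<mu> \<omega>) = {}" using elim \<open>n = 0\<close> by auto
      then have "AE z in \<mu> \<omega>. False" using compl_supp[OF nu(2)] by simp
      then show ?case by simp
    qed
    then show False by simp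
  qed
  then obtain m where n: "n = Suc m" by (cases n) auto
  \<comment> \<open>The locale asks for rotation invariant laws at every index; beyond n the point
    mass at 0, fixed by all rotations, fills the family.\<close>
  define D where "D i = (if i < n then distr M borel (\<gamma> i) else return borel 0)" for i
  have gamma_meas: "\<gamma> i \<in> borel_measurable M" for i
    unfolding \<gamma>_def by (rule measurable_compose[OF mu measurable_modified_verblunsky])
  interpret random_verblunsky M D \<mu> m
  proof (intro random_verblunsky.intro rotational_family.intro random_verblunsky_axioms.intro)
    show "prob_space M" by fact
    show "prob_space (D i)" for i
      unfolding D_def using gamma_meas by (auto intro!: prob_space_distr prob_space_return)
    show "sets (D i) = sets borel" for i by (simp add: D_def)
    show "rotationally_invariant (D i)" for i
      using assms(8) rotationally_invariant_return_0 by (simp add: D_def)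
    show "\<mu> \<in> M \<rightarrow>\<^sub>M prob_algebra circle" by fact
    show "AE \<omega> in M. finite (supp (\<mu> \<omega>)) \<and> card (supp (\<mu> \<omega>)) = Suc m"
      using AE_n by (simp add: n)
    \<comment> \<open>Independence in the form of an equation between the joint law and the product
      of the marginals.\<close>
    have "distr M (PiM {..<n} (\<lambda>_. borel)) (\<lambda>\<omega>. \<lambda>i\<in>{..<n}. \<gamma> i \<omega>) = PiM {..<n} (\<lambda>i. distr M borel (\<gamma> i))"
      using assms(7) \<open>n \<noteq> 0\<close> gamma_meas by (subst (asm) indep_vars_iff_distr_eq_PiM') auto
    also have "\<dots> = PiM {..<n} D" by (intro PiM_cong) (simp_all add: D_def)
    finally show "distr M (coords (Suc m)) (\<lambda>\<omega>. \<lambda>k\<in>{..<Suc m}. modified_verblunsky (\<mu> \<omega>) k) = PiM {..<Suc m} D"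
      by (simp add: n \<gamma>_def)
  qed
  have law_eq: "law = random_verblunsky.law M \<mu>"
    unfolding assms(3) by (simp add: law_def)
  have "(\<lambda>\<omega>. \<lambda>i\<in>{..<n}. \<gamma>' i \<omega>) =
      (\<lambda>\<omega>. \<lambda>i\<in>{..<Suc m}. if i < m then palm_flip (modified_verblunsky (\<mu> \<omega>) i) else 1)"
    by (auto simp: fun_eq_iff \<gamma>'_def \<gamma>_def n palm_flip_def)
  then show ?thesis
    using converges_to_palm_law distr_palm_law by (simp add: law_eq n)
qed

end
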